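(* Let $x,y,z$ be non-negative integers. (i) For all non-negative integers $a,b$, $$M(H^{(8)}_{x,y,z}(a,b))=\frac{P_{y,y+2a-2,b}\,P'_{z+b-1,z+b-1,a}\,K'(a,b,x,y+z)}{P'_{y+z+b-1,y+z+b-1,a}}\cdot\frac{V(2a+2b+1,y+z-1,y)}{V(2x+2a+2b+1,y+z-1,y)}\cdot\frac{T(x+b+1,y+z+2a-2,y)\,T(2a+b,y+b-1,b)\,T(z+1,y+b-1,b)}{T(b+1,y+z+2a-2,y)\,T(x+2a+b,y+b-1,b)\,T(x+z+1,y+b-1,b)}.$$ (ii) For every $k\ge 2$ and every sequence $\mathbf a=(a_1,\dots,a_{2k})$ of non-negative integers, write $\mathrm O=\mathrm O(\mathbf a)$, $\mathrm E=\mathrm E(\mathbf a)$, $e_i=e_i(\mathbf a)$, $o_i=o_i(\mathbf a)$, $\sigma_i=s_{2i-1}(\mathbf a)+s_{2k}(\mathbf a)$ and $T_i(u)=T(u,\,a_{2i-2}+o_i-1,\,o_i)$. Then $$M(H^{(8)}_{x,y,z}(a_1,\dots,a_{2k}))=M(H^{(8)}_{x,y,z}(\mathrm O,\mathrm E))\,\frac{Q(0,a_1-1,a_2,\dots,a_{2k},y)\,K'(a_1,\dots,a_{2k-1},a_{2k}+z)}{P_{y,y+2\mathrm O-2,\mathrm E}\,P'_{z+\mathrm E-1,z+\mathrm E-1,\mathrm O}}$$ $$\times\prod_{i=2}^{k}\frac{T_i(x+z+e_i+1)\,T_i(y+e_i+1)}{T_i(x+y+e_i+1)\,T_i(z+e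_i+1)}\cdot\frac{T_i(x+y+\sigma_i)\,T_i(z+\sigma_i)}{T_i(x+z+\sigma_i)\,T_i(y+\sigma_i)}.$$
   Context: Geometry. Work on the triangular lattice with unit equilateral triangles and horizontal lattice lines; consecutive horizontal lattice lines are one level apart. East, west, NE, NW, SE, SW denote the six unit lattice steps. An up-pointing (down-pointing) triangle has a horizontal bottom (top) side. A lozenge is the union of two unit triangles sharing an edge; it is vertical if the shared edge is horizontal. A tiling of a region (finite union of unit triangles) is a covering by lozenges without gaps or overlaps. Lozenges may carry weights (weight 1 unless stated otherwise); the weight of a tiling is the product of the weights of its lozenges, and $M(R)$ is the sum of the weights of all tilings of $R$. Polygons are described by their boundary path, starting at the upper-left corner and going counterclockwise; $(\mathrm{SW},\mathrm{SE})^m$ means the two steps repeated $m$ times. Numbers $P,P'$. For $0\le a\le b$, $c\ge0$, take the polygon with boundary $(\mathrm{SW},\mathrm{SE})^{a}$, then $b-a$ steps SE, $c$ steps east, $a$ steps NE, $b$ steps NW, $c$ steps west. $P_{a,b,c}$ is its number of (unweighted) tilings; $P'_{a,b,c}$ is its weighted tiling number when each vertical lozenge whose two left sides both lie on the zigzag part $(\mathrm{SW},\mathrm{SE})^a$ has weight $\frac12$. Sequences. For a finite sequence $\mathbf t=(t_1,t_2,\dots)$ of non-negative integers: $\mathrm O(\mathbf t)=\sum_{i\text{ odd}}t_i$, $\mathrm E(\mathbf t)=\sum_{i\text{ even}}t_i$, $s_m(\mathbf t)=\sum_{i=1}^m t_i$, $o_m(\mathbf t)=\sum_{i\ge m}t_{2i-1}$,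 $e_m(\mathbf t)=\sum_{i\ge m}t_{2i}$. Numbers $Q$, $K'$. For $\mathbf t=(t_1,\dots,t_{2l})$, $Q(\mathbf t)$ is the number of tilings of the region obtained from the polygon with boundary $(\mathrm{SW},\mathrm{SE})^{\mathrm E(\mathbf t)}$, then $\mathrm E(\mathbf t)+\mathrm O(\mathbf t)$ steps east, $2\mathrm E(\mathbf t)$ steps NW, $\mathrm O(\mathbf t)$ steps west, as follows: divide the bottom side from left to right into segments of lengths $t_1,\dots,t_{2l}$, and for each $i$ remove the up-pointing triangle of side $t_{2i}$ whose bottom side is the $2i$-th segment (intersected with the polygon). For $\mathrm E(\mathbf t)\ge1$, $K'(\mathbf t)$ is the weighted tiling number of the region obtained by the same removals from the polygon with boundary $(\mathrm{SW},\mathrm{SE})^{\mathrm E(\mathbf t)-1}$, one step SW, then $\mathrm E(\mathbf t)+\mathrm O(\mathbf t)$ steps east, $2\mathrm E(\mathbf t)-1$ steps NW, $\mathrm O(\mathbf t)$ steps west, where each vertical lozenge whose two left sides both lie on the western zigzag has weight $\frac12$. Region $H^{(8)}_{x,y,z}(a_1,\dots,a_k)$. With $\mathrm O=\mathrm O(\mathbf a)$, $\mathrm E=\mathrm E(\mathbf a)$, take the polygon with boundary $(\mathrm{SW},\mathrm{SE})^{y+\mathrm O-1}$, one step west (arriving at a point $W_0$), $(\mathrm{SE},\mathrm{SW})^{z+\mathrm E-1}$, one step SE, then $x+\mathrm O$ steps east, $y+z+2\mathrm E-1$ steps NE, $y+z+2\mathrm O-2$ steps NW, $x+\mathrm E$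 steps west (this makes sense when $y+\mathrm O\ge1$ and $z+\mathrm E\ge1$). Let $L$ be the horizontal lattice line through $W_0$; starting at $W_0$ mark on $L$ from left to right consecutive segments of lengths $a_1,\dots,a_k$. Remove: for $i=1$, the part of the polygon above $L$ and to the left of the line going from the right endpoint of the first segment in direction NW (half of an up-pointing triangle); for odd $i\ge3$, the up-pointing triangle of side $a_i$ whose bottom side is the $i$-th segment; for even $i$, the down-pointing triangle of side $a_i$ whose top side is the $i$-th segment. Give weight $\frac12$ to each vertical lozenge whose two left sides both lie on the part of the western boundary below $L$; all other lozenges have weight 1. Products. $(u)_n=u(u+1)\cdots(u+n-1)$ for $n>0$, $(u)_0=1$, $(u)_n=\frac1{(u-1)(u-2)\cdots(u+n)}$ for $n<0$. $[u]_n=u(u+2)\cdots(u+2(n-1))$ for $n>0$, $[u]_0=1$, $[u]_n=\frac1{(u-2)(u-4)\cdots(u+2n)}$ for $n<0$. $T(u,n,m)=\prod_{i=0}^{m-1}(u+i)_{n-2i}$ and $V(u,n,m)=\prod_{i=0}^{m-1}[u+2i]_{n-2i}$ (empty products $=1$).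
   Formalization: σ_i is corrected to s_{2i−3}(a)+s_{2k}(a); with s_{2i−1} part (ii) fails, e.g. x=1, y=0, z=1, a=(1,1,1,0) gives 147/10 instead of 15. Cases where the formula is undefined are excluded: a≥1, z+b≥1 in (i); a_1≥1, z+E≥1 in (ii). *)

theory Defs
  imports Complex_Main "HOL-Library.Disjoint_Sets"
begin

section \<open>The triangular lattice\<close>

text \<open>
  The pair \<open>(i, j)\<close> is the lattice point \<open>i * u + j * v\<close>, where \<open>u\<close> and \<open>v\<close> are the unit
  steps east and north-east; \<open>j\<close> is the level of the point.
\<close>

type_synonym point = "int \<times> int"

datatype step = East | West | NE | NW | SE | SW

fun move :: "step \<Rightarrow> point \<Rightarrow> point" where
  "move East (i, j) = (i + 1, j)"
| "move West (i, j) = (i - 1, j)"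
| "move NE (i, j) = (i, j + 1)"
| "move NW (i, j) = (i - 1, j + 1)"
| "move SE (i, j) = (i + 1, j - 1)"
| "move SW (i, j) = (i, j - 1)"

definition endpoint :: "point \<Rightarrow> step list \<Rightarrow> point" where
  "endpoint p ss = fold move ss p"

fun path_edges :: "point \<Rightarrow> step list \<Rightarrow> (point \<times> point) list" where
  "path_edges p [] = []"
| "path_edges p (s # ss) = (p, move s p) # path_edges (move s p) ss"

definition repeat_steps :: "nat \<Rightarrow> step list \<Rightarrow> step list" where
  "repeat_steps m ss = concat (replicate m ss)"

text \<open>
  \<open>Up p\<close> and \<open>Down p\<close> are the two unit triangles having the unit segment from \<open>p\<close> to its
  east neighbour as bottom side and as top side, respectively.
\<close>

datatype tri = Up point | Down point

fun vertices :: "tri \<Rightarrow> point set" where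
  "vertices (Up p) = {p, move East p, move NE p}"
| "vertices (Down p) = {p, move East p, move SE p}"


section \<open>Polygons given by their boundary path\<close>

text \<open>
  A unit triangle lies in the horizontal strip between the levels \<open>strip t\<close> and
  \<open>strip t + 1\<close>. The middle of its cross-section at half height has horizontal coordinate
  \<open>mid_x t / 2\<close>, and the point \<open>p\<close> has horizontal coordinate \<open>xcoord p / 2\<close>. The westward
  ray from that middle meets an edge from \<open>p\<close> to \<open>q\<close> of a lattice path if and only if the
  edge crosses the strip and its midpoint is further west; the edge then contributes \<open>1\<close> or
  \<open>- 1\<close> to the winding number according to whether it goes down or up.
\<close>

fun xcoord :: "point \<Rightarrow> int" where
  "xcoord (i, j) = 2 * i + j"

fun strip :: "tri \<Rightarrow> int" where
  "strip (Up p) = snd p"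
| "strip (Down p) = snd p - 1"

fun mid_x :: "tri \<Rightarrow> int" where
  "mid_x (Up p) = xcoord p + 1"
| "mid_x (Down p) = xcoord p + 1"

definition crossing :: "tri \<Rightarrow> point \<times> point \<Rightarrow> int" where
  "crossing t e = (case e of (p, q) \<Rightarrow>
     if xcoord p + xcoord q < 2 * mid_x t then
       (if snd p = strip t + 1 \<and> snd q = strip t then 1
        else if snd p = strip t \<and> snd q = strip t + 1 then - 1
        else 0)
     else 0)"

definition winding :: "point \<Rightarrow> step list \<Rightarrow> tri \<Rightarrow> int" where
  "winding p ss t = (\<Sum>e\<leftarrow>path_edges p ss. crossing t e)"

definition polygon :: "point \<Rightarrow> step list \<Rightarrow> tri set" where
  "polygon p ss = {t. winding p ss t \<noteq> 0}"

definition up_triangle :: "point \<Rightarrow> nat \<Rightarrow> tri set" where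
  "up_triangle p n = polygon p (replicate n East @ replicate n NW @ replicate n SW)"

definition down_triangle :: "point \<Rightarrow> nat \<Rightarrow> tri set" where
  "down_triangle p n = polygon p (replicate n SE @ replicate n NE @ replicate n West)"


section \<open>Weighted lozenge tilings\<close>

definition lozenges :: "tri set set" where
  "lozenges = {{s, t} |s t. card (vertices s \<inter> vertices t) = 2}"

definition tilings :: "tri set \<Rightarrow> tri set set set" where
  "tilings R = {\<T>. partition_on R \<T> \<and> \<T> \<subseteq> lozenges}"

definition tiling_sum :: "(tri set \<Rightarrow> real) \<Rightarrow> tri set \<Rightarrow> real" where
  "tiling_sum w R = (\<Sum>\<T>\<in>tilings R. \<Prod>l\<in>\<T>. w l)"

text \<open>
  The vertical lozenge with horizontal diagonal starting at \<open>p\<close> has as left sides the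
  SW step ending at \<open>p\<close> and the SE step starting at \<open>p\<close>. The zigzags below only go down,
  so it suffices to compare directed edges.
\<close>

definition zigzag_weight :: "(point \<times> point) list \<Rightarrow> tri set \<Rightarrow> real" where
  "zigzag_weight Z l =
     (if \<exists>p. l = {Up p, Down p} \<and> (move NE p, p) \<in> set Z \<and> (p, move SE p) \<in> set Z
      then 1 / 2 else 1)"


section \<open>Sequences\<close>

text \<open>A sequence \<open>(t\<^sub>1, t\<^sub>2, \<dots>)\<close> is a list, whose terms are numbered from 1.\<close>

definition term_at :: "nat list \<Rightarrow> nat \<Rightarrow> nat" where
  "term_at t i = (if 1 \<le> i \<and> i \<le> length t then t ! (i - 1) else 0)"

definition odd_sum :: "nat list \<Rightarrow> nat" where
  "odd_sum t = (\<Sum>i | i \<in> {1..length t} \<and> odd i. term_at t i)"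

definition even_sum :: "nat list \<Rightarrow> nat" where
  "even_sum t = (\<Sum>i | i \<in> {1..length t} \<and> even i. term_at t i)"

definition partial_sum :: "nat \<Rightarrow> nat list \<Rightarrow> nat" where
  "partial_sum m t = (\<Sum>i = 1..m. term_at t i)"

text \<open>In the next two sums the terms with \<open>i > length t\<close> vanish.\<close>

definition odd_tail :: "nat \<Rightarrow> nat list \<Rightarrow> nat" where
  "odd_tail m t = (\<Sum>i = m..length t. term_at t (2 * i - 1))"

definition even_tail :: "nat \<Rightarrow> nat list \<Rightarrow> nat" where
  "even_tail m t = (\<Sum>i = m..length t. term_at t (2 * i))"


section \<open>The tiling numbers\<close>

definition P_path :: "nat \<Rightarrow> nat \<Rightarrow> nat \<Rightarrow> step list" where
  "P_path a b c = repeat_steps a [SW, SE] @ replicate (b - a) SE @ replicate c East @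
     replicate a NE @ replicate b NW @ replicate c West"

text \<open>Both numbers are meant for \<open>a \<le> b\<close> only.\<close>

definition P :: "nat \<Rightarrow> nat \<Rightarrow> nat \<Rightarrow> real" where
  "P a b c = tiling_sum (\<lambda>_. 1) (polygon (0, 0) (P_path a b c))"

definition P' :: "nat \<Rightarrow> nat \<Rightarrow> nat \<Rightarrow> real" where
  "P' a b c = tiling_sum (zigzag_weight (path_edges (0, 0) (repeat_steps a [SW, SE])))
     (polygon (0, 0) (P_path a b c))"

text \<open>
  The triangles removed from a polygon whose bottom side starts at \<open>p\<close>: the \<open>i\<close>-th segment
  of the bottom side starts \<open>partial_sum (i - 1) t\<close> units to the right of \<open>p\<close>.
\<close>

definition bottom_triangles :: "point \<Rightarrow> nat list \<Rightarrow> tri set" where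
  "bottom_triangles p t = (\<Union>i \<in> {i \<in> {1..length t}. even i}.
     up_triangle (fst p + int (partial_sum (i - 1) t), snd p) (term_at t i))"

definition Q :: "nat list \<Rightarrow> real" where
  "Q t = (let zigzag = repeat_steps (even_sum t) [SW, SE] in
     tiling_sum (\<lambda>_. 1)
       (polygon (0, 0) (zigzag @ replicate (even_sum t + odd_sum t) East @
          replicate (2 * even_sum t) NW @ replicate (odd_sum t) West)
        - bottom_triangles (endpoint (0, 0) zigzag) t))"

text \<open>The next number is meant for \<open>even_sum t \<ge> 1\<close> only.\<close>

definition K' :: "nat list \<Rightarrow> real" where
  "K' t = (let zigzag = repeat_steps (even_sum t - 1) [SW, SE] @ [SW] in
     tiling_sum (zigzag_weight (path_edges (0, 0) zigzag))
       (polygon (0, 0) (zigzag @ replicate (even_sum t + odd_sum t) East @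
          replicate (2 * even_sum t - 1) NW @ replicate (odd_sum t) West)
        - bottom_triangles (endpoint (0, 0) zigzag) t))"


section \<open>The halved hexagon with a fern removed\<close>

definition H8_upper :: "nat \<Rightarrow> nat list \<Rightarrow> step list" where
  "H8_upper y a = repeat_steps (y + odd_sum a - 1) [SW, SE] @ [West]"

definition H8_lower :: "nat \<Rightarrow> nat list \<Rightarrow> step list" where
  "H8_lower z a = repeat_steps (z + even_sum a - 1) [SE, SW] @ [SE]"

definition H8_polygon :: "nat \<Rightarrow> nat \<Rightarrow> nat \<Rightarrow> nat list \<Rightarrow> tri set" where
  "H8_polygon x y z a = polygon (0, 0)
     (H8_upper y a @ H8_lower z a @
      replicate (x + odd_sum a) East @
      replicate (y + z + 2 * even_sum a - 1) NE @
      replicate (y + z + 2 * odd_sum a - 2) NW @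
      replicate (x + even_sum a) West)"

text \<open>The lines in direction NW are those with constant \<open>i + j\<close>.\<close>

definition above_and_left_of_NW_line :: "point \<Rightarrow> tri set" where
  "above_and_left_of_NW_line q =
     {t. \<forall>(i, j) \<in> vertices t. snd q \<le> j \<and> i + j \<le> fst q + snd q}"

definition fern :: "point \<Rightarrow> nat list \<Rightarrow> tri set" where
  "fern p a =
     above_and_left_of_NW_line (fst p + int (term_at a 1), snd p) \<union>
     (\<Union>i \<in> {2..length a}.
        (if odd i then up_triangle else down_triangle)
          (fst p + int (partial_sum (i - 1) a), snd p) (term_at a i))"

text \<open>
  The truncated subtractions in the boundary path are exact for \<open>odd_sum a \<ge> 1\<close> and
  \<open>z + even_sum a \<ge> 1\<close>.
\<close>

definition M_H8 :: "nat \<Rightarrow> nat \<Rightarrow> nat \<Rightarrow> nat list \<Rightarrow> real" where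
  "M_H8 x y z a = (let W\<^sub>0 = endpoint (0, 0) (H8_upper y a) in
     tiling_sum (zigzag_weight (path_edges W\<^sub>0 (H8_lower z a)))
       (H8_polygon x y z a - fern W\<^sub>0 a))"


section \<open>Products\<close>

text \<open>\<open>rising u n\<close> is \<open>(u)\<^sub>n\<close> and \<open>rising2 u n\<close> is \<open>[u]\<^sub>n\<close>.\<close>

definition rising :: "real \<Rightarrow> int \<Rightarrow> real" where
  "rising u n = (if n \<ge> 0 then \<Prod>j<nat n. u + real j
                 else 1 / (\<Prod>j = 1..nat (- n). u - real j))"

definition rising2 :: "real \<Rightarrow> int \<Rightarrow> real" where
  "rising2 u n = (if n \<ge> 0 then \<Prod>j<nat n. u + 2 * real j
                  else 1 / (\<Prod>j = 1..nat (- n). u - 2 * real j))"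

definition T :: "real \<Rightarrow> int \<Rightarrow> nat \<Rightarrow> real" where
  "T u n m = (\<Prod>i<m. rising (u + real i) (n - 2 * int i))"

definition V :: "real \<Rightarrow> int \<Rightarrow> nat \<Rightarrow> real" where
  "V u n m = (\<Prod>i<m. rising2 (u + 2 * real i) (n - 2 * int i))"

text \<open>
  The factor \<open>T\<^sub>i(u)\<close> and the shift \<open>\<sigma>\<^sub>i\<close> of the product formula. The shift is
  \<open>s\<^bsub>2i-3\<^esub> + s\<^bsub>2k\<^esub>\<close> and corrects \<open>s\<^bsub>2i-1\<^esub> + s\<^bsub>2k\<^esub>\<close> in the source, with which the
  formula is false: \<open>M_H8 1 0 1 [1, 1, 1, 0]\<close> is 15, but that formula gives 147 / 10, which is
  not even of the form \<open>m / 2 ^ n\<close>.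
\<close>

definition T_factor :: "nat list \<Rightarrow> nat \<Rightarrow> real \<Rightarrow> real" where
  "T_factor a i u =
     T u (int (term_at a (2 * i - 2)) + int (odd_tail i a) - 1) (odd_tail i a)"

definition sigma :: "nat list \<Rightarrow> nat \<Rightarrow> real" where
  "sigma a i = real (partial_sum (2 * i - 3) a) + real (partial_sum (length a) a)"

end

theory Submission
  imports Defs "Jordan_Normal_Form.Determinant"
begin

text \<open>
  A tiling of a trapezoid whose western side is a vertical zigzag is determined by its vertical
  lozenges, and the positions of those on consecutive levels interlace. Summing over all
  interlacing patterns, one level after the other, amounts to a discrete integration in each row
  of a determinant (lemma \<open>tsum_det\<close>). In a basis of binomial coefficients the determinant becomes
  a Vandermonde determinant in squares. With triangles removed along the base at the positions
  in a set \<open>D\<close> of \<open>n\<close> numbers, the result is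
  \<open>symp D = (\<Prod>p\<in>D. p) * (\<Prod>p<q. q\<^sup>2 - p\<^sup>2) / (\<Prod>j<n. (2 * j + 1)!)\<close> for an even number of levels and
  unit weights, and \<open>orth D = (\<Prod>p<q. q\<^sup>2 - p\<^sup>2) / (\<Prod>j<n. (2 * j)!)\<close> for an odd number of levels and
  weight \<open>1/2\<close> along the zigzag (\<open>tsum_symp\<close>, \<open>tsum_orth\<close>). A big triangle standing on the base may be
  replaced by the unit triangles along its bottom side, because that forces the lozenges inside
  it (\<open>tiling_sum_remove_triangles\<close>). Therefore \<open>P\<close> and \<open>Q\<close> are values of \<open>symp\<close>, and \<open>P'\<close> and \<open>K'\<close> are values
  of \<open>orth\<close>.

  The line of the fern cuts the halved hexagon into two such trapezoids, the lower one upside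
  down. Summing over the set \<open>X\<close> of positions at which vertical lozenges cross this line gives
  \<open>M = (\<Sum>X. symp (U \<union> C \<union> X) * orth (D \<union> C' \<union> X))\<close> (\<open>M_H8_eq_sum\<close>), where \<open>U\<close> and \<open>D\<close> are the positions
  below the up-pointing and above the down-pointing triangles of the fern, and \<open>C\<close> and \<open>C'\<close>, one of
  which is empty, account for the eastern corner of the hexagon, which need not lie on the line. As
  \<open>U \<union> D = {1..<N}\<close> with \<open>N = O + E\<close>, the factors linking \<open>X\<close> to \<open>U\<close> and to \<open>D\<close> combine to a product over
  \<open>{1..<N}\<close>. So the sum over \<open>X\<close> that remains depends on \<open>N\<close>, \<open>x\<close>, \<open>y\<close>, \<open>z\<close> only, and
  \<open>M = symp (U \<union> {N..<N + y}) * orth (D \<union> {N..<N + z}) * (\<Prod>q\<in>U. psi q) * fern_factor N\<close>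
  (\<open>M_H8_product\<close>) with an explicit quotient \<open>psi q\<close> of factorials.

  In the second part of the theorem two ferns with the same \<open>N\<close> are compared. The common factor
  cancels, and the products of \<open>psi\<close> differ by a telescoping product, in which step \<open>i\<close> moves the
  odd segments from the \<open>i\<close>-th on across the segment before them (\<open>prod_segments_telescope\<close>).

  The first part needs the value of the sum over \<open>X\<close> (\<open>gap_sum_product\<close>). Its terms contain the
  square of a Vandermonde product. Written as the product of two determinants in Newton bases
  with nodes at the two ends of the range of \<open>X\<close>, it turns by the Cauchy--Binet formula into a
  determinant of single sums. These have a closed form (\<open>sum_wt0_upper_factor\<close>), which leaves a
  determinant of binomial coefficients. What then remains is an identity between products of
  factorials.
\<close>

section \<open>Determinants\<close>

text \<open>
  The determinant of the matrix \<open>f i j\<close>, \<open>i, j < n\<close>, given by a function on all indices.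
\<close>

definition fdet :: "nat \<Rightarrow> (nat \<Rightarrow> nat \<Rightarrow> real) \<Rightarrow> real" where
  "fdet n f = det (mat n n (\<lambda>(i, j). f i j))"

lemma fdet_leibniz:
  "fdet n f = (\<Sum>p | p permutes {..<n}. signof p * (\<Prod>i<n. f i (p i)))"
  unfolding fdet_def det_def
  by (auto simp: atLeast0LessThan permutes_in_image intro!: sum.cong prod.cong)

lemma fdet_cong:
  assumes "\<And>i j. i < n \<Longrightarrow> j < n \<Longrightarrow> f i j = g i j"
  shows "fdet n f = fdet n g"
  unfolding fdet_def using assms by (intro arg_cong[of _ _ det] eq_matI) auto

lemma fdet_scale:
  "fdet n (\<lambda>i j. r i * c j * f i j) = (\<Prod>i<n. r i) * (\<Prod>j<n. c j) * fdet n f"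
proof -
  have "(\<Prod>i<n. r i * c (p i) * f i (p i)) = (\<Prod>i<n. r i) * (\<Prod>j<n. c j) * (\<Prod>i<n. f i (p i))"
    if "p permutes {..<n}" for p
    using prod.permute[OF that, of c] by (simp add: prod.distrib o_def)
  then show ?thesis
    unfolding fdet_leibniz sum_distrib_left by (intro sum.cong) auto
qed

lemma fdet_permute_rows:
  assumes "p permutes {..<n}"
  shows "fdet n (\<lambda>i j. f (p i) j) = signof p * fdet n f"
proof -
  have "det (mat n n (\<lambda>(i, j). mat n n (\<lambda>(i, j). f i j) $$ (p i, j))) = signof p * fdet n f"
    unfolding fdet_def
    by (rule det_permute_rows) (use assms in \<open>auto simp: atLeast0LessThan\<close>)
  moreover have "mat n n (\<lambda>(i, j). mat n n (\<lambda>(i, j). f i j) $$ (p i, j)) = mat n n (\<lambda>(i, j). f (p i) j)"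
    using permutes_in_image[OF assms] by (intro eq_matI) auto
  ultimately show ?thesis
    by (simp add: fdet_def)
qed

text \<open>The determinant is linear in each row.\<close>

lemma fdet_sum_rows:
  assumes "\<And>i. i < n \<Longrightarrow> finite (I i)"
  shows "(\<Sum>h\<in>Pi\<^sub>E {..<n} I. (\<Prod>i<n. w i (h i)) * fdet n (\<lambda>i j. g j (h i))) =
    fdet n (\<lambda>i j. \<Sum>x\<in>I i. w i x * g j x)"
proof -
  have "(\<Sum>h\<in>Pi\<^sub>E {..<n} I. (\<Prod>i<n. w i (h i)) * fdet n (\<lambda>i j. g j (h i))) =
    (\<Sum>p | p permutes {..<n}. \<Sum>h\<in>Pi\<^sub>E {..<n} I. signof p * (\<Prod>i<n. w i (h i) * g (p i) (h i)))"
    unfolding fdet_leibniz sum_distrib_left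
    by (subst sum.swap) (intro sum.cong, auto simp: prod.distrib algebra_simps)
  also have "\<dots> = fdet n (\<lambda>i j. \<Sum>x\<in>I i. w i x * g j x)"
    unfolding fdet_leibniz
    by (intro sum.cong refl) (subst prod_sum_PiE, auto simp: assms sum_distrib_left)
  finally show ?thesis .
qed

text \<open>The Cauchy--Binet formula, in the form of a sum over all tuples.\<close>

lemma fdet_andreief:
  assumes "finite G"
  shows "(\<Sum>h\<in>Pi\<^sub>E {..<n} (\<lambda>_. G).
      (\<Prod>i<n. w (h i)) * fdet n (\<lambda>i j. f j (h i)) * fdet n (\<lambda>i j. g j (h i))) =
    fact n * fdet n (\<lambda>i j. \<Sum>x\<in>G. w x * f i x * g j x)"
proof -
  let ?G = "\<lambda>i j. \<Sum>x\<in>G. w x * f i x * g j x"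
  have "(\<Sum>h\<in>Pi\<^sub>E {..<n} (\<lambda>_. G).
      (\<Prod>i<n. w (h i)) * fdet n (\<lambda>i j. f j (h i)) * fdet n (\<lambda>i j. g j (h i))) =
    (\<Sum>p | p permutes {..<n}. \<Sum>h\<in>Pi\<^sub>E {..<n} (\<lambda>_. G).
      signof p * ((\<Prod>i<n. w (h i) * f (p i) (h i)) * fdet n (\<lambda>i j. g j (h i))))"
    unfolding fdet_leibniz[of n "\<lambda>i j. f j (_ i)"] sum_distrib_left sum_distrib_right
    by (subst sum.swap) (intro sum.cong, auto simp: prod.distrib algebra_simps)
  also have "\<dots> = (\<Sum>p | p permutes {..<n}. signof p * fdet n (\<lambda>i j. ?G (p i) j))"
    unfolding sum_distrib_left[symmetric]
    by (subst fdet_sum_rows[where w = "\<lambda>i x. w x * f (_ i) x"]) (simp_all add: assms)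
  also have "\<dots> = (\<Sum>p | p permutes {..<n}. fdet n ?G)"
  proof (intro sum.cong refl)
    fix p assume "p \<in> {p. p permutes {..<n}}"
    then have "fdet n (\<lambda>i j. ?G (p i) j) = signof p * fdet n ?G"
      using fdet_permute_rows[of p n ?G] by simp
    then show "signof p * fdet n (\<lambda>i j. ?G (p i) j) = fdet n ?G"
      by (simp add: sign_def)
  qed
  also have "\<dots> = fact n * fdet n ?G"
    by (simp add: card_permutations)
  finally show ?thesis .
qed

lemma fdet_triangular:
  assumes "\<And>i j. i < j \<Longrightarrow> j < n \<Longrightarrow> f i j = 0"
  shows "fdet n f = (\<Prod>i<n. f i i)"
proof -
  have "fdet n f = prod_list (diag_mat (mat n n (\<lambda>(i, j). f i j)))"
    unfolding fdet_def by (rule det_lower_triangular[of n]) (use assms in auto)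
  also have "diag_mat (mat n n (\<lambda>(i, j). f i j)) = map (\<lambda>i. f i i) [0..<n]"
    unfolding diag_mat_def by (auto intro: map_cong)
  also have "prod_list \<dots> = (\<Prod>i<n. f i i)"
    by (simp add: prod.distinct_set_conv_list[symmetric] atLeast0LessThan)
  finally show ?thesis .
qed

lemma fdet_mult:
  "fdet n (\<lambda>i j. \<Sum>k<n. f i k * g k j) = fdet n f * fdet n g"
proof -
  have "mat n n (\<lambda>(i, j). f i j) * mat n n (\<lambda>(i, j). g i j) = mat n n (\<lambda>(i, j). \<Sum>k<n. f i k * g k j)"
    by (intro eq_matI) (auto simp: scalar_prod_def atLeast0LessThan intro!: sum.cong)
  then show ?thesis
    unfolding fdet_def using det_mult[of "mat n n (\<lambda>(i, j). f i j)" n "mat n n (\<lambda>(i, j). g i j)"] by simp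
qed

lemma fdet_transpose: "fdet n (\<lambda>i j. f j i) = fdet n f"
proof -
  have "mat n n (\<lambda>(i, j). f j i) = transpose_mat (mat n n (\<lambda>(i, j). f i j))"
    by (intro eq_matI) auto
  then show ?thesis
    unfolding fdet_def by (simp add: det_transpose[of _ n])
qed

lemma fdet_column_operations:
  assumes "\<And>i j. i < n \<Longrightarrow> j < n \<Longrightarrow> f i j = (\<Sum>k\<le>j. c j k * g i k)"
    and "\<And>j. c j j = 1"
  shows "fdet n f = fdet n g"
proof -
  let ?c = "\<lambda>k j. if k \<le> j then c j k else 0"
  have "fdet n f = fdet n (\<lambda>i j. \<Sum>k<n. g i k * ?c k j)"
  proof (rule fdet_cong)
    fix i j assume "i < n" "j < n"
    have "(\<Sum>k<n. g i k * ?c k j) = (\<Sum>k\<le>j. g i k * ?c k j)"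
      by (rule sum.mono_neutral_right) (use \<open>j < n\<close> in auto)
    then show "f i j = (\<Sum>k<n. g i k * ?c k j)"
      using assms(1)[OF \<open>i < n\<close> \<open>j < n\<close>] by (simp add: mult.commute)
  qed
  also have "\<dots> = fdet n g * fdet n ?c"
    by (rule fdet_mult)
  also have "fdet n ?c = fdet n (\<lambda>j k. ?c k j)"
    by (rule fdet_transpose[symmetric])
  also have "\<dots> = 1"
    by (subst fdet_triangular) (auto simp: assms(2))
  finally show ?thesis
    by simp
qed

lemma newton_basis_change:
  fixes s t :: "nat \<Rightarrow> real"
  shows "\<exists>c. (\<forall>j. c j j = 1) \<and>
    (\<forall>j x. (\<Prod>l<j. x - t l) = (\<Sum>k\<le>j. c j k * (\<Prod>l<k. x - s l)))"
proof -
  have "\<exists>c. c j = 1 \<and> (\<forall>x. (\<Prod>l<j. x - t l) = (\<Sum>k\<le>j. c k * (\<Prod>l<k. x - s l)))" for j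
  proof (induction j)
    case 0
    show ?case by (intro exI[of _ "\<lambda>_. 1"]) auto
  next
    case (Suc j)
    then obtain c where c: "c j = 1" "\<And>x. (\<Prod>l<j. x - t l) = (\<Sum>k\<le>j. c k * (\<Prod>l<k. x - s l))"
      by blast
    let ?c = "\<lambda>k. (if k = 0 then 0 else c (k - 1)) + (if k \<le> j then c k * (s k - t j) else 0)"
    have "(\<Prod>l<Suc j. x - t l) = (\<Sum>k\<le>Suc j. ?c k * (\<Prod>l<k. x - s l))" for x
    proof -
      have "(\<Prod>l<Suc j. x - t l) = (\<Sum>k\<le>j. c k * (\<Prod>l<k. x - s l)) * (x - t j)"
        by (simp add: c(2))
      also have "\<dots> =
        (\<Sum>k\<le>j. c k * (\<Prod>l<k. x - s l) * (x - s k) + c k * (s k - t j) * (\<Prod>l<k. x - s l))"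
        unfolding sum_distrib_right by (intro sum.cong refl) (simp add: algebra_simps)
      also have "\<dots> = (\<Sum>k\<le>j. c k * (\<Prod>l<Suc k. x - s l)) + (\<Sum>k\<le>j. c k * (s k - t j) * (\<Prod>l<k. x - s l))"
        by (simp add: sum.distrib mult.assoc)
      also have "(\<Sum>k\<le>j. c k * (\<Prod>l<Suc k. x - s l)) =
          (\<Sum>k\<le>Suc j. (if k = 0 then 0 else c (k - 1)) * (\<Prod>l<k. x - s l))"
        by (simp only: sum.atMost_Suc_shift) simp
      also have "(\<Sum>k\<le>j. c k * (s k - t j) * (\<Prod>l<k. x - s l)) =
          (\<Sum>k\<le>Suc j. (if k \<le> j then c k * (s k - t j) else 0) * (\<Prod>l<k. x - s l))"
        by simp
      finally show ?thesis
        by (simp add: sum.distrib[symmetric] algebra_simps del: sum.atMost_Suc)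
    qed
    then show ?case
      using c(1) by (intro exI[of _ ?c]) auto
  qed
  then obtain c where "\<And>j. c j j = 1 \<and> (\<forall>x. (\<Prod>l<j. x - t l) = (\<Sum>k\<le>j. c j k * (\<Prod>l<k. x - s l)))"
    by metis
  then show ?thesis
    by blast
qed

text \<open>
  Vandermonde's determinant for an arbitrary Newton basis. Column operations replace the
  nodes \<open>t\<close> by the points \<open>X\<close> themselves, which makes the matrix triangular.
\<close>

lemma fdet_newton:
  "fdet n (\<lambda>i j. \<Prod>l<j. X i - t l) = (\<Prod>j<n. \<Prod>i<j. X j - X i)"
proof -
  obtain c where c: "\<And>j. c j j = 1"
      "\<And>j x. (\<Prod>l<j. x - t l) = (\<Sum>k\<le>j. c j k * (\<Prod>l<k. x - X l))"
    using newton_basis_change[of t X] by blast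
  have "fdet n (\<lambda>i j. \<Prod>l<j. X i - t l) = fdet n (\<lambda>i j. \<Prod>l<j. X i - X l)"
    by (rule fdet_column_operations[where c = c]) (use c in auto)
  also have "\<dots> = (\<Prod>j<n. \<Prod>i<j. X j - X i)"
    by (rule fdet_triangular) auto
  finally show ?thesis .
qed

lemma fdet_row_differences:
  "fdet n (\<lambda>i j. if i = 0 then f 0 j else f i j - f (i - 1) j) = fdet n f"
proof -
  let ?d = "\<lambda>i k. if k = i then 1 else if Suc k = i then - 1 else 0 :: real"
  have "fdet n (\<lambda>i j. if i = 0 then f 0 j else f i j - f (i - 1) j) = fdet n (\<lambda>i j. \<Sum>k<n. ?d i k * f k j)"
  proof (rule fdet_cong)
    fix i j assume "i < n" "j < n"
    have "(\<Sum>k<n. ?d i k * f k j) = (\<Sum>k\<in>{i} \<union> (if i = 0 then {} else {i - 1}). ?d i k * f k j)"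
      by (rule sum.mono_neutral_right) (use \<open>i < n\<close> in auto)
    then show "(if i = 0 then f 0 j else f i j - f (i - 1) j) = (\<Sum>k<n. ?d i k * f k j)"
      by auto
  qed
  also have "\<dots> = fdet n ?d * fdet n f"
    by (rule fdet_mult)
  also have "fdet n ?d = 1"
    by (subst fdet_triangular) auto
  finally show ?thesis
    by simp
qed

text \<open>
  If the first column consists of ones, taking differences of consecutive rows removes one row
  and one column.
\<close>

lemma fdet_differences_of_ones:
  assumes "\<And>i. i \<le> n \<Longrightarrow> f i 0 = 1"
  shows "fdet n (\<lambda>i j. f (Suc i) (Suc j) - f i (Suc j)) = fdet (Suc n) f"
proof -
  let ?d = "\<lambda>i j. if i = 0 then f 0 j else f i j - f (i - 1) j"
  let ?A = "mat (Suc n) (Suc n) (\<lambda>(i, j). ?d i j)"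
  have "fdet (Suc n) f = det ?A"
    unfolding fdet_row_differences[of "Suc n" f, symmetric] by (simp add: fdet_def)
  also have "\<dots> = (\<Sum>i<Suc n. ?A $$ (i, 0) * cofactor ?A i 0)"
    by (rule laplace_expansion_column) auto
  also have "\<dots> = ?A $$ (0, 0) * cofactor ?A 0 0"
    by (subst sum.lessThan_Suc_shift) (auto simp: assms intro!: sum.neutral)
  also have "\<dots> = det (mat_delete ?A 0 0)"
    by (simp add: cofactor_def assms)
  also have "mat_delete ?A 0 0 = mat n n (\<lambda>(i, j). f (Suc i) (Suc j) - f i (Suc j))"
    unfolding mat_delete_def by (intro eq_matI) auto
  finally show ?thesis
    by (simp add: fdet_def)
qed

section \<open>Sums over tilings\<close>

lemma finite_tilings: "finite R \<Longrightarrow> finite (tilings R)"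
  by (rule finite_subset[of _ "Pow (Pow R)"]) (auto simp: tilings_def partition_on_def)

lemma tiling_sum_empty [simp]: "tiling_sum w {} = 1"
proof -
  have "tilings {} = {{}}"
    by (auto simp: tilings_def partition_on_def)
  then show ?thesis
    by (simp add: tiling_sum_def)
qed

lemma tiling_sum_cong:
  assumes "\<And>l. l \<in> lozenges \<Longrightarrow> l \<subseteq> R \<Longrightarrow> w l = w' l"
  shows "tiling_sum w R = tiling_sum w' R"
  unfolding tiling_sum_def using assms
  by (intro sum.cong prod.cong refl) (auto simp: tilings_def partition_on_def)

lemma finite_tiling: "finite R \<Longrightarrow> \<T> \<in> tilings R \<Longrightarrow> finite \<T>"
  by (rule finite_subset[of _ "Pow R"]) (auto simp: tilings_def partition_on_def)

lemma tilingsI: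
  assumes "\<Union>\<T> = R" "\<And>l l'. l \<in> \<T> \<Longrightarrow> l' \<in> \<T> \<Longrightarrow> l \<noteq> l' \<Longrightarrow> l \<inter> l' = {}" "{} \<notin> \<T>" "\<T> \<subseteq> lozenges"
  shows "\<T> \<in> tilings R"
  using assms by (auto simp: tilings_def partition_on_def disjoint_def)

lemma tilingsD:
  assumes "\<T> \<in> tilings R"
  shows "\<Union>\<T> = R" "\<And>l l'. l \<in> \<T> \<Longrightarrow> l' \<in> \<T> \<Longrightarrow> l \<noteq> l' \<Longrightarrow> l \<inter> l' = {}" "{} \<notin> \<T>" "\<T> \<subseteq> lozenges"
  using assms by (auto simp: tilings_def partition_on_def disjoint_def)

text \<open>
  Cutting a region into two parts. The set \<open>K\<close> consists of the lozenges that meet both parts; the sum is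
  over the subset of \<open>K\<close> that a tiling uses.
\<close>

lemma tiling_sum_cut:
  assumes K: "K = {l \<in> lozenges. l \<subseteq> A \<union> B \<and> l \<inter> A \<noteq> {} \<and> l \<inter> B \<noteq> {}}"
    and AB: "finite A" "finite B" "A \<inter> B = {}" and "disjoint K"
  shows "tiling_sum w (A \<union> B) =
    (\<Sum>X\<in>Pow K. (\<Prod>l\<in>X. w l) * tiling_sum w (A - \<Union>X) * tiling_sum w (B - \<Union>X))"
proof -
  have finK: "finite K"
    by (rule finite_subset[of _ "Pow (A \<union> B)"]) (use AB in \<open>auto simp: K\<close>)
  have disjK: "\<And>l l'. l \<in> K \<Longrightarrow> l' \<in> K \<Longrightarrow> l \<noteq> l' \<Longrightarrow> l \<inter> l' = {}"
    using \<open>disjoint K\<close> by (auto simp: disjoint_def)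
  let ?S = "SIGMA X:Pow K. tilings (A - \<Union>X) \<times> tilings (B - \<Union>X)"
  let ?w = "\<lambda>\<T>. \<Prod>l\<in>\<T>. w l"
  have "(\<Sum>X\<in>Pow K. ?w X * tiling_sum w (A - \<Union>X) * tiling_sum w (B - \<Union>X)) =
    (\<Sum>X\<in>Pow K. \<Sum>(T1, T2)\<in>tilings (A - \<Union>X) \<times> tilings (B - \<Union>X). ?w X * ?w T1 * ?w T2)"
    by (simp only: tiling_sum_def mult.assoc sum_product sum.cartesian_product)
      (simp add: sum_distrib_left case_prod_beta)
  also have "\<dots> = (\<Sum>(X, T1, T2)\<in>?S. ?w X * ?w T1 * ?w T2)"
    using finK AB by (subst sum.Sigma) (auto simp: finite_tilings)
  also have "\<dots> = (\<Sum>\<T>\<in>tilings (A \<union> B). ?w \<T>)"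
  proof (rule sum.reindex_bij_witness[where i = "\<lambda>\<T>. (\<T> \<inter> K, {l \<in> \<T>. l \<subseteq> A}, {l \<in> \<T>. l \<subseteq> B})"
        and j = "\<lambda>(X, T1, T2). X \<union> T1 \<union> T2"])
    fix a assume "a \<in> ?S"
    then obtain X T1 T2 where a: "a = (X, T1, T2)" and X: "X \<subseteq> K"
      and T: "T1 \<in> tilings (A - \<Union>X)" "T2 \<in> tilings (B - \<Union>X)"
      by auto
    note t1 = tilingsD[OF T(1)] and t2 = tilingsD[OF T(2)]
    have subs: "l \<subseteq> A \<and> l \<inter> B = {} \<and> l \<noteq> {}" if "l \<in> T1" for l
      using t1(1,3) that AB(3) by auto
    have subs2: "l \<subseteq> B \<and> l \<inter> A = {} \<and> l \<noteq> {}" if "l \<in> T2" for l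
      using t2(1,3) that AB(3) by auto
    have KX: "l \<inter> A \<noteq> {} \<and> l \<inter> B \<noteq> {} \<and> l \<subseteq> A \<union> B \<and> l \<in> lozenges" if "l \<in> X" for l
      using X that by (auto simp: K)
    have d1: "l \<inter> l' = {}" if "l \<in> T1" "l' \<in> X" for l l'
      using t1(1) that by auto
    have d2: "l \<inter> l' = {}" if "l \<in> T2" "l' \<in> X" for l l'
      using t2(1) that by auto
    have d3: "l \<inter> l' = {}" if "l \<in> T1" "l' \<in> T2" for l l'
      using subs[OF that(1)] subs2[OF that(2)] by auto
    have "X \<union> T1 \<union> T2 \<in> tilings (A \<union> B)"
    proof (rule tilingsI)
      show "\<Union> (X \<union> T1 \<union> T2) = A \<union> B"
        using t1(1) t2(1) KX by fastforce
      show "{} \<notin> X \<union> T1 \<union> T2"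
        using subs subs2 KX by blast
      show "X \<union> T1 \<union> T2 \<subseteq> lozenges"
        using t1(4) t2(4) KX by blast
      fix l l' assume "l \<in> X \<union> T1 \<union> T2" "l' \<in> X \<union> T1 \<union> T2" "l \<noteq> l'"
      then show "l \<inter> l' = {}"
        using d1[of l l'] d1[of l' l] d2[of l l'] d2[of l' l] d3[of l l'] d3[of l' l]
          t1(2)[of l l'] t2(2)[of l l'] disjK[of l l'] subsetD[OF X, of l] subsetD[OF X, of l']
        by (elim UnE) (simp_all add: Int_commute)
    qed
    then show "(\<lambda>(X, T1, T2). X \<union> T1 \<union> T2) a \<in> tilings (A \<union> B)"
      by (simp add: a)
    have "T1 \<inter> K = {}" "T2 \<inter> K = {}"
      using subs subs2 by (auto simp: K)
    moreover have "{l \<in> X \<union> T1 \<union> T2. l \<subseteq> A} = T1"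
      using subs subs2 KX AB(3) by blast
    moreover have "{l \<in> X \<union> T1 \<union> T2. l \<subseteq> B} = T2"
      using subs subs2 KX AB(3) by blast
    ultimately show "(\<lambda>\<T>. (\<T> \<inter> K, {l \<in> \<T>. l \<subseteq> A}, {l \<in> \<T>. l \<subseteq> B})) ((\<lambda>(X, T1, T2). X \<union> T1 \<union> T2) a) = a"
      using X by (auto simp: a)
    have "X \<inter> T1 = {}" "(X \<union> T1) \<inter> T2 = {}"
      using subs subs2 KX by blast+
    moreover have "finite X" "finite T1" "finite T2"
      using finite_tiling[OF _ T(1)] finite_tiling[OF _ T(2)] AB finite_subset[OF X finK] by auto
    ultimately show "?w ((\<lambda>(X, T1, T2). X \<union> T1 \<union> T2) a) = (case a of (X, T1, T2) \<Rightarrow> ?w X * ?w T1 * ?w T2)"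
      by (simp add: a prod.union_disjoint)
  next
    fix \<T> assume T: "\<T> \<in> tilings (A \<union> B)"
    note t = tilingsD[OF T]
    have cases: "l \<subseteq> A \<or> l \<subseteq> B \<or> l \<in> K" if "l \<in> \<T>" for l
      using t(1,4) that by (auto simp: K)
    then show "(\<lambda>(X, T1, T2). X \<union> T1 \<union> T2) (\<T> \<inter> K, {l \<in> \<T>. l \<subseteq> A}, {l \<in> \<T>. l \<subseteq> B}) = \<T>"
      by auto
    have KAB: "l \<inter> A \<noteq> {} \<and> l \<inter> B \<noteq> {}" if "l \<in> K" for l
      using that by (auto simp: K)
    have "{l \<in> \<T>. l \<subseteq> A} \<in> tilings (A - \<Union> (\<T> \<inter> K))"
    proof (rule tilingsI)
      show "\<Union> {l \<in> \<T>. l \<subseteq> A} = A - \<Union> (\<T> \<inter> K)"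
      proof (intro equalityI subsetI)
        fix x assume "x \<in> \<Union> {l \<in> \<T>. l \<subseteq> A}"
        then obtain l where l: "l \<in> \<T>" "l \<subseteq> A" "x \<in> l" by blast
        have "x \<notin> l'" if "l' \<in> \<T>" "l' \<in> K" for l'
          using t(2)[OF l(1) that(1)] KAB[OF that(2)] l AB(3) by blast
        then show "x \<in> A - \<Union> (\<T> \<inter> K)" using l by blast
      next
        fix x assume x: "x \<in> A - \<Union> (\<T> \<inter> K)"
        then obtain l where "l \<in> \<T>" "x \<in> l" using t(1) by blast
        then show "x \<in> \<Union> {l \<in> \<T>. l \<subseteq> A}"
          using cases[of l] x AB(3) by blast
      qed
    qed (use t in auto)
    moreover have "{l \<in> \<T>. l \<subseteq> B} \<in> tilings (B - \<Union> (\<T> \<inter> K))"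
    proof (rule tilingsI)
      show "\<Union> {l \<in> \<T>. l \<subseteq> B} = B - \<Union> (\<T> \<inter> K)"
      proof (intro equalityI subsetI)
        fix x assume "x \<in> \<Union> {l \<in> \<T>. l \<subseteq> B}"
        then obtain l where l: "l \<in> \<T>" "l \<subseteq> B" "x \<in> l" by blast
        have "x \<notin> l'" if "l' \<in> \<T>" "l' \<in> K" for l'
          using t(2)[OF l(1) that(1)] KAB[OF that(2)] l AB(3) by blast
        then show "x \<in> B - \<Union> (\<T> \<inter> K)" using l by blast
      next
        fix x assume x: "x \<in> B - \<Union> (\<T> \<inter> K)"
        then obtain l where "l \<in> \<T>" "x \<in> l" using t(1) by blast
        then show "x \<in> \<Union> {l \<in> \<T>. l \<subseteq> B}"
          using cases[of l] x AB(3) by blast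
      qed
    qed (use t in auto)
    ultimately show "(\<T> \<inter> K, {l \<in> \<T>. l \<subseteq> A}, {l \<in> \<T>. l \<subseteq> B}) \<in> ?S"
      by auto
  qed
  finally show ?thesis
    by (simp add: tiling_sum_def)
qed

lemma tiling_sum_separated:
  assumes "finite A" "finite B" "A \<inter> B = {}"
    and "\<And>l. l \<in> lozenges \<Longrightarrow> l \<subseteq> A \<union> B \<Longrightarrow> l \<subseteq> A \<or> l \<subseteq> B"
  shows "tiling_sum w (A \<union> B) = tiling_sum w A * tiling_sum w B"
proof -
  have "{} = {l \<in> lozenges. l \<subseteq> A \<union> B \<and> l \<inter> A \<noteq> {} \<and> l \<inter> B \<noteq> {}}"
    using assms(3,4) by blast
  from tiling_sum_cut[OF this assms(1-3), of w] show ?thesis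
    by simp
qed

lemma tiling_sum_forced:
  assumes "finite R" "disjoint F" "F \<subseteq> lozenges" "{} \<notin> F" "\<Union>F \<subseteq> R"
    and forced: "\<And>\<T>. \<T> \<in> tilings R \<Longrightarrow> F \<subseteq> \<T>"
  shows "tiling_sum w R = (\<Prod>l\<in>F. w l) * tiling_sum w (R - \<Union>F)"
proof -
  have finF: "finite F"
    by (rule finite_subset[of _ "Pow R"]) (use assms in auto)
  have "tiling_sum w R = (\<Sum>\<T>\<in>tilings (R - \<Union>F). (\<Prod>l\<in>F. w l) * (\<Prod>l\<in>\<T>. w l))"
    unfolding tiling_sum_def
  proof (rule sum.reindex_bij_witness[where i = "\<lambda>\<T>. \<T> \<union> F" and j = "\<lambda>\<T>. \<T> - F"])
    fix \<T> assume T: "\<T> \<in> tilings R"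
    note t = tilingsD[OF T]
    show "\<T> - F \<union> F = \<T>"
      using forced[OF T] by auto
    show "\<T> - F \<in> tilings (R - \<Union>F)"
    proof (rule tilingsI)
      have "x \<notin> \<Union>F" if "x \<in> l" "l \<in> \<T> - F" for x l
        using t(2)[of l] forced[OF T] that by blast
      then show "\<Union> (\<T> - F) = R - \<Union>F"
        using t(1) by blast
    qed (use t in auto)
    have "\<T> = (\<T> - F) \<union> F"
      using forced[OF T] by auto
    then have "(\<Prod>l\<in>\<T>. w l) = (\<Prod>l\<in>(\<T> - F) \<union> F. w l)"
      by simp
    also have "\<dots> = (\<Prod>l\<in>F. w l) * (\<Prod>l\<in>\<T> - F. w l)"
      using finite_tiling[OF assms(1) T] finF by (subst prod.union_disjoint) auto
    finally show "(\<Prod>l\<in>F. w l) * (\<Prod>l\<in>\<T> - F. w l) = (\<Prod>l\<in>\<T>. w l)"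
      by simp
  next
    fix \<T> assume T: "\<T> \<in> tilings (R - \<Union>F)"
    note t = tilingsD[OF T]
    have d: "l \<inter> l' = {}" if "l \<in> \<T>" "l' \<in> F" for l l'
      using t(1) that by blast
    have "l \<notin> F" if "l \<in> \<T>" for l
      using d[OF that, of l] t(3) that by auto
    then show "\<T> \<union> F - F = \<T>"
      by auto
    show "\<T> \<union> F \<in> tilings R"
    proof (rule tilingsI)
      show "\<Union> (\<T> \<union> F) = R"
        using t(1) assms(5) by auto
      fix l l' assume "l \<in> \<T> \<union> F" "l' \<in> \<T> \<union> F" "l \<noteq> l'"
      then show "l \<inter> l' = {}"
        using t(2)[of l l'] d[of l l'] d[of l' l] disjointD[OF \<open>disjoint F\<close>, of l l']
        by (elim UnE) (auto simp: Int_commute)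
    qed (use t assms in auto)
  qed
  then show ?thesis
    by (simp add: tiling_sum_def sum_distrib_left)
qed

lemma tiling_sum_image:
  assumes "inj f" and loz: "\<And>l. f ` l \<in> lozenges \<longleftrightarrow> l \<in> lozenges"
  shows "tiling_sum w (f ` R) = tiling_sum (\<lambda>l. w (f ` l)) R"
proof -
  have inv: "inv_into UNIV f ` f ` l = l" for l
    using \<open>inj f\<close> by (simp add: image_image)
  have img: "(`) f ` \<T> \<in> tilings (f ` R)" if "\<T> \<in> tilings R" for \<T>
  proof (rule tilingsI)
    note t = tilingsD[OF that]
    show "\<Union> ((`) f ` \<T>) = f ` R" using t(1) by auto
    show "{} \<notin> (`) f ` \<T>" using t(3) by auto
    show "(`) f ` \<T> \<subseteq> lozenges" using t(4) loz by auto
    fix l l' assume "l \<in> (`) f ` \<T>" "l' \<in> (`) f ` \<T>" "l \<noteq> l'"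
    then obtain k k' where "k \<in> \<T>" "k' \<in> \<T>" "k \<noteq> k'" "l = f ` k" "l' = f ` k'" by blast
    then show "l \<inter> l' = {}"
      using t(2)[of k k'] image_Int[OF \<open>inj f\<close>, of k k'] by simp
  qed
  have "tiling_sum (\<lambda>l. w (f ` l)) R = (\<Sum>\<T>\<in>tilings R. \<Prod>l\<in>(`) f ` \<T>. w l)"
    unfolding tiling_sum_def
    by (intro sum.cong refl, subst prod.reindex) (auto simp: inj_on_def inj_image_eq_iff[OF \<open>inj f\<close>])
  also have "\<dots> = tiling_sum w (f ` R)"
    unfolding tiling_sum_def
  proof (rule sum.reindex_bij_witness[where i = "\<lambda>\<T>. (`) (inv_into UNIV f) ` \<T>" and j = "\<lambda>\<T>. (`) f ` \<T>"])
    fix \<T> assume T: "\<T> \<in> tilings (f ` R)"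
    note t = tilingsD[OF T]
    have l: "f ` inv_into UNIV f ` l = l" if "l \<in> \<T>" for l
    proof -
      have "l \<subseteq> range f" using t(1) that by auto
      then obtain k where "l = f ` k" by (auto simp: subset_image_iff)
      then show ?thesis by (simp add: inv)
    qed
    show e: "(`) f ` (`) (inv_into UNIV f) ` \<T> = \<T>"
      using l by (auto simp: image_image)
    show "(`) (inv_into UNIV f) ` \<T> \<in> tilings R"
    proof (rule tilingsI)
      show "\<Union> ((`) (inv_into UNIV f) ` \<T>) = R"
      proof -
        have "\<Union> ((`) (inv_into UNIV f) ` \<T>) = inv_into UNIV f ` \<Union>\<T>" by auto
        then show ?thesis using t(1) inv by simp
      qed
      show "{} \<notin> (`) (inv_into UNIV f) ` \<T>" using t(3) by auto
      show "(`) (inv_into UNIV f) ` \<T> \<subseteq> lozenges"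
        using t(4) l loz by (metis image_subsetI subsetD)
      fix k k' assume "k \<in> (`) (inv_into UNIV f) ` \<T>" "k' \<in> (`) (inv_into UNIV f) ` \<T>" "k \<noteq> k'"
      then obtain m m' where m: "m \<in> \<T>" "m' \<in> \<T>" "k = inv_into UNIV f ` m" "k' = inv_into UNIV f ` m'" by blast
      then have "f ` k \<inter> f ` k' = {}"
        using t(2)[of m m'] l \<open>k \<noteq> k'\<close> by auto
      then show "k \<inter> k' = {}" by auto
    qed
  qed (use img in \<open>auto simp: image_image inv_f_f[OF \<open>inj f\<close>]\<close>)
  finally show ?thesis by simp
qed

section \<open>Triangles by strip and position\<close>

text \<open>
  The unit triangle with coordinates \<open>strip = s\<close> and \<open>mid_x = m\<close>. Within a strip the triangles are
  numbered consecutively from west to east, and \<open>tri_at s m\<close> points up if and only if \<open>m + s\<close> is odd.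
\<close>

definition tri_at :: "int \<Rightarrow> int \<Rightarrow> tri" where
  "tri_at s m = (if odd (m + s) then Up ((m - s - 1) div 2, s) else Down ((m - s - 2) div 2, s + 1))"

lemma strip_tri_at [simp]: "strip (tri_at s m) = s"
  and mid_x_tri_at [simp]: "mid_x (tri_at s m) = m"
  by (auto simp: tri_at_def elim!: oddE evenE)

lemma tri_at_strip_mid_x [simp]: "tri_at (strip t) (mid_x t) = t"
  by (cases t) (auto simp: tri_at_def)

lemma tri_eq_iff: "s = t \<longleftrightarrow> strip s = strip t \<and> mid_x s = mid_x t"
  by (metis tri_at_strip_mid_x)

lemma tri_at_eq_iff [simp]: "tri_at s m = tri_at s' m' \<longleftrightarrow> s = s' \<and> m = m'"
  by (metis strip_tri_at mid_x_tri_at)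

lemma card_2_obtain:
  assumes "card (A \<inter> B) = 2"
  obtains u v where "u \<in> A" "v \<in> A" "u \<in> B" "v \<in> B" "u \<noteq> v"
  using assms by (auto simp: card_2_iff)

text \<open>
  A lozenge either consists of two neighbours in one strip, or of an up-pointing triangle and the
  down-pointing triangle below it.
\<close>

lemma lozenge_iff:
  "l \<in> lozenges \<longleftrightarrow> (\<exists>s m. l = {tri_at s m, tri_at s (m + 1)}) \<or>
     (\<exists>s m. odd (m + s) \<and> l = {tri_at s m, tri_at (s - 1) m})"
proof
  assume "l \<in> lozenges"
  then obtain s t where l: "l = {s, t}" and c: "card (vertices s \<inter> vertices t) = 2"
    by (auto simp: lozenges_def)
  have UD: "(\<exists>s m. {Up p, Down q} = {tri_at s m, tri_at s (m + 1)}) \<or>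
     (\<exists>s m. odd (m + s) \<and> {Up p, Down q} = {tri_at s m, tri_at (s - 1) m})"
    if c: "card (vertices (Up p) \<inter> vertices (Down q)) = 2" for p q
  proof -
    obtain i j where p: "p = (i, j)" by (cases p)
    obtain k h where q: "q = (k, h)" by (cases q)
    obtain u v where uv: "u \<in> vertices (Up p)" "v \<in> vertices (Up p)" "u \<in> vertices (Down q)" "v \<in> vertices (Down q)" "u \<noteq> v"
      by (rule card_2_obtain[OF c])
    then have "(k = i \<and> h = j) \<or> (k = i \<and> h = j + 1) \<or> (k = i - 1 \<and> h = j + 1)"
      by (auto simp: p q)
    moreover have "Up (i, j) = tri_at j (2 * i + j + 1)"
      by (simp add: tri_eq_iff)
    moreover have "Down (k, h) = tri_at (h - 1) (2 * k + h + 1)"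
      by (simp add: tri_eq_iff)
    ultimately consider "{Up p, Down q} = {tri_at j (2 * i + j + 1), tri_at (j - 1) (2 * i + j + 1)}"
      | "{Up p, Down q} = {tri_at j (2 * i + j + 1), tri_at j (2 * i + j + 1 + 1)}"
      | "{Up p, Down q} = {tri_at j (2 * i + j), tri_at j (2 * i + j + 1)}"
      by (auto simp: p q algebra_simps insert_commute)
    then show ?thesis
    proof cases
      case 1
      then show ?thesis by (intro disjI2 exI[of _ j] exI[of _ "2 * i + j + 1"]) auto
    qed blast+
  qed
  have UU: False if c: "card (vertices (Up p) \<inter> vertices (Up q)) = 2" "p \<noteq> q" for p q
  proof -
    obtain i j where p: "p = (i, j)" by (cases p)
    obtain k h where q: "q = (k, h)" by (cases q)
    obtain u v where uv: "u \<in> vertices (Up p)" "v \<in> vertices (Up p)" "u \<in> vertices (Up q)" "v \<in> vertices (Up q)" "u \<noteq> v"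
      by (rule card_2_obtain[OF c(1)])
    then show False using c(2) by (auto simp: p q)
  qed
  have DD: False if c: "card (vertices (Down p) \<inter> vertices (Down q)) = 2" "p \<noteq> q" for p q
  proof -
    obtain i j where p: "p = (i, j)" by (cases p)
    obtain k h where q: "q = (k, h)" by (cases q)
    obtain u v where uv: "u \<in> vertices (Down p)" "v \<in> vertices (Down p)" "u \<in> vertices (Down q)" "v \<in> vertices (Down q)" "u \<noteq> v"
      by (rule card_2_obtain[OF c(1)])
    then show False using c(2) by (auto simp: p q)
  qed
  have self: "card (vertices t) = 3" for t
    by (cases t rule: vertices.cases) auto
  have "s \<noteq> t"
    using c self[of s] by auto
  then show "(\<exists>s m. l = {tri_at s m, tri_at s (m + 1)}) \<or>
     (\<exists>s m. odd (m + s) \<and> l = {tri_at s m, tri_at (s - 1) m})"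
  proof (cases s)
    case s: (Up p)
    show ?thesis
    proof (cases t)
      case (Up q)
      then show ?thesis using UU[of p q] c \<open>s \<noteq> t\<close> unfolding s by blast
    next
      case (Down q)
      then show ?thesis using UD[of p q] c unfolding l s by (simp only:)
    qed
  next
    case s: (Down p)
    show ?thesis
    proof (cases t)
      case (Up q)
      then show ?thesis using UD[of q p] c unfolding l s
        by (simp only: Int_commute[of "vertices (Down p)"] insert_commute[of "Down p"])
    next
      case (Down q)
      then show ?thesis using DD[of p q] c \<open>s \<noteq> t\<close> unfolding s by blast
    qed
  qed
next
  have loz: "{Up p, Down q} \<in> lozenges" if "vertices (Up p) \<inter> vertices (Down q) = {a, b}" "a \<noteq> b" for p q a b
    using that unfolding lozenges_def by (intro CollectI exI[of _ "Up p"] exI[of _ "Down q"]) simp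
  assume "(\<exists>s m. l = {tri_at s m, tri_at s (m + 1)}) \<or>
     (\<exists>s m. odd (m + s) \<and> l = {tri_at s m, tri_at (s - 1) m})"
  then show "l \<in> lozenges"
  proof (elim disjE exE conjE)
    fix s m assume l: "l = {tri_at s m, tri_at s (m + 1)}"
    show ?thesis
    proof (cases "odd (m + s)")
      case True
      then obtain i where m: "m = 2 * i + s + 1" 
        by (intro that[of "(m - s - 1) div 2"]) presburger
      have "tri_at s m = Up (i, s)" "tri_at s (m + 1) = Down (i, s + 1)"
        by (simp_all add: tri_eq_iff m)
      then show ?thesis
        unfolding l by (auto intro!: loz[of _ _ "(i + 1, s)" "(i, s + 1)"])
    next
      case False
      then obtain i where m: "m = 2 * i + s + 2"
        by (intro that[of "(m - s - 2) div 2"]) presburger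
      have "tri_at s m = Down (i, s + 1)" "tri_at s (m + 1) = Up (i + 1, s)"
        by (simp_all add: tri_eq_iff m)
      moreover have "{Up (i + 1, s), Down (i, s + 1)} \<in> lozenges"
        by (auto intro!: loz[of _ _ "(i + 1, s)" "(i + 1, s + 1)"])
      ultimately show ?thesis
        unfolding l by (simp add: insert_commute)
    qed
  next
    fix s m assume "odd (m + s)" and l: "l = {tri_at s m, tri_at (s - 1) m}"
    then obtain i where m: "m = 2 * i + s + 1"
      by (intro that[of "(m - s - 1) div 2"]) presburger
    have "tri_at s m = Up (i, s)" "tri_at (s - 1) m = Down (i, s)"
      by (simp_all add: tri_eq_iff m)
    then show ?thesis
      unfolding l by (auto intro!: loz[of _ _ "(i, s)" "(i + 1, s)"])
  qed
qed

section \<open>Tilings of a single strip\<close>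

text \<open>
  The triangles of strip \<open>s\<close> at the positions in \<open>A\<close>.
\<close>

definition row :: "int \<Rightarrow> int set \<Rightarrow> tri set" where
  "row s A = tri_at s ` A"

lemma row_simps [simp]:
  "row s {} = {}" "row s (A \<union> B) = row s A \<union> row s B" "row s (A \<inter> B) = row s A \<inter> row s B"
  "row s (A - B) = row s A - row s B" "finite A \<Longrightarrow> finite (row s A)"
  by (auto simp: row_def)

lemma in_row_iff: "t \<in> row s A \<longleftrightarrow> strip t = s \<and> mid_x t \<in> A"
  unfolding row_def by (metis imageE image_eqI mid_x_tri_at strip_tri_at tri_at_strip_mid_x)

lemma tri_at_in_row [simp]: "tri_at s m \<in> row s' A \<longleftrightarrow> s = s' \<and> m \<in> A"
  by (auto simp: in_row_iff)

lemma lozenge_in_row: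
  assumes "l \<in> lozenges" "l \<subseteq> row s A"
  obtains m where "l = {tri_at s m, tri_at s (m + 1)}" "m \<in> A" "m + 1 \<in> A"
  using assms by (auto simp: lozenge_iff)

text \<open>
  The vertical lozenge at position \<open>m\<close> on level \<open>s\<close>; it is a lozenge only if \<open>m + s\<close> is odd.
\<close>

definition vert :: "int \<Rightarrow> int \<Rightarrow> tri set" where
  "vert s m = {tri_at s m, tri_at (s - 1) m}"

text \<open>
  Weight \<open>\<omega>\<close> for the vertical lozenges at position 0. In the trapezoids below these are the ones with
  both left sides on the western zigzag.
\<close>

definition std_weight :: "real \<Rightarrow> tri set \<Rightarrow> real" where
  "std_weight \<omega> l = (if \<exists>s. l = vert s 0 then \<omega> else 1)"

lemma vert_eq_iff [simp]: "vert s m = vert s' m' \<longleftrightarrow> s = s' \<and> m = m'"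
  by (auto simp: vert_def doubleton_eq_iff)

lemma std_weight_vert [simp]: "std_weight \<omega> (vert s m) = (if m = 0 then \<omega> else 1)"
  by (auto simp: std_weight_def)

lemma std_weight_horizontal [simp]: "std_weight \<omega> {tri_at s m, tri_at s (m + 1)} = 1"
  by (auto simp: std_weight_def vert_def doubleton_eq_iff)

lemma std_weight_1 [simp]: "std_weight 1 = (\<lambda>_. 1)"
  by (auto simp: std_weight_def)

lemma tiling_sum_row_union:
  assumes "finite A" "finite B" "A \<inter> B = {}" "\<And>a b. a \<in> A \<Longrightarrow> b \<in> B \<Longrightarrow> \<bar>a - b\<bar> \<noteq> 1"
  shows "tiling_sum w (row s (A \<union> B)) = tiling_sum w (row s A) * tiling_sum w (row s B)"
  unfolding row_simps(2)
proof (rule tiling_sum_separated)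
  fix l assume l: "l \<in> lozenges" "l \<subseteq> row s A \<union> row s B"
  then have "l \<subseteq> row s (A \<union> B)" by simp
  with l(1) obtain m where m: "l = {tri_at s m, tri_at s (m + 1)}" "m \<in> A \<union> B" "m + 1 \<in> A \<union> B"
    by (rule lozenge_in_row)
  with assms(4)[of m "m + 1"] assms(4)[of "m + 1" m] show "l \<subseteq> row s A \<or> l \<subseteq> row s B"
    by auto
qed (use assms in \<open>auto simp: in_row_iff\<close>)

text \<open>
  The sign of a position. It alternates between up-pointing and down-pointing triangles of a
  strip, so that it sums to zero over a set of positions that can be tiled within the strip.
\<close>

definition sgp :: "int \<Rightarrow> int" where
  "sgp m = (if even m then 1 else - 1)"

lemma tiling_sum_row_unbalanced:
  assumes "finite A" "(\<Sum>m\<in>A. sgp m) \<noteq> 0"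
  shows "tiling_sum w (row s A) = 0"
proof -
  have "tilings (row s A) = {}"
  proof (rule ccontr)
    assume "tilings (row s A) \<noteq> {}"
    then obtain \<T> where T: "\<T> \<in> tilings (row s A)" by blast
    note t = tilingsD[OF T]
    have zero: "finite l \<and> (\<Sum>t\<in>l. sgp (mid_x t)) = 0" if "l \<in> \<T>" for l
    proof -
      have "l \<in> lozenges" "l \<subseteq> row s A" using t(1,4) that by auto
      then obtain m where "l = {tri_at s m, tri_at s (m + 1)}"
        by (rule lozenge_in_row)
      then show ?thesis by (auto simp: sgp_def)
    qed
    have "(\<Sum>m\<in>A. sgp m) = (\<Sum>t\<in>row s A. sgp (mid_x t))"
      unfolding row_def by (subst sum.reindex) (auto simp: inj_on_def)
    also have "\<dots> = (\<Sum>t\<in>\<Union>\<T>. sgp (mid_x t))"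
      by (simp add: t(1))
    also have "\<dots> = (\<Sum>l\<in>\<T>. \<Sum>t\<in>l. sgp (mid_x t))"
      by (subst sum.Union_disjoint) (use zero t(2) in auto)
    also have "\<dots> = 0"
      using zero by simp
    finally show False
      using assms(2) by simp
  qed
  then show ?thesis
    by (simp add: tiling_sum_def)
qed

lemma tiling_sum_row_interval:
  "tiling_sum (std_weight \<omega>) (row s {l..<l + 2 * int n}) = 1"
proof (induction n arbitrary: l)
  case (Suc n)
  let ?R = "row s {l..<l + 2 * int (Suc n)}" and ?l = "{tri_at s l, tri_at s (l + 1)}"
  have "tiling_sum (std_weight \<omega>) ?R = (\<Prod>l\<in>{?l}. std_weight \<omega> l) * tiling_sum (std_weight \<omega>) (?R - \<Union>{?l})"
  proof (rule tiling_sum_forced)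
    fix \<T> assume T: "\<T> \<in> tilings ?R"
    note t = tilingsD[OF T]
    have "tri_at s l \<in> \<Union>\<T>" unfolding t(1) by simp
    then obtain k where k: "k \<in> \<T>" "tri_at s l \<in> k" by blast
    then have "k \<in> lozenges" "k \<subseteq> ?R" using t(1,4) by auto
    then obtain m where "k = {tri_at s m, tri_at s (m + 1)}" "m \<in> {l..<l + 2 * int (Suc n)}"
      by (rule lozenge_in_row)
    with k show "{?l} \<subseteq> \<T>" by auto
  qed (auto simp: lozenge_iff)
  moreover have "?R - \<Union>{?l} = row s {l + 2..<(l + 2) + 2 * int n}"
    by (auto simp: in_row_iff tri_eq_iff)
  ultimately show ?case
    using Suc.IH[of "l + 2"] by simp
qed simp

lemma sum_sgp_interval: "l \<le> u \<Longrightarrow> (\<Sum>m\<in>{l..<u}. sgp m) = (if even (u - l) then 0 else sgp l)"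
proof (induction u rule: int_ge_induct)
  case (step u)
  have "{l..<u + 1} = insert u {l..<u}" using step.hyps by auto
  then show ?case using step by (auto simp: sgp_def)
qed simp

lemma sum_sgp_same_parity:
  assumes "\<And>x. x \<in> X \<Longrightarrow> even (x - c)"
  shows "(\<Sum>m\<in>X. sgp m) = sgp c * int (card X)"
proof -
  have "(\<Sum>m\<in>X. sgp m) = (\<Sum>m\<in>X. sgp c)"
    using assms by (intro sum.cong) (auto simp: sgp_def)
  then show ?thesis by simp
qed

lemma sum_sgp_gap:
  assumes "l \<le> u" "\<And>x. x \<in> X \<Longrightarrow> even (x - c)"
  shows "(\<Sum>m\<in>{l..<u} - X. sgp m) = (if even (u - l) then 0 else sgp l) - sgp c * int (card (X \<inter> {l..<u}))"
proof -
  have "(\<Sum>m\<in>{l..<u} - X. sgp m) = (\<Sum>m\<in>{l..<u} - X \<inter> {l..<u}. sgp m)"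
    by (intro sum.cong) auto
  also have "\<dots> = (\<Sum>m\<in>{l..<u}. sgp m) - (\<Sum>m\<in>X \<inter> {l..<u}. sgp m)"
    by (rule sum_diff) auto
  finally show ?thesis
    using sum_sgp_interval[OF assms(1)] sum_sgp_same_parity[of "X \<inter> {l..<u}" c] assms(2) by auto
qed

text \<open>
  A segment of a strip from which triangles of one kind are removed has at most one tiling.
\<close>

lemma tiling_sum_segment_even:
  assumes "l \<le> u" "even (u - l)" "\<And>x. x \<in> X \<Longrightarrow> even (x - c)"
  shows "tiling_sum (std_weight \<omega>) (row s ({l..<u} - X)) = of_bool (X \<inter> {l..<u} = {})"
proof (cases "X \<inter> {l..<u} = {}")
  case True
  then have "{l..<u} - X = {l..<l + 2 * int (nat ((u - l) div 2))}"
    using assms(1,2) by auto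
  then show ?thesis
    using True by (simp only: tiling_sum_row_interval) simp
next
  case False
  then have "card (X \<inter> {l..<u}) \<noteq> 0" by auto
  then show ?thesis
    using False sum_sgp_gap[OF assms(1,3), of X] assms(2)
    by (subst tiling_sum_row_unbalanced) (auto simp: sgp_def)
qed

lemma tiling_sum_segment_odd:
  assumes "l \<le> u" "odd (u - l)" "\<And>x. x \<in> X \<Longrightarrow> even (x - l)"
  shows "tiling_sum (std_weight \<omega>) (row s ({l..<u} - X)) = of_bool (card (X \<inter> {l..<u}) = 1)"
proof (cases "card (X \<inter> {l..<u}) = 1")
  case True
  then obtain x where x: "X \<inter> {l..<u} = {x}" by (auto simp: card_1_singleton_iff)
  then have xlu: "x \<in> X" "l \<le> x" "x < u" by auto
  have ev: "even (x - l)" "even (u - (x + 1))" using assms(3)[OF xlu(1)] assms(2) by auto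
  have len: "l + 2 * int (nat ((x - l) div 2)) = x" "(x + 1) + 2 * int (nat ((u - (x + 1)) div 2)) = u"
    using ev xlu by auto
  have one: "tiling_sum (std_weight \<omega>) (row s {l..<x}) = 1" "tiling_sum (std_weight \<omega>) (row s {x + 1..<u}) = 1"
    using tiling_sum_row_interval[of \<omega> s l "nat ((x - l) div 2)"]
      tiling_sum_row_interval[of \<omega> s "x + 1" "nat ((u - (x + 1)) div 2)"] unfolding len by auto
  have "{l..<u} - X = {l..<u} - {x}"
    using x by blast
  also have "\<dots> = {l..<x} \<union> {x + 1..<u}"
    using xlu by auto
  also have "tiling_sum (std_weight \<omega>) (row s \<dots>) = 1"
    by (subst tiling_sum_row_union) (auto simp: one)
  finally show ?thesis
    using True by simp
next
  case False
  then show ?thesis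
    using sum_sgp_gap[OF assms(1,3), of X] assms(2)
    by (subst tiling_sum_row_unbalanced) (auto simp: sgp_def)
qed

lemma tiling_sum_segment_bad:
  assumes "l \<le> u" "odd (u - l)" "\<And>x. x \<in> X \<Longrightarrow> odd (x - l)"
  shows "tiling_sum (std_weight \<omega>) (row s ({l..<u} - X)) = 0"
proof -
  have "even (x - (l + 1))" if "x \<in> X" for x
    using assms(3)[OF that] by auto
  from sum_sgp_gap[OF assms(1) this, of X] show ?thesis
    using assms(2) by (intro tiling_sum_row_unbalanced) (auto simp: sgp_def split: if_splits)
qed

lemma tiling_sum_row_split:
  fixes d :: "nat \<Rightarrow> int"
  assumes "\<And>i j. i < j \<Longrightarrow> j < n \<Longrightarrow> d i < d j" "\<And>i. i < n \<Longrightarrow> 0 \<le> d i \<and> d i < u"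
  shows "tiling_sum w (row s ({0..<u} - d ` {..<n} - X)) =
    (\<Prod>i\<le>n. tiling_sum w (row s ({if i = 0 then 0 else d (i - 1) + 1..<if i < n then d i else u} - X)))"
  using assms
proof (induction n arbitrary: u)
  case (Suc n)
  have "{0..<u} - d ` {..<Suc n} - X = ({0..<d n} - d ` {..<n} - X) \<union> ({d n + 1..<u} - X)"
    using Suc.prems(1)[of _ n] Suc.prems(2)[of n] by (fastforce simp: lessThan_Suc less_Suc_eq)
  also have "tiling_sum w (row s \<dots>) =
     tiling_sum w (row s ({0..<d n} - d ` {..<n} - X)) * tiling_sum w (row s ({d n + 1..<u} - X))"
    by (rule tiling_sum_row_union) auto
  also have "tiling_sum w (row s ({0..<d n} - d ` {..<n} - X)) =
    (\<Prod>i\<le>n. tiling_sum w (row s ({if i = 0 then 0 else d (i - 1) + 1..<if i < n then d i else d n} - X)))"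
    by (rule Suc.IH) (use Suc.prems in auto)
  also have "\<dots> = (\<Prod>i\<le>n. tiling_sum w (row s ({if i = 0 then 0 else d (i - 1) + 1..<if i < Suc n then d i else u} - X)))"
    by (intro prod.cong refl) (auto simp: less_Suc_eq)
  finally show ?case
    by simp
qed simp

lemma prod_of_bool: "finite I \<Longrightarrow> (\<Prod>i\<in>I. of_bool (p i)) = (of_bool (\<forall>i\<in>I. p i) :: real)"
  by (induction I rule: finite_induct) auto

lemma tiling_sum_row_even:
  fixes d :: "nat \<Rightarrow> int"
  assumes d: "\<And>i j. i < j \<Longrightarrow> j < n \<Longrightarrow> d i < d j" "\<And>i. i < n \<Longrightarrow> 0 \<le> d i \<and> d i < u \<and> odd (d i)"
    and "even u" "0 \<le> u" and X: "\<And>x. x \<in> X \<Longrightarrow> even x"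
  shows "tiling_sum (std_weight \<omega>) (row s ({0..<u} - d ` {..<n} - X)) =
    of_bool ((\<forall>i<n. card (X \<inter> {if i = 0 then 0 else d (i - 1) + 1..<d i}) = 1) \<and>
      X \<inter> {if n = 0 then 0 else d (n - 1) + 1..<u} = {})"
proof -
  have "tiling_sum (std_weight \<omega>) (row s ({0..<u} - d ` {..<n} - X)) =
    (\<Prod>i\<le>n. tiling_sum (std_weight \<omega>) (row s ({if i = 0 then 0 else d (i - 1) + 1..<if i < n then d i else u} - X)))"
    by (rule tiling_sum_row_split) (use d in auto)
  also have "\<dots> = (\<Prod>i<n. of_bool (card (X \<inter> {if i = 0 then 0 else d (i - 1) + 1..<d i}) = 1)) *
     of_bool (X \<inter> {if n = 0 then 0 else d (n - 1) + 1..<u} = {})"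
    unfolding lessThan_Suc_atMost[symmetric] prod.lessThan_Suc
  proof (intro arg_cong2[where f = "(*)"] prod.cong refl)
    fix i assume i: "i \<in> {..<n}"
    have lo: "even (if i = 0 then 0 else d (i - 1) + 1)" "(if i = 0 then 0 else d (i - 1) + 1) \<le> d i"
      using d(1)[of "i - 1" i] d(2)[of "i - 1"] d(2)[of i] i by (auto simp: Suc_le_eq)
    show "tiling_sum (std_weight \<omega>) (row s ({if i = 0 then 0 else d (i - 1) + 1..<if i < n then d i else u} - X)) =
       of_bool (card (X \<inter> {if i = 0 then 0 else d (i - 1) + 1..<d i}) = 1)"
      using tiling_sum_segment_odd[OF lo(2), of X \<omega> s] lo(1) d(2)[of i] i X by auto
  next
    have lo: "even (if n = 0 then 0 else d (n - 1) + 1)" "(if n = 0 then 0 else d (n - 1) + 1) \<le> u"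
      using d(2)[of "n - 1"] \<open>0 \<le> u\<close> by auto
    show "tiling_sum (std_weight \<omega>) (row s ({if n = 0 then 0 else d (n - 1) + 1..<if n < n then d n else u} - X)) =
       of_bool (X \<inter> {if n = 0 then 0 else d (n - 1) + 1..<u} = {})"
      using tiling_sum_segment_even[OF lo(2), of X 0 \<omega> s] lo(1) \<open>even u\<close> X by auto
  qed
  finally show ?thesis
    by (simp add: prod_of_bool lessThan_def)
qed

lemma tiling_sum_row_odd:
  fixes d :: "nat \<Rightarrow> int"
  assumes d: "\<And>i j. i < j \<Longrightarrow> j < Suc n \<Longrightarrow> d i < d j" "\<And>i. i < Suc n \<Longrightarrow> 0 \<le> d i \<and> d i < u \<and> even (d i)"
    and "odd u" and X: "\<And>x. x \<in> X \<Longrightarrow> odd x"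
  shows "tiling_sum (std_weight \<omega>) (row s ({0..<u} - d ` {..<Suc n} - X)) =
    of_bool (X \<inter> {0..<d 0} = {} \<and> (\<forall>i<n. card (X \<inter> {d i + 1..<d (Suc i)}) = 1) \<and> X \<inter> {d n + 1..<u} = {})"
proof -
  have "tiling_sum (std_weight \<omega>) (row s ({0..<u} - d ` {..<Suc n} - X)) =
    (\<Prod>i\<le>Suc n. tiling_sum (std_weight \<omega>) (row s ({if i = 0 then 0 else d (i - 1) + 1..<if i < Suc n then d i else u} - X)))"
    by (rule tiling_sum_row_split) (use d in auto)
  also have "\<dots> = of_bool (X \<inter> {0..<d 0} = {}) * ((\<Prod>i<n. of_bool (card (X \<inter> {d i + 1..<d (Suc i)}) = 1)) *
     of_bool (X \<inter> {d n + 1..<u} = {}))"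
    unfolding prod.atMost_Suc_shift unfolding lessThan_Suc_atMost[symmetric] prod.lessThan_Suc
  proof (intro arg_cong2[where f = "(*)"] prod.cong refl)
    show "tiling_sum (std_weight \<omega>) (row s ({if 0 = 0 then 0 else d (0 - 1) + 1..<if 0 < Suc n then d 0 else u} - X)) =
       of_bool (X \<inter> {0..<d 0} = {})"
      using tiling_sum_segment_even[of 0 "d 0" X 1 \<omega> s] d(2)[of 0] X by auto
    fix i assume i: "i \<in> {..<n}"
    show "tiling_sum (std_weight \<omega>) (row s ({if Suc i = 0 then 0 else d (Suc i - 1) + 1..<if Suc i < Suc n then d (Suc i) else u} - X)) =
       of_bool (card (X \<inter> {d i + 1..<d (Suc i)}) = 1)"
      using tiling_sum_segment_odd[of "d i + 1" "d (Suc i)" X \<omega> s] d(1)[of i "Suc i"] d(2)[of i] d(2)[of "Suc i"] i X by auto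
  next
    show "tiling_sum (std_weight \<omega>) (row s ({if Suc n = 0 then 0 else d (Suc n - 1) + 1..<if Suc n < Suc n then d (Suc n) else u} - X)) =
       of_bool (X \<inter> {d n + 1..<u} = {})"
      using tiling_sum_segment_even[of "d n + 1" u X 1 \<omega> s] d(2)[of n] \<open>odd u\<close> X by auto
  qed
  finally show ?thesis
    by (simp add: prod_of_bool lessThan_def)
qed

lemma sum_transversals:
  fixes I :: "nat \<Rightarrow> 'a set"
  assumes "finite U" "\<And>i. i < n \<Longrightarrow> I i \<subseteq> U" "\<And>i j. i < j \<Longrightarrow> j < n \<Longrightarrow> I i \<inter> I j = {}"
  shows "(\<Sum>X\<in>Pow U. g X * of_bool (X \<subseteq> (\<Union>i<n. I i) \<and> (\<forall>i<n. card (X \<inter> I i) = 1))) =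
    (\<Sum>h\<in>Pi\<^sub>E {..<n} I. g (h ` {..<n}) :: real)"
proof -
  let ?p = "\<lambda>X. X \<subseteq> (\<Union>i<n. I i) \<and> (\<forall>i<n. card (X \<inter> I i) = 1)"
  have disj: "i = j" if "x \<in> I i" "x \<in> I j" "i < n" "j < n" for x and i j :: nat
    using assms(3)[of i j] assms(3)[of j i] that by (cases i j rule: linorder_cases) auto
  have "(\<Sum>X\<in>Pow U. g X * of_bool (?p X)) = (\<Sum>X\<in>{X \<in> Pow U. ?p X}. g X)"
    by (rule sum.mono_neutral_cong_right) (use assms(1) in auto)
  also have "\<dots> = (\<Sum>h\<in>Pi\<^sub>E {..<n} I. g (h ` {..<n}))"
  proof (rule sum.reindex_bij_witness[where j = "\<lambda>X. restrict (\<lambda>i. the_elem (X \<inter> I i)) {..<n}" and i = "\<lambda>h. h ` {..<n}"])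
    fix X assume X: "X \<in> {X \<in> Pow U. ?p X}"
    have the: "X \<inter> I i = {the_elem (X \<inter> I i)}" if "i < n" for i
    proof -
      have "card (X \<inter> I i) = 1" using X that by auto
      then obtain x where "X \<inter> I i = {x}" by (auto simp: card_1_singleton_iff)
      then show ?thesis by simp
    qed
    have X': "X = (\<Union>i<n. X \<inter> I i)" using X by auto
    also have "\<dots> = (\<lambda>i. the_elem (X \<inter> I i)) ` {..<n}"
      using the by auto
    finally show "restrict (\<lambda>i. the_elem (X \<inter> I i)) {..<n} ` {..<n} = X"
      by simp
    then show "g (restrict (\<lambda>i. the_elem (X \<inter> I i)) {..<n} ` {..<n}) = g X"
      by simp
    show "restrict (\<lambda>i. the_elem (X \<inter> I i)) {..<n} \<in> Pi\<^sub>E {..<n} I"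
      using the by auto
  next
    fix h assume h: "h \<in> Pi\<^sub>E {..<n} I"
    have hi: "h ` {..<n} \<inter> I i = {h i}" if "i < n" for i
      using h that disj by (auto simp: PiE_def Pi_def)
    show "restrict (\<lambda>i. the_elem (h ` {..<n} \<inter> I i)) {..<n} = h"
      using h hi by (auto simp: PiE_def extensional_def restrict_def fun_eq_iff)
    show "h ` {..<n} \<in> {X \<in> Pow U. ?p X}"
      using h hi assms(2) by (auto simp: PiE_def Pi_def)
  qed
  finally show ?thesis .
qed

section \<open>Dented trapezoids\<close>

text \<open>
  The trapezoid with \<open>k\<close> strips below level 0, a top side of length \<open>c\<close>, a vertical zigzag as western
  side and an eastern side running SE.
\<close>

definition trap :: "nat \<Rightarrow> nat \<Rightarrow> tri set" where
  "trap c k = {t. - int k \<le> strip t \<and> strip t < 0 \<and> 0 \<le> mid_x t \<and> mid_x t < 2 * int c - strip t}"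

text \<open>
  The tiling sum of the trapezoid from whose lowest strip the triangles at the positions in \<open>D\<close>
  (the dents) are removed.
\<close>

definition tsum :: "real \<Rightarrow> nat \<Rightarrow> nat \<Rightarrow> int set \<Rightarrow> real" where
  "tsum \<omega> c k D = tiling_sum (std_weight \<omega>) (trap c k - row (- int k) D)"

lemma trap_0 [simp]: "trap c 0 = {}"
  by (auto simp: trap_def)

lemma trap_Suc: "trap c (Suc k) = trap c k \<union> row (- int (Suc k)) {0..<2 * int c + int (Suc k)}"
  by (auto simp: trap_def in_row_iff)

lemma finite_trap [simp]: "finite (trap c k)"
  by (induction k) (simp_all add: trap_Suc)

lemma tsum_0 [simp]: "tsum \<omega> c 0 D = 1"
  by (simp add: tsum_def)

lemma in_vert_iff: "t \<in> vert s m \<longleftrightarrow> mid_x t = m \<and> (strip t = s \<or> strip t = s - 1)"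
  by (auto simp: vert_def tri_eq_iff)

lemma vert_lozenge: "odd (m + s) \<Longrightarrow> vert s m \<in> lozenges"
  by (auto simp: lozenge_iff vert_def)

lemma lozenge_cases:
  assumes "l \<in> lozenges"
  obtains (horizontal) s m where "l = {tri_at s m, tri_at s (m + 1)}"
    | (vertical) s m where "odd (m + s)" "l = vert s m"
  using assms by (auto simp: lozenge_iff vert_def)

text \<open>
  Cutting off the lowest strip. The vertical lozenges that cross the cut become dents of the
  shorter trapezoid.
\<close>

lemma tsum_Suc:
  assumes "k \<ge> 1" "\<And>m. m \<in> D \<Longrightarrow> even (m + int k)"
  shows "tsum \<omega> c (Suc k) D =
    (\<Sum>X\<in>Pow {m. 0 \<le> m \<and> m < 2 * int c + int k \<and> odd (m + int k)}.
      (\<Prod>m\<in>X. if m = 0 then \<omega> else 1) * tsum \<omega> c k X *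
      tiling_sum (std_weight \<omega>) (row (- int (Suc k)) ({0..<2 * int c + int (Suc k)} - D - X)))"
proof -
  let ?G = "{m. 0 \<le> m \<and> m < 2 * int c + int k \<and> odd (m + int k)}"
  let ?A = "trap c k" and ?B = "row (- int (Suc k)) ({0..<2 * int c + int (Suc k)} - D)"
  let ?v = "vert (- int k)"
  have stripA: "- int k \<le> strip t" if "t \<in> ?A" for t
    using that by (simp add: trap_def)
  have stripB: "strip t = - int (Suc k)" if "t \<in> ?B" for t
    using that by (simp add: in_row_iff del: row_simps)
  have K: "?v ` ?G = {l \<in> lozenges. l \<subseteq> ?A \<union> ?B \<and> l \<inter> ?A \<noteq> {} \<and> l \<inter> ?B \<noteq> {}}"
  proof (intro equalityI subsetI)
    fix l assume "l \<in> ?v ` ?G"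
    then obtain m where m: "l = ?v m" "0 \<le> m" "m < 2 * int c + int k" "odd (m + int k)" by blast
    then have "m \<notin> D" using assms(2)[of m] by auto
    then have "tri_at (- int k) m \<in> ?A" "tri_at (- int k - 1) m \<in> ?B"
      using m assms(1) by (auto simp: trap_def)
    moreover have "l \<in> lozenges"
      using m by (auto intro: vert_lozenge)
    ultimately show "l \<in> {l \<in> lozenges. l \<subseteq> ?A \<union> ?B \<and> l \<inter> ?A \<noteq> {} \<and> l \<inter> ?B \<noteq> {}}"
      unfolding m(1) vert_def by blast
  next
    fix l assume l: "l \<in> {l \<in> lozenges. l \<subseteq> ?A \<union> ?B \<and> l \<inter> ?A \<noteq> {} \<and> l \<inter> ?B \<noteq> {}}"
    then obtain a b where ab: "a \<in> l" "a \<in> ?A" "b \<in> l" "b \<in> ?B" by blast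
    have "l \<in> lozenges" using l by blast
    then show "l \<in> ?v ` ?G"
    proof (cases rule: lozenge_cases)
      case (horizontal s m)
      then show ?thesis using ab stripA[of a] stripB[of b] by auto
    next
      case (vertical s m)
      then have s: "s = - int k" "a = tri_at s m"
        using ab stripA[of a] stripB[of b] by (auto simp: in_vert_iff tri_eq_iff)
      then have "0 \<le> m" "m < 2 * int c + int k"
        using ab(2) by (auto simp: trap_def)
      then show ?thesis using vertical s by auto
    qed
  qed
  have "trap c (Suc k) - row (- int (Suc k)) D = ?A \<union> ?B"
    using stripA by (fastforce simp: trap_Suc in_row_iff)
  then have "tsum \<omega> c (Suc k) D = tiling_sum (std_weight \<omega>) (?A \<union> ?B)"
    by (simp add: tsum_def)
  also have "\<dots> = (\<Sum>X\<in>Pow (?v ` ?G). (\<Prod>l\<in>X. std_weight \<omega> l) *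
      tiling_sum (std_weight \<omega>) (?A - \<Union>X) * tiling_sum (std_weight \<omega>) (?B - \<Union>X))"
  proof (rule tiling_sum_cut[OF K])
    show "?A \<inter> ?B = {}" using stripA stripB by force
    show "disjoint (?v ` ?G)" by (auto simp: disjoint_def in_vert_iff)
  qed auto
  also have "\<dots> = (\<Sum>X\<in>Pow ?G. (\<Prod>l\<in>?v ` X. std_weight \<omega> l) *
      tiling_sum (std_weight \<omega>) (?A - \<Union>(?v ` X)) * tiling_sum (std_weight \<omega>) (?B - \<Union>(?v ` X)))"
    unfolding image_Pow_surj[OF refl, symmetric]
    by (subst sum.reindex[OF inj_on_image_Pow]) (simp_all add: inj_on_def)
  also have "\<dots> = (\<Sum>X\<in>Pow ?G. (\<Prod>m\<in>X. if m = 0 then \<omega> else 1) * tsum \<omega> c k X *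
      tiling_sum (std_weight \<omega>) (row (- int (Suc k)) ({0..<2 * int c + int (Suc k)} - D - X)))"
  proof (intro sum.cong refl)
    fix X assume "X \<in> Pow ?G"
    have 1: "(\<Prod>l\<in>?v ` X. std_weight \<omega> l) = (\<Prod>m\<in>X. if m = 0 then \<omega> else 1)"
      by (subst prod.reindex) (auto simp: inj_on_def)
    have 2: "?A - \<Union>(?v ` X) = trap c k - row (- int k) X"
      by (auto simp: in_vert_iff in_row_iff trap_def)
    have 3: "?B - \<Union>(?v ` X) = row (- int (Suc k)) ({0..<2 * int c + int (Suc k)} - D - X)"
      by (auto simp: in_vert_iff in_row_iff)
    show "(\<Prod>l\<in>?v ` X. std_weight \<omega> l) *
      tiling_sum (std_weight \<omega>) (?A - \<Union>(?v ` X)) * tiling_sum (std_weight \<omega>) (?B - \<Union>(?v ` X)) =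
      (\<Prod>m\<in>X. if m = 0 then \<omega> else 1) * tsum \<omega> c k X *
      tiling_sum (std_weight \<omega>) (row (- int (Suc k)) ({0..<2 * int c + int (Suc k)} - D - X))"
      unfolding 1 2 3 tsum_def ..
  qed
  finally show ?thesis .
qed

lemma locate:
  fixes d :: "nat \<Rightarrow> int"
  assumes "0 \<le> m" "m \<notin> d ` {..<n}"
  shows "(\<exists>i<n. (if i = 0 then 0 else d (i - 1) + 1) \<le> m \<and> m < d i) \<or> (if n = 0 then 0 else d (n - 1) + 1) \<le> m"
  using assms(2)
proof (induction n)
  case (Suc n)
  then have "m \<noteq> d n" "m \<notin> d ` {..<n}" by (auto simp: lessThan_Suc)
  from Suc.IH[OF this(2)] show ?case
  proof
    assume "\<exists>i<n. (if i = 0 then 0 else d (i - 1) + 1) \<le> m \<and> m < d i"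
    then show ?thesis by (meson less_SucI)
  next
    assume lo: "(if n = 0 then 0 else d (n - 1) + 1) \<le> m"
    show ?thesis
    proof (cases "m < d n")
      case True
      with lo show ?thesis by blast
    next
      case False
      with \<open>m \<noteq> d n\<close> show ?thesis by simp
    qed
  qed
qed (use assms(1) in simp)

lemma nat_le_pred: "i < n \<Longrightarrow> i \<le> n - (1::nat)"
  by simp

lemma strict_increasing_le:
  fixes d :: "nat \<Rightarrow> int"
  assumes "\<And>i j. i < j \<Longrightarrow> j < n \<Longrightarrow> d i < d j" "i \<le> j" "j < n"
  shows "d i \<le> d j"
  using assms by (cases "i = j") (auto simp: le_less)

lemma strict_increasing_pred:
  fixes d :: "nat \<Rightarrow> int"
  assumes "\<And>i j. i < j \<Longrightarrow> j < n \<Longrightarrow> d i < d j" "i < j" "j < n"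
  shows "d i \<le> d (j - 1)"
  by (rule strict_increasing_le[of n d, OF assms(1)]) (use assms(2,3) in auto)

text \<open>
  The two interlacing rules: each gap between neighbouring dents contains exactly one
  crossing lozenge. If the new number of levels is even, the zigzag counts as a dent on the left
  of all others, and position 0 is a possible crossing; if it is odd, the number of crossings is
  one less than the number of dents.
\<close>

lemma tsum_to_even:
  fixes d :: "nat \<Rightarrow> int"
  assumes "odd k" and d: "\<And>i j. i < j \<Longrightarrow> j < n \<Longrightarrow> d i < d j"
    "\<And>i. i < n \<Longrightarrow> 0 \<le> d i \<and> d i < 2 * int c + int (Suc k) \<and> odd (d i)"
  shows "tsum \<omega> c (Suc k) (d ` {..<n}) =
    (\<Sum>h\<in>Pi\<^sub>E {..<n} (\<lambda>i. {m. (if i = 0 then 0 else d (i - 1) + 1) \<le> m \<and> m < d i \<and> even m}).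
      (\<Prod>i<n. if h i = 0 then \<omega> else 1) * tsum \<omega> c k (h ` {..<n}))"
proof -
  let ?lo = "\<lambda>i. if i = 0 then 0 else d (i - 1) + 1"
  let ?I = "\<lambda>i. {m. ?lo i \<le> m \<and> m < d i \<and> even m}"
  let ?G = "{m. 0 \<le> m \<and> m < 2 * int c + int k \<and> odd (m + int k)}"
  let ?u = "2 * int c + int (Suc k)"
  let ?g = "\<lambda>X. (\<Prod>m\<in>X. if m = 0 then \<omega> else 1) * tsum \<omega> c k X"
  have "tsum \<omega> c (Suc k) (d ` {..<n}) = (\<Sum>X\<in>Pow ?G. ?g X *
      tiling_sum (std_weight \<omega>) (row (- int (Suc k)) ({0..<?u} - d ` {..<n} - X)))"
    by (rule tsum_Suc) (use \<open>odd k\<close> d in \<open>auto simp: Suc_le_eq odd_pos\<close>)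
  also have "\<dots> = (\<Sum>X\<in>Pow ?G. ?g X * of_bool (X \<subseteq> (\<Union>i<n. ?I i) \<and> (\<forall>i<n. card (X \<inter> ?I i) = 1)))"
  proof (intro sum.cong refl arg_cong2[where f = "(*)"])
    fix X assume X: "X \<in> Pow ?G"
    have par: "even m" if "m \<in> X" for m using X that \<open>odd k\<close> by auto
    have rng: "0 \<le> m \<and> m < ?u" if "m \<in> X" for m using X that by auto
    have eq: "X \<inter> {?lo i..<d i} = X \<inter> ?I i" for i using par by auto
    have last: "X \<inter> {?lo n..<?u} = {} \<longleftrightarrow> X \<subseteq> (\<Union>i<n. ?I i)"
    proof
      assume L: "X \<inter> {?lo n..<?u} = {}"
      show "X \<subseteq> (\<Union>i<n. ?I i)"
      proof
        fix m assume m: "m \<in> X"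
        then have "m \<notin> d ` {..<n}" using par[OF m] d(2) by auto
        from locate[OF _ this] rng[OF m]
        have "(\<exists>i<n. ?lo i \<le> m \<and> m < d i) \<or> ?lo n \<le> m" by blast
        moreover have "\<not> ?lo n \<le> m"
        proof
          assume "?lo n \<le> m"
          then have "m \<in> X \<inter> {?lo n..<?u}" using m rng[OF m] by simp
          with L show False by blast
        qed
        ultimately obtain i where "i < n" "?lo i \<le> m" "m < d i" by blast
        then show "m \<in> (\<Union>i<n. ?I i)"
          using par[OF m] by blast
      qed
    next
      assume S: "X \<subseteq> (\<Union>i<n. ?I i)"
      show "X \<inter> {?lo n..<?u} = {}"
      proof (rule ccontr)
        assume "X \<inter> {?lo n..<?u} \<noteq> {}"
        then obtain m where m: "m \<in> X" "?lo n \<le> m" by auto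
        with S obtain i where i: "i < n" "m < d i" by blast
        then show False
          using m strict_increasing_le[of n d i "n - 1", OF d(1) nat_le_pred] by auto
      qed
    qed
    have "tiling_sum (std_weight \<omega>) (row (- int (Suc k)) ({0..<?u} - d ` {..<n} - X)) =
      of_bool ((\<forall>i<n. card (X \<inter> {?lo i..<d i}) = 1) \<and> X \<inter> {?lo n..<?u} = {})"
      by (rule tiling_sum_row_even) (use d par \<open>odd k\<close> in auto)
    then show "tiling_sum (std_weight \<omega>) (row (- int (Suc k)) ({0..<?u} - d ` {..<n} - X)) =
      of_bool (X \<subseteq> (\<Union>i<n. ?I i) \<and> (\<forall>i<n. card (X \<inter> ?I i) = 1))"
      unfolding eq last by (simp only: conj_ac)
  qed
  also have "\<dots> = (\<Sum>h\<in>Pi\<^sub>E {..<n} ?I. ?g (h ` {..<n}))"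
  proof (rule sum_transversals)
    show "finite ?G" by (rule finite_subset[of _ "{0..2 * int c + int k}"]) auto
    show "?I i \<subseteq> ?G" if "i < n" for i
    proof
      fix m assume m: "m \<in> ?I i"
      have "0 \<le> m"
      proof (cases "i = 0")
        case False
        then have "i - 1 < n" using that by simp
        from d(2)[OF this] m False show ?thesis by simp
      qed (use m in simp)
      moreover have "m < 2 * int c + int k" using m d(2)[OF that] by auto
      ultimately show "m \<in> ?G" using m \<open>odd k\<close> by auto
    qed
    show "?I i \<inter> ?I j = {}" if "i < j" "j < n" for i j
      using strict_increasing_pred[of n d i j, OF d(1)] that by auto
  qed
  also have "\<dots> = (\<Sum>h\<in>Pi\<^sub>E {..<n} ?I. (\<Prod>i<n. if h i = 0 then \<omega> else 1) * tsum \<omega> c k (h ` {..<n}))"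
  proof (intro sum.cong refl arg_cong2[where f = "(*)"])
    fix h assume h: "h \<in> Pi\<^sub>E {..<n} ?I"
    have "h i < h j" if "i < j" "j < n" for i j
      using PiE_mem[OF h, of i] PiE_mem[OF h, of j] strict_increasing_pred[of n d i j, OF d(1)] that by auto
    then have "inj_on h {..<n}" by (auto simp: inj_on_def) (metis less_irrefl linorder_neqE_nat)
    then show "(\<Prod>m\<in>h ` {..<n}. if m = 0 then \<omega> else 1) = (\<Prod>i<n. if h i = 0 then \<omega> else 1)"
      by (simp only: prod.reindex o_def)
  qed
  finally show ?thesis .
qed

lemma tsum_to_odd:
  fixes d :: "nat \<Rightarrow> int"
  assumes "even k" "k \<ge> 1" and d: "\<And>i j. i < j \<Longrightarrow> j < Suc n \<Longrightarrow> d i < d j"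
    "\<And>i. i < Suc n \<Longrightarrow> 0 \<le> d i \<and> d i < 2 * int c + int (Suc k) \<and> even (d i)"
  shows "tsum \<omega> c (Suc k) (d ` {..<Suc n}) =
    (\<Sum>h\<in>Pi\<^sub>E {..<n} (\<lambda>i. {m. d i < m \<and> m < d (Suc i) \<and> odd m}). tsum \<omega> c k (h ` {..<n}))"
proof -
  let ?I = "\<lambda>i. {m. d i < m \<and> m < d (Suc i) \<and> odd m}"
  let ?G = "{m. 0 \<le> m \<and> m < 2 * int c + int k \<and> odd (m + int k)}"
  let ?u = "2 * int c + int (Suc k)"
  have "tsum \<omega> c (Suc k) (d ` {..<Suc n}) = (\<Sum>X\<in>Pow ?G. (\<Prod>m\<in>X. if m = 0 then \<omega> else 1) * tsum \<omega> c k X *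
      tiling_sum (std_weight \<omega>) (row (- int (Suc k)) ({0..<?u} - d ` {..<Suc n} - X)))"
    by (rule tsum_Suc) (use assms(1,2) d in auto)
  also have "\<dots> = (\<Sum>X\<in>Pow ?G. tsum \<omega> c k X * of_bool (X \<subseteq> (\<Union>i<n. ?I i) \<and> (\<forall>i<n. card (X \<inter> ?I i) = 1)))"
  proof (intro sum.cong refl arg_cong2[where f = "(*)"])
    fix X assume X: "X \<in> Pow ?G"
    have par: "odd m" if "m \<in> X" for m using X that \<open>even k\<close> by auto
    have rng: "0 \<le> m \<and> m < ?u" if "m \<in> X" for m using X that by auto
    have "(\<Prod>m\<in>X. if m = 0 then \<omega> else 1) = 1"
      using par by (intro prod.neutral) auto
    then show "(\<Prod>m\<in>X. if m = 0 then \<omega> else 1) * tsum \<omega> c k X = tsum \<omega> c k X"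
      by simp
    have eq: "X \<inter> {d i + 1..<d (Suc i)} = X \<inter> ?I i" for i using par by auto
    have last: "X \<inter> {0..<d 0} = {} \<and> X \<inter> {d n + 1..<?u} = {} \<longleftrightarrow> X \<subseteq> (\<Union>i<n. ?I i)"
    proof
      assume L: "X \<inter> {0..<d 0} = {} \<and> X \<inter> {d n + 1..<?u} = {}"
      show "X \<subseteq> (\<Union>i<n. ?I i)"
      proof
        fix m assume m: "m \<in> X"
        then have nd: "m \<notin> d ` {..<Suc n}" using par[OF m] d(2) by auto
        have "\<not> d n + 1 \<le> m" "\<not> m < d 0" using L m rng[OF m] by auto
        then obtain i where i: "i < Suc n" "i \<noteq> 0" "d (i - 1) + 1 \<le> m" "m < d i"
          using locate[OF _ nd] rng[OF m] by (auto split: if_splits)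
        then obtain i' where "i = Suc i'" by (cases i) auto
        then show "m \<in> (\<Union>i<n. ?I i)"
          using i par[OF m] by (intro UN_I[of i']) auto
      qed
    next
      assume S: "X \<subseteq> (\<Union>i<n. ?I i)"
      have "d 0 < m \<and> m < d n" if "m \<in> X" for m
      proof -
        from S that obtain i where i: "i < n" "d i < m" "m < d (Suc i)" by blast
        then show ?thesis
          using strict_increasing_le[of "Suc n" d 0 i, OF d(1)] strict_increasing_le[of "Suc n" d "Suc i" n, OF d(1)] by auto
      qed
      then show "X \<inter> {0..<d 0} = {} \<and> X \<inter> {d n + 1..<?u} = {}"
        by fastforce
    qed
    have "tiling_sum (std_weight \<omega>) (row (- int (Suc k)) ({0..<?u} - d ` {..<Suc n} - X)) =
      of_bool (X \<inter> {0..<d 0} = {} \<and> (\<forall>i<n. card (X \<inter> {d i + 1..<d (Suc i)}) = 1) \<and> X \<inter> {d n + 1..<?u} = {})"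
      by (rule tiling_sum_row_odd) (use d par \<open>even k\<close> in auto)
    then show "tiling_sum (std_weight \<omega>) (row (- int (Suc k)) ({0..<?u} - d ` {..<Suc n} - X)) =
      of_bool (X \<subseteq> (\<Union>i<n. ?I i) \<and> (\<forall>i<n. card (X \<inter> ?I i) = 1))"
      unfolding eq last[symmetric] by (simp only: conj_ac)
  qed
  also have "\<dots> = (\<Sum>h\<in>Pi\<^sub>E {..<n} ?I. tsum \<omega> c k (h ` {..<n}))"
  proof (rule sum_transversals)
    show "finite ?G" by (rule finite_subset[of _ "{0..2 * int c + int k}"]) auto
    show "?I i \<subseteq> ?G" if "i < n" for i
    proof
      fix m assume m: "m \<in> ?I i"
      then show "m \<in> ?G" using d(2)[of i] d(2)[of "Suc i"] that \<open>even k\<close> by auto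
    qed
    show "?I i \<inter> ?I j = {}" if "i < j" "j < n" for i j
      using strict_increasing_le[of "Suc n" d "Suc i" j, OF d(1)] that by auto
  qed
  finally show ?thesis .
qed

lemma tsum_odd_no_dents:
  assumes "even k"
  shows "tsum \<omega> c (Suc k) {} = 0"
proof -
  have row: "tiling_sum (std_weight \<omega>) (row s ({0..<2 * int c + int (Suc k)} - X)) = 0"
    if "\<And>x. x \<in> X \<Longrightarrow> odd x" for X s
    by (rule tiling_sum_segment_bad) (use assms that in auto)
  show ?thesis
  proof (cases "k = 0")
    case True
    then show ?thesis
      using row[of "{}" "- 1"] by (simp add: tsum_def trap_Suc)
  next
    case False
    have "tsum \<omega> c (Suc k) {} = (\<Sum>X\<in>Pow {m. 0 \<le> m \<and> m < 2 * int c + int k \<and> odd (m + int k)}.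
      (\<Prod>m\<in>X. if m = 0 then \<omega> else 1) * tsum \<omega> c k X *
      tiling_sum (std_weight \<omega>) (row (- int (Suc k)) ({0..<2 * int c + int (Suc k)} - {} - X)))"
      by (rule tsum_Suc) (use False in auto)
    also have "\<dots> = 0"
      by (intro sum.neutral ballI) (use assms row in \<open>auto simp del: row_simps\<close>)
    finally show ?thesis .
  qed
qed

lemma tsum_1:
  fixes d :: "nat \<Rightarrow> int"
  assumes d: "\<And>i j. i < j \<Longrightarrow> j < n \<Longrightarrow> d i < d j"
    "\<And>i. i < n \<Longrightarrow> 0 \<le> d i \<and> d i < 2 * int c + 1 \<and> even (d i)"
  shows "tsum \<omega> c 1 (d ` {..<n}) = of_bool (n = 1)"
proof (cases n)
  case 0
  then show ?thesis using tsum_odd_no_dents[of 0 \<omega> c] by simp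
next
  case (Suc n')
  have "tsum \<omega> c 1 (d ` {..<n}) = tiling_sum (std_weight \<omega>) (row (- 1) ({0..<2 * int c + 1} - d ` {..<Suc n'} - {}))"
    by (simp add: tsum_def trap_Suc Suc)
  also have "\<dots> = of_bool ({} \<inter> {0..<d 0} = {} \<and> (\<forall>i<n'. card ({} \<inter> {d i + 1..<d (Suc i)}) = 1) \<and> {} \<inter> {d n' + 1..<2 * int c + 1} = {})"
    by (rule tiling_sum_row_odd) (use d Suc in auto)
  also have "\<dots> = of_bool (n = 1)"
    using Suc by auto
  finally show ?thesis .
qed

lemma sum_between:
  fixes \<phi> \<psi> :: "int \<Rightarrow> real"
  assumes "\<And>m. d < m \<Longrightarrow> m < d + 2 * int n \<Longrightarrow> odd (m - d) \<Longrightarrow> \<phi> m = \<psi> (m + 1) - \<psi> (m - 1)"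
  shows "(\<Sum>m\<in>{m. d < m \<and> m < d + 2 * int n \<and> odd (m - d)}. \<phi> m) = \<psi> (d + 2 * int n) - \<psi> d"
  using assms
proof (induction n)
  case 0
  have "{m. d < m \<and> m < d + 2 * int 0 \<and> odd (m - d)} = {}" by auto
  then show ?case by (simp only: sum.empty) simp
next
  case (Suc n)
  have "{m. d < m \<and> m < d + 2 * int (Suc n) \<and> odd (m - d)} =
      insert (d + 2 * int n + 1) {m. d < m \<and> m < d + 2 * int n \<and> odd (m - d)}"
    by (intro equalityI subsetI; simp; presburger)
  moreover have "finite {m. d < m \<and> m < d + 2 * int n \<and> odd (m - d)}"
    by (rule finite_subset[of _ "{d..d + 2 * int n}"]) auto
  moreover have "\<phi> (d + 2 * int n + 1) = \<psi> (d + 2 * int (Suc n)) - \<psi> (d + 2 * int n)"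
    by (subst Suc.prems) (auto simp: algebra_simps)
  ultimately show ?case
    using Suc.IH Suc.prems by simp
qed

lemma sum_between':
  fixes \<phi> \<psi> :: "int \<Rightarrow> real"
  assumes "d \<le> d'" "even (d' - d)"
    "\<And>m. d < m \<Longrightarrow> m < d' \<Longrightarrow> odd (m - d) \<Longrightarrow> \<phi> m = \<psi> (m + 1) - \<psi> (m - 1)"
  shows "(\<Sum>m\<in>{m. d < m \<and> m < d' \<and> odd (m - d)}. \<phi> m) = \<psi> d' - \<psi> d"
proof -
  obtain n where "d' = d + 2 * int n"
    using assms(1,2) by (intro that[of "nat ((d' - d) div 2)"]) auto
  then show ?thesis using sum_between[of d n \<phi> \<psi>] assms(3) by simp
qed

text \<open>
  The functions \<open>ev j\<close> and \<open>od j\<close> are discrete antiderivatives of each other. By linearity in each row,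
  the sum over the crossings in the gaps between dents of a determinant in the one turns into a
  determinant of differences of the other. The weight of the zigzag enters through the initial
  value of \<open>ev\<close>. The constant function \<open>od 0\<close> supplies the column of ones that is needed when the number
  of dents goes up by one.
\<close>

lemma tsum_det:
  fixes ev od :: "nat \<Rightarrow> int \<Rightarrow> real" and d :: "nat \<Rightarrow> int"
  assumes ev: "\<And>j m. m > 0 \<Longrightarrow> even m \<Longrightarrow> ev j (m + 1) - ev j (m - 1) = od j m"
    and ev1: "\<And>j. ev j 1 = \<omega> * od j 0"
    and od: "\<And>j m. m > 0 \<Longrightarrow> odd m \<Longrightarrow> od (Suc j) (m + 1) - od (Suc j) (m - 1) = ev j m"
    and od0: "\<And>m. od 0 m = 1"
    and "k \<ge> 1" "\<And>i j. i < j \<Longrightarrow> j < n \<Longrightarrow> d i < d j"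
    and "\<And>i. i < n \<Longrightarrow> 0 \<le> d i \<and> d i < 2 * int c + int k \<and> odd (d i + int k)"
  shows "tsum \<omega> c k (d ` {..<n}) =
    (if n = (k + 1) div 2 then fdet n (\<lambda>i j. (if even k then ev else od) j (d i)) else 0)"
  using assms(5-)
proof (induction k arbitrary: n d rule: nat_induct_at_least)
  case base
  have "tsum \<omega> c 1 (d ` {..<n}) = of_bool (n = 1)"
    by (rule tsum_1) (use base in auto)
  moreover have "fdet n (\<lambda>i j. od j (d i)) = 1" if "n = 1"
    unfolding that by (subst fdet_triangular) (simp_all add: od0)
  ultimately show ?case
    by auto
next
  case (Suc k)
  note d = Suc.prems
  show ?case
  proof (cases "even k")
    case True
    show ?thesis
    proof (cases n)
      case 0
      then show ?thesis using tsum_odd_no_dents[OF True, of \<omega> c] True by auto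
    next
      case n: (Suc n')
      let ?I = "\<lambda>i. {m. d i < m \<and> m < d (Suc i) \<and> odd m}"
      have "tsum \<omega> c (Suc k) (d ` {..<n}) = (\<Sum>h\<in>Pi\<^sub>E {..<n'} ?I. tsum \<omega> c k (h ` {..<n'}))"
        unfolding n by (rule tsum_to_odd) (use d True Suc.hyps n in auto)
      also have "\<dots> = (\<Sum>h\<in>Pi\<^sub>E {..<n'} ?I. if n' = (k + 1) div 2 then fdet n' (\<lambda>i j. ev j (h i)) else 0)"
      proof (rule sum.cong[OF refl])
        fix h assume h: "h \<in> Pi\<^sub>E {..<n'} ?I"
        have I: "d i < h i \<and> h i < d (Suc i) \<and> odd (h i)" if "i < n'" for i
          using PiE_mem[OF h, of i] that by simp
        have "tsum \<omega> c k (h ` {..<n'}) =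
          (if n' = (k + 1) div 2 then fdet n' (\<lambda>i j. (if even k then ev else od) j (h i)) else 0)"
        proof (rule Suc.IH)
          fix i j assume ij: "i < j" "j < n'"
          have "d (Suc i) \<le> d j"
            by (rule strict_increasing_le[of n d, OF d(1)]) (use ij n in auto)
          then show "h i < h j"
            using I[of i] I[of j] ij by auto
        next
          fix i assume "i < n'"
          then show "0 \<le> h i \<and> h i < 2 * int c + int k \<and> odd (h i + int k)"
            using I[of i] d(2)[of i] d(2)[of "Suc i"] n True by auto
        qed
        then show "tsum \<omega> c k (h ` {..<n'}) = (if n' = (k + 1) div 2 then fdet n' (\<lambda>i j. ev j (h i)) else 0)"
          using True by simp
      qed
      also have "\<dots> = (if n' = (k + 1) div 2 then fdet n (\<lambda>i j. od j (d i)) else 0)"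
      proof (cases "n' = (k + 1) div 2")
        case eq: True
        have "(\<Sum>h\<in>Pi\<^sub>E {..<n'} ?I. fdet n' (\<lambda>i j. ev j (h i))) =
            (\<Sum>h\<in>Pi\<^sub>E {..<n'} ?I. (\<Prod>i<n'. 1) * fdet n' (\<lambda>i j. ev j (h i)))"
          by simp
        also have "\<dots> = fdet n' (\<lambda>i j. \<Sum>m\<in>?I i. 1 * ev j m)"
        proof (rule fdet_sum_rows)
          show "finite (?I i)" for i
            by (rule finite_subset[of _ "{d i..d (Suc i)}"]) auto
        qed
        also have "\<dots> = fdet n' (\<lambda>i j. od (Suc j) (d (Suc i)) - od (Suc j) (d i))"
        proof (rule fdet_cong)
          fix i j assume "i < n'" "j < n'"
          then have di: "d i < d (Suc i)" "0 \<le> d i" "even (d i)" "even (d (Suc i))"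
            using d(1)[of i "Suc i"] d(2)[of i] d(2)[of "Suc i"] n True by auto
          have "(\<Sum>m\<in>{m. d i < m \<and> m < d (Suc i) \<and> odd (m - d i)}. ev j m) =
              od (Suc j) (d (Suc i)) - od (Suc j) (d i)"
            by (rule sum_between') (use di od in auto)
          moreover have "{m. d i < m \<and> m < d (Suc i) \<and> odd (m - d i)} = ?I i"
            using di by auto
          ultimately show "(\<Sum>m\<in>?I i. 1 * ev j m) = od (Suc j) (d (Suc i)) - od (Suc j) (d i)"
            by simp
        qed
        also have "\<dots> = fdet n (\<lambda>i j. od j (d i))"
          unfolding n by (rule fdet_differences_of_ones) (simp add: od0)
        finally show ?thesis
          using eq by simp
      qed simp
      also have "\<dots> = (if n = (Suc k + 1) div 2 then fdet n (\<lambda>i j. od j (d i)) else 0)"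
        using True n by (auto elim!: evenE)
      finally show ?thesis
        using True by simp
    qed
  next
    case False
    let ?I = "\<lambda>i. {m. (if i = 0 then 0 else d (i - 1) + 1) \<le> m \<and> m < d i \<and> even m}"
    have "tsum \<omega> c (Suc k) (d ` {..<n}) = (\<Sum>h\<in>Pi\<^sub>E {..<n} ?I.
        (\<Prod>i<n. if h i = 0 then \<omega> else 1) * tsum \<omega> c k (h ` {..<n}))"
      by (rule tsum_to_even) (use d False in auto)
    also have "\<dots> = (\<Sum>h\<in>Pi\<^sub>E {..<n} ?I. (\<Prod>i<n. if h i = 0 then \<omega> else 1) *
        (if n = (k + 1) div 2 then fdet n (\<lambda>i j. od j (h i)) else 0))"
    proof (intro sum.cong refl arg_cong2[where f = "(*)"])
      fix h assume h: "h \<in> Pi\<^sub>E {..<n} ?I"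
      have I: "(if i = 0 then 0 else d (i - 1) + 1) \<le> h i \<and> h i < d i \<and> even (h i)" if "i < n" for i
        using PiE_mem[OF h, of i] that by simp
      have "tsum \<omega> c k (h ` {..<n}) =
        (if n = (k + 1) div 2 then fdet n (\<lambda>i j. (if even k then ev else od) j (h i)) else 0)"
      proof (rule Suc.IH)
        fix i j assume ij: "i < j" "j < n"
        have "d i \<le> d (j - 1)"
          by (rule strict_increasing_le[of n d, OF d(1)]) (use ij in auto)
        then show "h i < h j"
          using I[of i] I[of j] ij by auto
      next
        fix i assume i: "i < n"
        have "0 \<le> h i"
        proof (cases "i = 0")
          case False
          then have "i - 1 < n" using i by simp
          from d(2)[OF this] I[OF i] False show ?thesis by simp
        qed (use I[OF i] in simp)
        then show "0 \<le> h i \<and> h i < 2 * int c + int k \<and> odd (h i + int k)"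
          using I[OF i] d(2)[OF i] False by auto
      qed
      then show "tsum \<omega> c k (h ` {..<n}) = (if n = (k + 1) div 2 then fdet n (\<lambda>i j. od j (h i)) else 0)"
        using False by simp
    qed
    also have "\<dots> = (if n = (k + 1) div 2 then fdet n (\<lambda>i j. ev j (d i)) else 0)"
    proof (cases "n = (k + 1) div 2")
      case eq: True
      have "(\<Sum>h\<in>Pi\<^sub>E {..<n} ?I. (\<Prod>i<n. if h i = 0 then \<omega> else 1) * fdet n (\<lambda>i j. od j (h i))) =
          fdet n (\<lambda>i j. \<Sum>m\<in>?I i. (if m = 0 then \<omega> else 1) * od j m)"
      proof (rule fdet_sum_rows)
        show "finite (?I i)" for i
          by (rule finite_subset[of _ "{if i = 0 then 0 else d (i - 1) + 1..d i}"]) auto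
      qed
      also have "\<dots> = fdet n (\<lambda>i j. if i = 0 then ev j (d 0) else ev j (d i) - ev j (d (i - 1)))"
      proof (rule fdet_cong)
        fix i j assume i: "i < n" "j < n"
        show "(\<Sum>m\<in>?I i. (if m = 0 then \<omega> else 1) * od j m) =
          (if i = 0 then ev j (d 0) else ev j (d i) - ev j (d (i - 1)))"
        proof (cases "i = 0")
          case True
          have di: "0 \<le> d 0" "odd (d 0)" using d(2)[of 0] i False by auto
          let ?ev = "\<lambda>m. if m = - 1 then 0 else ev j m"
          have "(\<Sum>m\<in>{m. - 1 < m \<and> m < d 0 \<and> odd (m - (- 1))}. (if m = 0 then \<omega> else 1) * od j m) =
              ?ev (d 0) - ?ev (- 1)"
          proof (rule sum_between')
            fix m :: int assume m: "- 1 < m" "m < d 0" "odd (m - (- 1))"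
            then show "(if m = 0 then \<omega> else 1) * od j m = ?ev (m + 1) - ?ev (m - 1)"
              using ev[of m j] ev1[of j] by (cases "m = 0") auto
          qed (use di in auto)
          moreover have "{m. - 1 < m \<and> m < d 0 \<and> odd (m - (- 1))} = ?I i"
            using True by auto
          ultimately show ?thesis
            using True di by auto
        next
          case i0: False
          have di: "d (i - 1) < d i" "0 \<le> d (i - 1)" "odd (d (i - 1))" "odd (d i)"
            using d(1)[of "i - 1" i] d(2)[of "i - 1"] d(2)[of i] i i0 False by auto
          have "(\<Sum>m\<in>{m. d (i - 1) < m \<and> m < d i \<and> odd (m - d (i - 1))}. (if m = 0 then \<omega> else 1) * od j m) =
              ev j (d i) - ev j (d (i - 1))"
            by (rule sum_between') (use di ev in auto)
          moreover have "{m. d (i - 1) < m \<and> m < d i \<and> odd (m - d (i - 1))} = ?I i"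
            using di i0 by auto
          ultimately show ?thesis
            using i0 by simp
        qed
      qed
      also have "\<dots> = fdet n (\<lambda>i j. ev j (d i))"
        by (rule fdet_row_differences)
      finally show ?thesis
        using eq by simp
    qed simp
    also have "\<dots> = (if n = (Suc k + 1) div 2 then fdet n (\<lambda>i j. ev j (d i)) else 0)"
      using False by (auto elim!: oddE)
    finally show ?thesis
      using False by simp
  qed
qed

section \<open>Closed forms for dented trapezoids\<close>

text \<open>
  The next lemmas exhibit the entries of the determinants as Newton bases in squares.
\<close>

lemma gbinomial_step2:
  fixes a :: real
  shows "(a + 1 gchoose (k + 2)) * (real k + 1) * (real k + 2) = (a + 1) * (a - real k) * (a gchoose k)"
proof -
  have 1: "(real k + 2) * (a + 1 gchoose (k + 2)) = (a + 1) * (a gchoose Suc k)"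
    using gbinomial_absorption[of "Suc k" "a + 1"] by (simp add: algebra_simps)
  have 2: "(a gchoose Suc k) * (real k + 1) = (a gchoose k) * (a - real k)"
    using gbinomial_mult_1[of a k] by (simp add: algebra_simps)
  have "(a + 1 gchoose (k + 2)) * (real k + 1) * (real k + 2) =
      (real k + 2) * (a + 1 gchoose (k + 2)) * (real k + 1)"
    by simp
  also have "\<dots> = (a + 1) * ((a gchoose Suc k) * (real k + 1))"
    by (simp only: 1 mult.assoc)
  also have "\<dots> = (a + 1) * (a - real k) * (a gchoose k)"
    by (simp only: 2 mult_ac)
  finally show ?thesis .
qed

lemma gbinomial_odd_newton:
  fixes x :: real
  shows "(x + real j gchoose (2 * j + 1)) = x * (\<Prod>l<j. x^2 - (real l + 1)^2) / fact (2 * j + 1)"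
proof (induction j)
  case (Suc j)
  have "(x + real (Suc j) gchoose (2 * Suc j + 1)) * (real (2 * j + 2) * real (2 * j + 3)) =
      (x + real j + 1) * (x - real j - 1) * (x + real j gchoose (2 * j + 1))"
    using gbinomial_step2[of "x + real j" "2 * j + 1"] by (simp add: algebra_simps)
  also have "\<dots> = x * (\<Prod>l<Suc j. x^2 - (real l + 1)^2) / fact (2 * j + 1)"
    unfolding Suc.IH by (simp add: field_simps power2_eq_square)
  finally have "(x + real (Suc j) gchoose (2 * Suc j + 1)) =
      x * (\<Prod>l<Suc j. x^2 - (real l + 1)^2) / fact (2 * j + 1) / (real (2 * j + 2) * real (2 * j + 3))"
    by (rule eq_divide_imp[rotated]) simp
  moreover have "fact (2 * Suc j + 1) = fact (2 * j + 1) * (real (2 * j + 2) * real (2 * j + 3))"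
    by (simp add: algebra_simps)
  ultimately show ?case
    by (simp only: divide_divide_eq_left)
qed simp

lemma gbinomial_even_newton:
  fixes x :: real
  shows "((x + real j gchoose (2 * j)) + (x + real j - 1 gchoose (2 * j))) / 2 =
    (\<Prod>l<j. x^2 - (real l)^2) / fact (2 * j)"
proof (cases j)
  case (Suc i)
  have 1: "real (2 * i + 2) * (x + real j gchoose (2 * j)) = (x + real j) * (x + real i gchoose (2 * i + 1))"
    using gbinomial_absorption[of "2 * i + 1" "x + real j"] by (simp add: Suc algebra_simps)
  have 2: "real (2 * i + 2) * (x + real j - 1 gchoose (2 * j)) = (x - real j) * (x + real i gchoose (2 * i + 1))"
    using gbinomial_mult_1[of "x + real i" "2 * i + 1"] by (simp add: Suc algebra_simps)
  have "real (2 * i + 2) * (((x + real j gchoose (2 * j)) + (x + real j - 1 gchoose (2 * j))) / 2) =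
      x * (x + real i gchoose (2 * i + 1))"
    using 1 2 by (simp add: algebra_simps)
  also have "\<dots> = (\<Prod>l<Suc i. x^2 - (real l)^2) / fact (2 * i + 1)"
    unfolding gbinomial_odd_newton prod.lessThan_Suc_shift by (simp add: power2_eq_square add.commute)
  finally have "((x + real j gchoose (2 * j)) + (x + real j - 1 gchoose (2 * j))) / 2 * real (2 * i + 2) =
      (\<Prod>l<Suc i. x^2 - (real l)^2) / fact (2 * i + 1)"
    by (simp only: mult.commute)
  then have "((x + real j gchoose (2 * j)) + (x + real j - 1 gchoose (2 * j))) / 2 =
      (\<Prod>l<Suc i. x^2 - (real l)^2) / fact (2 * i + 1) / real (2 * i + 2)"
    by (rule eq_divide_imp[rotated]) simp
  moreover have "fact (2 * j) = fact (2 * i + 1) * real (2 * i + 2)"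
    by (simp add: Suc algebra_simps)
  ultimately show ?thesis
    by (simp only: divide_divide_eq_left Suc)
qed simp

text \<open>
  The antiderivatives for weight 1 (\<open>ev1\<close>, \<open>od1\<close>) and for weight \<open>1/2\<close> (\<open>ev2\<close>, \<open>od2\<close>). The latter are
  averages of two neighbouring binomial coefficients, which makes \<open>ev2 j 1\<close> half of \<open>od2 j 0\<close>.
\<close>

definition ev1 :: "nat \<Rightarrow> int \<Rightarrow> real" where
  "ev1 j m = ((real_of_int m + 1) / 2 + real j gchoose (2 * j + 1))"

definition od1 :: "nat \<Rightarrow> int \<Rightarrow> real" where
  "od1 j m = ((real_of_int m + 1) / 2 + real j - 1 / 2 gchoose (2 * j))"

definition ev2 :: "nat \<Rightarrow> int \<Rightarrow> real" where
  "ev2 j m = ((real_of_int m / 2 + real j + 1 / 2 gchoose (2 * j + 1)) +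
     (real_of_int m / 2 + real j - 1 / 2 gchoose (2 * j + 1))) / 2"

definition od2 :: "nat \<Rightarrow> int \<Rightarrow> real" where
  "od2 j m = ((real_of_int m / 2 + real j gchoose (2 * j)) +
     (real_of_int m / 2 + real j - 1 gchoose (2 * j))) / 2"

lemma gbinomial_pascal:
  fixes a :: real
  shows "(a + 1 gchoose (k + 1)) - (a gchoose (k + 1)) = (a gchoose k)"
  using gbinomial_Suc_Suc[of a k] by simp

lemma gbinomial_nat_zero: "n < k \<Longrightarrow> (real n gchoose k) = 0"
  by (simp add: binomial_gbinomial[symmetric] binomial_eq_0)

lemma half_sums:
  fixes a b c d :: real
  shows "a - a' = c \<Longrightarrow> b - b' = d \<Longrightarrow> (a + b) / 2 - (a' + b') / 2 = (c + d) / 2"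
  by (simp add: field_simps)

lemma tsum_det_1:
  assumes "k \<ge> 1" "\<And>i j. i < j \<Longrightarrow> j < n \<Longrightarrow> d i < d j"
    and "\<And>i. i < n \<Longrightarrow> 0 \<le> d i \<and> d i < 2 * int c + int k \<and> odd (d i + int k)"
  shows "tsum 1 c k (d ` {..<n}) =
    (if n = (k + 1) div 2 then fdet n (\<lambda>i j. (if even k then ev1 else od1) j (d i)) else 0)"
proof (rule tsum_det)
  fix j :: nat and m :: int
  let ?x = "(real_of_int m + 1) / 2 + real j"
  have args: "(real_of_int (m + 1) + 1) / 2 + real j = ?x - 1 / 2 + 1"
    "(real_of_int (m - 1) + 1) / 2 + real j = ?x - 1 / 2"
    "(real_of_int (m + 1) + 1) / 2 + real (Suc j) - 1 / 2 = ?x + 1"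
    "(real_of_int (m - 1) + 1) / 2 + real (Suc j) - 1 / 2 = ?x"
    by (simp_all add: field_simps)
  show "ev1 j (m + 1) - ev1 j (m - 1) = od1 j m"
    using gbinomial_pascal[of "?x - 1 / 2" "2 * j"] unfolding ev1_def od1_def args by simp
  show "od1 (Suc j) (m + 1) - od1 (Suc j) (m - 1) = ev1 j m"
    using gbinomial_pascal[of ?x "2 * j + 1"] unfolding ev1_def od1_def args by simp
  show "ev1 j 1 = 1 * od1 j 0"
    using gbinomial_pascal[of "real j" "2 * j"] gbinomial_nat_zero[of j "2 * j + 1"]
    by (simp add: ev1_def od1_def add.commute)
  show "od1 0 m = 1"
    by (simp add: od1_def)
qed (use assms in auto)

lemma tsum_det_2:
  assumes "k \<ge> 1" "\<And>i j. i < j \<Longrightarrow> j < n \<Longrightarrow> d i < d j"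
    and "\<And>i. i < n \<Longrightarrow> 0 \<le> d i \<and> d i < 2 * int c + int k \<and> odd (d i + int k)"
  shows "tsum (1 / 2) c k (d ` {..<n}) =
    (if n = (k + 1) div 2 then fdet n (\<lambda>i j. (if even k then ev2 else od2) j (d i)) else 0)"
proof (rule tsum_det)
  fix j :: nat and m :: int
  let ?x = "real_of_int m / 2 + real j"
  have args: "real_of_int (m + 1) / 2 + real j + 1 / 2 = ?x + 1" "real_of_int (m + 1) / 2 + real j - 1 / 2 = ?x"
    "real_of_int (m - 1) / 2 + real j + 1 / 2 = ?x" "real_of_int (m - 1) / 2 + real j - 1 / 2 = ?x - 1"
    "real_of_int (m + 1) / 2 + real (Suc j) = ?x + 1 / 2 + 1" "real_of_int (m + 1) / 2 + real (Suc j) - 1 = ?x - 1 / 2 + 1"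
    "real_of_int (m - 1) / 2 + real (Suc j) = ?x + 1 / 2" "real_of_int (m - 1) / 2 + real (Suc j) - 1 = ?x - 1 / 2"
    by (simp_all add: field_simps)
  have args2: "?x + 1 / 2 + 1 - 1 = ?x - 1 / 2 + 1" "?x + 1 / 2 - 1 = ?x - 1 / 2"
    by simp_all
  have suc: "2 * Suc j = 2 * j + 1 + 1"
    by simp
  show "ev2 j (m + 1) - ev2 j (m - 1) = od2 j m"
    using gbinomial_pascal[of ?x "2 * j"] gbinomial_pascal[of "?x - 1" "2 * j"]
    unfolding ev2_def od2_def args by (simp add: field_simps)
  show "od2 (Suc j) (m + 1) - od2 (Suc j) (m - 1) = ev2 j m"
    using gbinomial_pascal[of "?x + 1 / 2" "2 * j + 1"] gbinomial_pascal[of "?x - 1 / 2" "2 * j + 1"]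
    unfolding ev2_def od2_def args args2 suc by (rule half_sums)
  show "ev2 j 1 = 1 / 2 * od2 j 0"
  proof (cases j)
    case (Suc i)
    have "(real (j + 1) gchoose (2 * j + 1)) = 0" "(real j gchoose (2 * j + 1)) = 0"
      "(real j gchoose (2 * j)) = 0" "(real i gchoose (2 * j)) = 0"
      using Suc by (intro gbinomial_nat_zero; simp)+
    then show ?thesis
      using Suc by (simp add: ev2_def od2_def add.commute)
  qed (simp add: ev2_def od2_def)
  show "od2 0 m = 1"
    by (simp add: od2_def)
qed (use assms in auto)

text \<open>
  The Vandermonde product in the squares of the elements of \<open>D\<close>.
\<close>

definition vdm :: "nat set \<Rightarrow> real" where
  "vdm D = (\<Prod>q\<in>D. \<Prod>p\<in>{p \<in> D. p < q}. (real q)^2 - (real p)^2)"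

text \<open>
  The product of Weyl's dimension formula for the symplectic groups, with the elements of \<open>D\<close> as
  shifted parts.
\<close>

definition symp :: "nat set \<Rightarrow> real" where
  "symp D = (\<Prod>p\<in>D. real p) * vdm D / (\<Prod>j<card D. fact (2 * j + 1))"

text \<open>
  The analogous product for the even orthogonal groups, up to a power of 2.
\<close>

definition orth :: "nat set \<Rightarrow> real" where
  "orth D = vdm D / (\<Prod>j<card D. fact (2 * j))"

lemma increasing_enumeration:
  fixes D :: "nat set"
  assumes "finite D"
  obtains d :: "nat \<Rightarrow> nat" where "\<And>i j. i < j \<Longrightarrow> j < card D \<Longrightarrow> d i < d j" "D = d ` {..<card D}"
    "inj_on d {..<card D}"
proof -
  let ?xs = "sorted_list_of_set D"
  have len: "length ?xs = card D" by simp
  have 1: "?xs ! i < ?xs ! j" if "i < j" "j < card D" for i j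
    using that sorted_nth_mono[of ?xs i j] nth_eq_iff_index_eq[of ?xs i j]
    by (simp add: order.strict_iff_order)
  have "D = set ?xs" using assms by simp
  then have 2: "D = (!) ?xs ` {..<card D}"
    unfolding set_conv_nth len by auto
  have "inj_on ((!) ?xs) {..<card D}"
    using 1 by (auto simp: inj_on_def) (metis less_irrefl linorder_neqE_nat)
  with 1 2 that show thesis by blast
qed

lemma vdm_enumeration:
  fixes d :: "nat \<Rightarrow> nat"
  assumes "\<And>i j. i < j \<Longrightarrow> j < n \<Longrightarrow> d i < d j" "inj_on d {..<n}"
  shows "vdm (d ` {..<n}) = (\<Prod>j<n. \<Prod>i<j. (real (d j))^2 - (real (d i))^2)"
proof -
  have "{p \<in> d ` {..<n}. p < d j} = d ` {..<j}" if "j < n" for j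
  proof -
    have "d i < d j \<longleftrightarrow> i < j" if "i < n" for i
      using assms(1)[of i j] assms(1)[of j i] \<open>j < n\<close> that by (cases i j rule: linorder_cases) auto
    then show ?thesis using that by (auto simp: image_iff)
  qed
  moreover have "inj_on d {..<j}" if "j < n" for j
    using assms(2) that by (auto intro: inj_on_subset)
  ultimately show ?thesis
    unfolding vdm_def by (simp add: prod.reindex assms(2))
qed

theorem tsum_symp:
  assumes "finite D" "\<And>p. p \<in> D \<Longrightarrow> 1 \<le> p \<and> p \<le> c + n" "n = 0 \<Longrightarrow> D = {}"
  shows "tsum 1 c (2 * n) ((\<lambda>p. 2 * int p - 1) ` D) = (if card D = n then symp D else 0)"
proof (cases "n = 0")
  case True
  then show ?thesis using assms(3) by (simp add: symp_def vdm_def)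
next
  case False
  obtain d where d: "\<And>i j. i < j \<Longrightarrow> j < card D \<Longrightarrow> d i < d j" "D = d ` {..<card D}" "inj_on d {..<card D}"
    using increasing_enumeration[OF assms(1)] by blast
  let ?m = "card D"
  have dD: "d i \<in> D" if "i < ?m" for i using d(2) that by blast
  have "(\<lambda>p. 2 * int p - 1) ` D = (\<lambda>i. 2 * int (d i) - 1) ` {..<?m}"
    by (subst d(2)) (simp add: image_image)
  then have "tsum 1 c (2 * n) ((\<lambda>p. 2 * int p - 1) ` D) = tsum 1 c (2 * n) ((\<lambda>i. 2 * int (d i) - 1) ` {..<?m})"
    by simp
  also have "\<dots> = (if ?m = (2 * n + 1) div 2 then fdet ?m (\<lambda>i j. (if even (2 * n) then ev1 else od1) j (2 * int (d i) - 1)) else 0)"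
    by (rule tsum_det_1) (use False d(1) dD assms(2) in fastforce)+
  also have "\<dots> = (if ?m = n then fdet ?m (\<lambda>i j. ev1 j (2 * int (d i) - 1)) else 0)"
    by simp
  also have "fdet ?m (\<lambda>i j. ev1 j (2 * int (d i) - 1)) =
      fdet ?m (\<lambda>i j. real (d i) * (1 / fact (2 * j + 1)) * (\<Prod>l<j. (real (d i))^2 - (real l + 1)^2))"
  proof (rule fdet_cong)
    fix i j
    have "ev1 j (2 * int (d i) - 1) = (real (d i) + real j gchoose (2 * j + 1))"
      by (simp add: ev1_def)
    also have "\<dots> = real (d i) * (\<Prod>l<j. (real (d i))^2 - (real l + 1)^2) / fact (2 * j + 1)"
      by (rule gbinomial_odd_newton)
    finally show "ev1 j (2 * int (d i) - 1) =
        real (d i) * (1 / fact (2 * j + 1)) * (\<Prod>l<j. (real (d i))^2 - (real l + 1)^2)"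
      by (simp only: divide_inverse mult_ac mult_1_left)
  qed
  also have "\<dots> = (\<Prod>i<?m. real (d i)) * (\<Prod>j<?m. 1 / fact (2 * j + 1)) * vdm (d ` {..<?m})"
    by (simp only: fdet_scale fdet_newton vdm_enumeration[OF d(1,3)])
  also have "\<dots> = symp (d ` {..<?m})"
    using d(3) by (simp add: symp_def prod.reindex card_image prod_dividef)
  finally show ?thesis
    by (simp only: d(2)[symmetric])
qed

theorem tsum_orth:
  assumes "finite D" "\<And>p. p \<in> D \<Longrightarrow> p < c + n" "n \<ge> 1"
  shows "tsum (1 / 2) c (2 * n - 1) ((\<lambda>p. 2 * int p) ` D) = (if card D = n then orth D else 0)"
proof -
  obtain d where d: "\<And>i j. i < j \<Longrightarrow> j < card D \<Longrightarrow> d i < d j" "D = d ` {..<card D}" "inj_on d {..<card D}"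
    using increasing_enumeration[OF assms(1)] by blast
  let ?m = "card D"
  have dD: "d i \<in> D" if "i < ?m" for i using d(2) that by blast
  have "(\<lambda>p. 2 * int p) ` D = (\<lambda>i. 2 * int (d i)) ` {..<?m}"
    by (subst d(2)) (simp add: image_image)
  then have "tsum (1 / 2) c (2 * n - 1) ((\<lambda>p. 2 * int p) ` D) = tsum (1 / 2) c (2 * n - 1) ((\<lambda>i. 2 * int (d i)) ` {..<?m})"
    by simp
  also have "\<dots> = (if ?m = (2 * n - 1 + 1) div 2 then fdet ?m (\<lambda>i j. (if even (2 * n - 1) then ev2 else od2) j (2 * int (d i))) else 0)"
  proof (rule tsum_det_2)
    fix i assume "i < ?m"
    then have "d i < c + n" using dD assms(2) by blast
    then show "0 \<le> 2 * int (d i) \<and> 2 * int (d i) < 2 * int c + int (2 * n - 1) \<and> odd (2 * int (d i) + int (2 * n - 1))"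
      using assms(3) by (auto simp: of_nat_diff)
  qed (use assms(3) d(1) in auto)
  also have "\<dots> = (if ?m = n then fdet ?m (\<lambda>i j. od2 j (2 * int (d i))) else 0)"
    using assms(3) by simp
  also have "fdet ?m (\<lambda>i j. od2 j (2 * int (d i))) =
      fdet ?m (\<lambda>i j. 1 * (1 / fact (2 * j)) * (\<Prod>l<j. (real (d i))^2 - (real l)^2))"
  proof (rule fdet_cong)
    fix i j
    have "od2 j (2 * int (d i)) = (((real (d i) + real j gchoose (2 * j)) + (real (d i) + real j - 1 gchoose (2 * j))) / 2)"
      by (simp add: od2_def)
    also have "\<dots> = (\<Prod>l<j. (real (d i))^2 - (real l)^2) / fact (2 * j)"
      by (rule gbinomial_even_newton)
    finally show "od2 j (2 * int (d i)) = 1 * (1 / fact (2 * j)) * (\<Prod>l<j. (real (d i))^2 - (real l)^2)"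
      by (simp only: divide_inverse mult_ac mult_1_left)
  qed
  also have "\<dots> = (\<Prod>i<?m. 1) * (\<Prod>j<?m. 1 / fact (2 * j)) * vdm (d ` {..<?m})"
    by (simp only: fdet_scale fdet_newton vdm_enumeration[OF d(1,3)])
  also have "\<dots> = orth (d ` {..<?m})"
    using d(3) by (simp add: orth_def card_image prod_dividef)
  finally show ?thesis
    by (simp only: d(2)[symmetric])
qed

section \<open>Removing triangles from a trapezoid\<close>

text \<open>
  The up-pointing triangle that stands on level \<open>- k\<close> and occupies the positions from \<open>l\<close> to \<open>r\<close> of
  the lowest strip; \<open>l\<close> and \<open>r\<close> have the parity of up-pointing triangles there. Parts of it may lie outside the
  trapezoid.
\<close>

definition tri_region :: "nat \<Rightarrow> int \<Rightarrow> int \<Rightarrow> tri set" where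
  "tri_region k l r = {t. - int k \<le> strip t \<and> l \<le> mid_x t - (strip t + int k) \<and> mid_x t + (strip t + int k) \<le> r}"

lemma remove_aux:
  fixes A B C D E X :: "tri set"
  assumes "\<And>t. t \<in> A \<inter> C \<Longrightarrow> t \<in> B \<or> t \<in> D" "\<And>t. t \<in> B \<Longrightarrow> t \<in> C" "\<And>t. t \<in> D \<Longrightarrow> t \<in> C" "E = D \<union> X"
  shows "A - E - B = A - C - X"
  using assms by blast

text \<open>
  Removing the triangles of the family \<open>\<F>\<close> amounts to removing only the up-pointing unit triangles
  along their bottom sides: those dents force the vertical lozenges inside each triangle, from the
  bottom to the top. Of the conditions on \<open>l\<close> and \<open>r\<close>, the one on \<open>\<omega>\<close> ensures that the forced lozenges have
  weight 1, and the one before it that no triangle is cut by the top side of the trapezoid.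
\<close>

lemma tiling_sum_remove_triangles:
  assumes par: "\<And>l r. (l, r) \<in> \<F> \<Longrightarrow> odd (l + int k) \<and> odd (r + int k) \<and>
      (r < int k \<or> r - l < 2 * int k) \<and> (\<omega> = 1 \<or> 1 \<le> l)"
    and D: "\<And>m. m \<in> D \<longleftrightarrow> 0 \<le> m \<and> odd (m + int k) \<and> (\<exists>(l, r)\<in>\<F>. l \<le> m \<and> m \<le> r)"
    and X: "\<And>m. m \<in> X \<Longrightarrow> odd (m + int k)"
  shows "tiling_sum (std_weight \<omega>) (trap c k - (\<Union>(l, r)\<in>\<F>. tri_region k l r) - row (- int k) X) =
    tsum \<omega> c k (D \<union> X)"
proof -
  let ?T = "\<Union>(l, r)\<in>\<F>. tri_region k l r"
  let ?R = "trap c k - row (- int k) (D \<union> X)"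
  let ?V = "{(s, m). odd (m + s) \<and> - int k < s \<and> tri_at s m \<in> trap c k \<inter> ?T}"
  let ?F = "(\<lambda>(s, m). vert s m) ` ?V"
  have T_iff: "tri_at s m \<in> trap c k \<inter> ?T \<longleftrightarrow> - int k \<le> s \<and> s < 0 \<and> 0 \<le> m \<and> m < 2 * int c - s \<and>
      (\<exists>(l, r)\<in>\<F>. l \<le> m - (s + int k) \<and> m + (s + int k) \<le> r)" for s m
    by (fastforce simp: tri_region_def trap_def)
  have below: "tri_at (s - 1) m' \<in> trap c k \<inter> ?T"
    if V: "(s, m) \<in> ?V" and m': "\<bar>m' - m\<bar> \<le> 1" "0 \<le> m'" for s m m'
  proof -
    from V have V': "odd (m + s)" "- int k < s" "tri_at s m \<in> trap c k \<inter> ?T" by auto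
    then obtain l r where lr: "(l, r) \<in> \<F>" "l \<le> m - (s + int k)" "m + (s + int k) \<le> r"
      and tr: "s < 0" "0 \<le> m" "m < 2 * int c - s"
      unfolding T_iff by auto
    have "l \<le> m' - (s - 1 + int k)" "m' + (s - 1 + int k) \<le> r"
      using lr m' by auto
    then show ?thesis
      unfolding T_iff using lr(1) tr m' V'(2) by auto
  qed
  have up: "tri_at (s + 1) m \<in> trap c k \<inter> ?T" if "even (m + s)" "tri_at s m \<in> trap c k \<inter> ?T" for s m
  proof -
    from that(2) obtain l r where lr: "(l, r) \<in> \<F>" "l \<le> m - (s + int k)" "m + (s + int k) \<le> r"
      and tr: "- int k \<le> s" "s < 0" "0 \<le> m" "m < 2 * int c - s"
      unfolding T_iff by auto
    note p = par[OF lr(1)]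
    have "l \<noteq> m - (s + int k)" "m + (s + int k) \<noteq> r" "m \<noteq> 2 * int c - s - 1"
      using p that(1) by auto
    then have l: "l \<le> m - (s + 1 + int k)" "m + (s + 1 + int k) \<le> r" "m < 2 * int c - (s + 1)"
      using lr tr by auto
    then have "s + 1 < 0"
      using p tr by auto
    then show ?thesis
      unfolding T_iff using l tr lr(1) by auto
  qed
  have bottom: "tri_at (- int k) m \<in> trap c k \<inter> ?T \<longrightarrow> m \<in> D" if "odd (m + int k)" for m
    unfolding T_iff D using that by auto
  have "tiling_sum (std_weight \<omega>) ?R = (\<Prod>l\<in>?F. std_weight \<omega> l) * tiling_sum (std_weight \<omega>) (?R - \<Union>?F)"
  proof (rule tiling_sum_forced)
    show "disjoint ?F"
      unfolding disjoint_def
    proof (intro ballI impI)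
      fix a b assume "a \<in> ?F" "b \<in> ?F" "a \<noteq> b"
      then obtain s m s' m' where ab: "a = vert s m" "b = vert s' m'" "odd (m + s)" "odd (m' + s')" "(s, m) \<noteq> (s', m')"
        by auto
      then show "a \<inter> b = {}"
        by (auto simp: in_vert_iff)
    qed
    show "?F \<subseteq> lozenges"
      by (auto intro: vert_lozenge)
    show "{} \<notin> ?F"
      by (auto simp: vert_def)
    show "\<Union>?F \<subseteq> ?R"
    proof
      fix t assume "t \<in> \<Union>?F"
      then obtain s m where V: "(s, m) \<in> ?V" and t: "t \<in> vert s m" by auto
      from V have V': "odd (m + s)" "- int k < s" "tri_at s m \<in> trap c k \<inter> ?T" "0 \<le> m"
        by (auto simp: trap_def)
      have "t = tri_at s m \<or> t = tri_at (s - 1) m"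
        using t by (auto simp: vert_def)
      then have "t \<in> trap c k"
        using V'(3) below[OF V, of m] V'(4) by auto
      moreover have "t \<notin> row (- int k) (D \<union> X)"
      proof
        assume "t \<in> row (- int k) (D \<union> X)"
        then have r: "strip t = - int k" "mid_x t \<in> D \<union> X" by (auto simp: in_row_iff)
        then have s: "s = 1 - int k" "mid_x t = m" using t V'(2) by (auto simp: in_vert_iff)
        then have "odd (m + int k)" using r(2) D X by auto
        then show False using V'(1) s(1) by presburger
      qed
      ultimately show "t \<in> ?R" by blast
    qed
  next
    fix \<T> assume "\<T> \<in> tilings ?R"
    note t = tilingsD[OF this]
    have "vert s m \<in> \<T>" if "(s, m) \<in> ?V" for s m
      using that
    proof (induction "nat (s + int k)" arbitrary: s m rule: less_induct)
      case less
      note V = less.prems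
      from V have V': "odd (m + s)" "- int k < s" "tri_at s m \<in> trap c k \<inter> ?T" "0 \<le> m"
        by (auto simp: trap_def)
      have nb: False if "l \<in> \<T>" "tri_at (s - 1) m' \<in> l" "\<bar>m' - m\<bar> = 1" "\<forall>m''. l \<noteq> vert (s - 1) m''" for m' l
      proof -
        have inR: "tri_at (s - 1) m' \<in> ?R" using t(1) that by blast
        then have "0 \<le> m'" by (simp add: trap_def)
        then have b: "tri_at (s - 1) m' \<in> trap c k \<inter> ?T"
          using below[OF V, of m'] that(3) by simp
        have odd: "odd (m' + (s - 1))" using V'(1) that(3) by presburger
        show False
        proof (cases "s - 1 = - int k")
          case True
          then have "m' \<in> D" using bottom[of m'] b odd by auto
          then show False using inR True by (simp add: in_row_iff)
        next
          case False
          then have "(s - 1, m') \<in> ?V" using b odd V'(2) by auto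
          then have "vert (s - 1) m' \<in> \<T>"
            using less.hyps[of "s - 1" m'] V'(2) by simp
          moreover have "tri_at (s - 1) m' \<in> vert (s - 1) m'" by (simp add: vert_def)
          ultimately show False using t(2)[of l "vert (s - 1) m'"] that by blast
        qed
      qed
      have "tri_at (s - 1) m \<in> ?R"
      proof -
        have "tri_at (s - 1) m \<in> trap c k" using below[OF V, of m] V'(4) by simp
        moreover have "m \<notin> D \<union> X" if "s - 1 = - int k"
        proof
          assume "m \<in> D \<union> X"
          then have "odd (m + int k)" using D X by auto
          then show False using V'(1) that by presburger
        qed
        ultimately show ?thesis by (auto simp: in_row_iff)
      qed
      then obtain l where l: "l \<in> \<T>" "tri_at (s - 1) m \<in> l" using t(1) by blast
      have "l \<in> lozenges" using l(1) t(4) by blast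
      then show ?case
      proof (cases rule: lozenge_cases)
        case (horizontal s' m')
        then have sm: "s' = s - 1" "m = m' \<or> m = m' + 1" using l(2) by auto
        have nv: "\<forall>m''. l \<noteq> vert (s - 1) m''"
          using horizontal by (auto simp: vert_def doubleton_eq_iff)
        have "tri_at (s - 1) m' \<in> l" "tri_at (s - 1) (m' + 1) \<in> l"
          using horizontal sm by auto
        then show ?thesis
          using nb[OF l(1) _ _ nv, of m'] nb[OF l(1) _ _ nv, of "m' + 1"] sm by auto
      next
        case (vertical s' m')
        then have "m' = m" "s' = s - 1 \<or> s' - 1 = s - 1" using l(2) by (auto simp: in_vert_iff)
        then have "s' = s" using vertical(1) V'(1) by auto
        then show ?thesis using vertical \<open>m' = m\<close> l(1) by simp
      qed
    qed
    then show "?F \<subseteq> \<T>" by auto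
  qed auto
  also have "(\<Prod>l\<in>?F. std_weight \<omega> l) = 1"
  proof (rule prod.neutral, rule ballI)
    fix l assume "l \<in> ?F"
    then obtain s m where sm: "l = vert s m" "- int k < s" "tri_at s m \<in> trap c k \<inter> ?T" by auto
    then obtain l' r where "(l', r) \<in> \<F>" "l' \<le> m - (s + int k)"
      unfolding T_iff by auto
    then show "std_weight \<omega> l = 1"
      using par[of l' r] sm(1,2) by auto
  qed
  also have "?R - \<Union>?F = trap c k - ?T - row (- int k) X"
  proof -
    have "t \<in> \<Union>?F \<or> t \<in> row (- int k) D" if "t \<in> trap c k \<inter> ?T" for t
    proof -
      define s m where "s = strip t" and "m = mid_x t"
      have t: "t = tri_at s m" by (simp add: s_def m_def)
      have sk: "- int k \<le> s" using that unfolding t T_iff by simp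
      show ?thesis
      proof (cases "odd (m + s)")
        case True
        show ?thesis
        proof (cases "s = - int k")
          case eq: True
          then show ?thesis using bottom[of m] that True unfolding t by (auto simp: in_row_iff)
        next
          case False
          then have "(s, m) \<in> ?V" using that True sk unfolding t by auto
          moreover have "t \<in> vert s m" by (simp add: t vert_def)
          ultimately show ?thesis by blast
        qed
      next
        case False
        then have "tri_at (s + 1) m \<in> trap c k \<inter> ?T" using up[of m s] that unfolding t by auto
        then have "(s + 1, m) \<in> ?V" using False sk by auto
        moreover have "t \<in> vert (s + 1) m" by (simp add: t vert_def)
        ultimately show ?thesis by blast
      qed
    qed
    moreover have "t \<in> ?T" if "t \<in> \<Union>?F" for t
    proof -
      from that obtain s m where V: "(s, m) \<in> ?V" and t: "t \<in> vert s m" by auto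
      then have "tri_at s m \<in> trap c k \<inter> ?T" by blast
      moreover from this have "0 \<le> m" by (simp add: trap_def)
      ultimately show ?thesis using t below[OF V, of m] by (auto simp: vert_def)
    qed
    moreover have "t \<in> ?T" if "t \<in> row (- int k) D" for t
      using that by (fastforce simp: in_row_iff D tri_region_def)
    moreover have "row (- int k) (D \<union> X) = row (- int k) D \<union> row (- int k) X"
      by simp
    ultimately show ?thesis
      by (rule remove_aux)
  qed
  finally show ?thesis
    by (simp add: tsum_def del: row_simps)
qed

section \<open>Winding numbers\<close>

lemma winding_Nil [simp]: "winding p [] t = 0"
  by (simp add: winding_def)

lemma winding_Cons [simp]: "winding p (s # ss) t = crossing t (p, move s p) + winding (move s p) ss t"
  by (simp add: winding_def)

lemma winding_append [simp]: "winding p (as @ bs) t = winding p as t + winding (endpoint p as) bs t"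
  by (induction as arbitrary: p) (auto simp: endpoint_def)

lemma endpoint_append [simp]: "endpoint p (as @ bs) = endpoint (endpoint p as) bs"
  and endpoint_Nil [simp]: "endpoint p [] = p"
  and endpoint_Cons [simp]: "endpoint p (s # ss) = endpoint (move s p) ss"
  by (simp_all add: endpoint_def)

lemma endpoint_replicate [simp]:
  "endpoint (i, j) (replicate n East) = (i + int n, j)"
  "endpoint (i, j) (replicate n West) = (i - int n, j)"
  "endpoint (i, j) (replicate n NE) = (i, j + int n)"
  "endpoint (i, j) (replicate n NW) = (i - int n, j + int n)"
  "endpoint (i, j) (replicate n SE) = (i + int n, j - int n)"
  "endpoint (i, j) (replicate n SW) = (i, j - int n)"
  by (induction n arbitrary: i j) auto

lemma repeat_steps_simps [simp]:
  "repeat_steps 0 ss = []" "repeat_steps (Suc n) ss = ss @ repeat_steps n ss"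
  by (simp_all add: repeat_steps_def)

lemma endpoint_zigzag [simp]:
  "endpoint (i, j) (repeat_steps n [SW, SE]) = (i + int n, j - 2 * int n)"
  "endpoint (i, j) (repeat_steps n [SE, SW]) = (i + int n, j - 2 * int n)"
  by (induction n arbitrary: i j) auto

lemma winding_East_West [simp]:
  "winding (i, j) (replicate n East) t = 0" "winding (i, j) (replicate n West) t = 0"
  by (induction n arbitrary: i j) (auto simp: crossing_def)

lemma winding_NE [simp]:
  "winding (i, j) (replicate n NE) t =
    (if j \<le> strip t \<and> strip t < j + int n \<and> 2 * i < mid_x t - strip t then - 1 else 0)"
  by (induction n arbitrary: i j) (auto simp: crossing_def)

lemma winding_NW [simp]:
  "winding (i, j) (replicate n NW) t =
    (if j \<le> strip t \<and> strip t < j + int n \<and> 2 * (i + j) \<le> mid_x t + strip t then - 1 else 0)"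
  by (induction n arbitrary: i j) (auto simp: crossing_def)

lemma winding_SE [simp]:
  "winding (i, j) (replicate n SE) t =
    (if j - int n \<le> strip t \<and> strip t < j \<and> 2 * (i + j) \<le> mid_x t + strip t then 1 else 0)"
  by (induction n arbitrary: i j) (auto simp: crossing_def)

lemma winding_SW [simp]:
  "winding (i, j) (replicate n SW) t =
    (if j - int n \<le> strip t \<and> strip t < j \<and> 2 * i < mid_x t - strip t then 1 else 0)"
  by (induction n arbitrary: i j) (auto simp: crossing_def)

lemma winding_zigzag_west [simp]:
  "winding (i, j) (repeat_steps n [SW, SE]) t =
    (if j - 2 * int n \<le> strip t \<and> strip t < j \<and> 2 * i + j \<le> mid_x t then 1 else 0)"
  by (induction n arbitrary: i j) (auto simp: crossing_def)

lemma winding_zigzag_east [simp]: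
  "winding (i, j) (repeat_steps n [SE, SW]) t =
    (if j - 2 * int n \<le> strip t \<and> strip t < j \<and> 2 * i + j < mid_x t then 1 else 0)"
  by (induction n arbitrary: i j) (auto simp: crossing_def)

lemma up_triangle_eq: "up_triangle (i, - int k) n = tri_region k (2 * i - int k + 1) (2 * i - int k + 2 * int n - 1)"
  unfolding up_triangle_def polygon_def tri_region_def by auto

text \<open>
  The polygon of \<open>P\<close> as the part of a trapezoid outside two triangles: one on its left end, which
  begins outside, and one that cuts off the lower right corner.
\<close>

lemma polygon_P:
  assumes "a \<ge> 1"
  shows "polygon (0, 0) (P_path y (y + 2 * a - 2) c) =
    trap c (2 * (y + a - 1)) - tri_region (2 * (y + a - 1)) (- 2 * int (y + a) - 1) (2 * int a - 3)
      - tri_region (2 * (y + a - 1)) (2 * int (c + a) - 1) (2 * int (c + y + a) - 3)"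
proof -
  obtain a' where a: "a = Suc a'" using assms by (cases a) auto
  show ?thesis
    unfolding polygon_def trap_def tri_region_def P_path_def a by (auto split: if_splits)
qed

lemma polygon_Q:
  "polygon (0, 0) (repeat_steps n [SW, SE] @ replicate (n + c) East @ replicate (2 * n) NW @ replicate c West) =
    trap c (2 * n)"
  unfolding polygon_def trap_def by (auto split: if_splits)

lemma polygon_K':
  assumes "n \<ge> 1"
  shows "polygon (0, 0) ((repeat_steps (n - 1) [SW, SE] @ [SW]) @ replicate (n + c) East @ replicate (2 * n - 1) NW @ replicate c West) =
    trap c (2 * n - 1)"
proof -
  obtain n' where n: "n = Suc n'" using assms by (cases n) auto
  have SW: "[SW] = replicate 1 SW" by simp
  show ?thesis
    unfolding polygon_def trap_def n SW
    by (auto split: if_splits simp del: winding_Cons replicate_Suc endpoint_Cons)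
qed

lemma vert_lozenge_iff: "vert s m \<in> lozenges \<longleftrightarrow> odd (m + s)"
proof
  assume "vert s m \<in> lozenges"
  then show "odd (m + s)"
  proof (cases rule: lozenge_cases)
    case (horizontal s' m')
    then show ?thesis by (auto simp: vert_def doubleton_eq_iff)
  qed auto
qed (rule vert_lozenge)

lemma Up_Down_vert: "{Up p, Down p} = vert (snd p) (2 * fst p + snd p + 1)"
  by (cases p) (auto simp: vert_def tri_eq_iff)

lemma path_edges_append: "path_edges p (as @ bs) = path_edges p as @ path_edges (endpoint p as) bs"
  by (induction as arbitrary: p) auto

lemma zigzag_west_edges:
  "(move NE p, p) \<in> set (path_edges (i, j) (repeat_steps n [SW, SE])) \<longleftrightarrow> (\<exists>h<n. p = (i + int h, j - 2 * int h - 1))"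
  "(p, move SE p) \<in> set (path_edges (i, j) (repeat_steps n [SW, SE])) \<longleftrightarrow> (\<exists>h<n. p = (i + int h, j - 2 * int h - 1))"
proof (induction n arbitrary: i j)
  case (Suc n)
  obtain a b where p: "p = (a, b)" by (cases p)
  {
    case 1
    then show ?case using Suc(1)[of "i + 1" "j - 2"] by (auto simp: Ex_less_Suc2 p algebra_simps)
  next
    case 2
    then show ?case using Suc(2)[of "i + 1" "j - 2"] by (auto simp: Ex_less_Suc2 p algebra_simps)
  }
qed auto

lemma zigzag_east_edges:
  "(move NE p, p) \<in> set (path_edges (i, j) (repeat_steps n [SE, SW])) \<longleftrightarrow> (\<exists>h<n. p = (i + int h + 1, j - 2 * int h - 2))"
  "(p, move SE p) \<in> set (path_edges (i, j) (repeat_steps n [SE, SW])) \<longleftrightarrow> (\<exists>h<n. p = (i + int h, j - 2 * int h))"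
proof (induction n arbitrary: i j)
  case (Suc n)
  obtain a b where p: "p = (a, b)" by (cases p)
  {
    case 1
    then show ?case using Suc(1)[of "i + 1" "j - 2"] by (auto simp: Ex_less_Suc2 p algebra_simps)
  next
    case 2
    then show ?case using Suc(2)[of "i + 1" "j - 2"] by (auto simp: Ex_less_Suc2 p algebra_simps)
  }
qed auto

lemma zigzag_weight_eq_std_weight:
  assumes Z: "\<And>p. (move NE p, p) \<in> set Z \<and> (p, move SE p) \<in> set Z \<longleftrightarrow> (\<exists>h<n. p = (int h, - 2 * int h - 1))"
    and l: "l \<in> lozenges" "l \<subseteq> trap c k" and k: "k div 2 = n"
  shows "zigzag_weight Z l = std_weight (1 / 2) l"
proof -
  have "(\<exists>p. l = {Up p, Down p} \<and> (move NE p, p) \<in> set Z \<and> (p, move SE p) \<in> set Z) \<longleftrightarrow> (\<exists>s. l = vert s 0)"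
  proof
    assume "\<exists>p. l = {Up p, Down p} \<and> (move NE p, p) \<in> set Z \<and> (p, move SE p) \<in> set Z"
    then show "\<exists>s. l = vert s 0"
      unfolding Z Up_Down_vert by auto
  next
    assume "\<exists>s. l = vert s 0"
    then obtain s where s: "l = vert s 0" by blast
    have "odd s" using l(1) unfolding s vert_lozenge_iff by simp
    have "tri_at s 0 \<in> trap c k" "tri_at (s - 1) 0 \<in> trap c k"
      using l(2) unfolding s vert_def by auto
    then have s': "s < 0" "- int k \<le> s - 1" by (auto simp: trap_def)
    define h where "h = nat ((- s - 1) div 2)"
    have sh: "s = - 2 * int h - 1" using \<open>odd s\<close> s' unfolding h_def by auto
    then have "h < n" using s' k by auto
    then have "(move NE (int h, - 2 * int h - 1), (int h, - 2 * int h - 1)) \<in> set Z \<and>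
        ((int h, - 2 * int h - 1), move SE (int h, - 2 * int h - 1)) \<in> set Z"
      unfolding Z by blast
    moreover have "l = {Up (int h, - 2 * int h - 1), Down (int h, - 2 * int h - 1)}"
      unfolding Up_Down_vert s sh by simp
    ultimately show "\<exists>p. l = {Up p, Down p} \<and> (move NE p, p) \<in> set Z \<and> (p, move SE p) \<in> set Z"
      by blast
  qed
  then show ?thesis
    by (simp add: zigzag_weight_def std_weight_def)
qed

section \<open>Segments\<close>

text \<open>
  The base line is divided into segments of lengths \<open>t\<^sub>1, t\<^sub>2, \<dots>\<close>, whose unit pieces are numbered from 0. This
  is the set of the pieces in segments of even index, or of odd index if \<open>b\<close> is false.
\<close>

definition segments :: "bool \<Rightarrow> nat list \<Rightarrow> nat set" where
  "segments b t = (\<Union>i\<in>{i \<in> {1..length t}. even i = b}. {partial_sum (i - 1) t..<partial_sum i t})"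

lemma partial_sum_0 [simp]: "partial_sum 0 t = 0"
  by (simp add: partial_sum_def)

lemma partial_sum_Suc [simp]: "partial_sum (Suc i) t = partial_sum i t + term_at t (Suc i)"
  by (simp add: partial_sum_def)

lemma partial_sum_mono: "i \<le> j \<Longrightarrow> partial_sum i t \<le> partial_sum j t"
  unfolding partial_sum_def by (rule sum_mono2) auto

lemma partial_sum_pred: "i \<ge> 1 \<Longrightarrow> partial_sum i t = partial_sum (i - 1) t + term_at t i"
  by (cases i) auto

lemma segments_disjoint:
  assumes "i < j"
  shows "{partial_sum (i - 1) t..<partial_sum i t} \<inter> {partial_sum (j - 1) t..<partial_sum j t} = {}"
proof -
  have "i \<le> j - 1" using assms by simp
  from partial_sum_mono[OF this, of t] show ?thesis by auto
qed

lemma segments_disjoint':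
  "i \<noteq> j \<Longrightarrow> {partial_sum (i - 1) t..<partial_sum i t} \<inter> {partial_sum (j - 1) t..<partial_sum j t} = {}"
  using segments_disjoint[of i j t] segments_disjoint[of j i t] by (cases i j rule: linorder_cases) auto

lemma segment_index_unique:
  assumes "q \<in> {partial_sum (i - 1) t..<partial_sum i t}" "q \<in> {partial_sum (j - 1) t..<partial_sum j t}"
  shows "i = j"
  using segments_disjoint[of i j t] segments_disjoint[of j i t] assms by (cases i j rule: linorder_cases) blast+

lemma finite_segments [simp]: "finite (segments b t)"
  by (simp add: segments_def)

lemma prod_segments:
  "(\<Prod>q\<in>segments b t. f q) = (\<Prod>i\<in>{i \<in> {1..length t}. even i = b}. \<Prod>j<term_at t i. f (partial_sum (i - 1) t + j))"
proof -
  have "(\<Prod>q\<in>segments b t. f q) =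
      (\<Prod>i\<in>{i \<in> {1..length t}. even i = b}. \<Prod>q\<in>{partial_sum (i - 1) t..<partial_sum i t}. f q)"
    unfolding segments_def
    by (rule prod.UNION_disjoint) (simp, simp, use segments_disjoint' in blast)
  also have "\<dots> = (\<Prod>i\<in>{i \<in> {1..length t}. even i = b}. \<Prod>j<term_at t i. f (partial_sum (i - 1) t + j))"
  proof (rule prod.cong[OF refl])
    fix i assume "i \<in> {i \<in> {1..length t}. even i = b}"
    then have "i \<ge> 1" by simp
    have "(\<Prod>q\<in>{partial_sum (i - 1) t..<partial_sum i t}. f q) =
        (\<Prod>q\<in>{0 + partial_sum (i - 1) t..<term_at t i + partial_sum (i - 1) t}. f q)"
      using partial_sum_pred[OF \<open>i \<ge> 1\<close>, of t] by (simp add: add.commute)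
    also have "\<dots> = (\<Prod>j\<in>{0..<term_at t i}. f (j + partial_sum (i - 1) t))"
      by (rule prod.shift_bounds_nat_ivl)
    finally show "(\<Prod>q\<in>{partial_sum (i - 1) t..<partial_sum i t}. f q) = (\<Prod>j<term_at t i. f (partial_sum (i - 1) t + j))"
      by (simp add: atLeast0LessThan add.commute)
  qed
  finally show ?thesis .
qed

lemma card_segments: "card (segments b t) = (\<Sum>i\<in>{i \<in> {1..length t}. even i = b}. term_at t i)"
proof -
  have "card (segments b t) =
      (\<Sum>i\<in>{i \<in> {1..length t}. even i = b}. card {partial_sum (i - 1) t..<partial_sum i t})"
    unfolding segments_def
    by (rule card_UN_disjoint) (simp, simp, use segments_disjoint' in blast)
  also have "\<dots> = (\<Sum>i\<in>{i \<in> {1..length t}. even i = b}. term_at t i)"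
    by (intro sum.cong refl) (auto simp: partial_sum_pred)
  finally show ?thesis .
qed

lemma card_segments_True [simp]: "card (segments True t) = even_sum t"
  by (simp add: card_segments even_sum_def)

lemma card_segments_False [simp]: "card (segments False t) = odd_sum t"
  by (simp add: card_segments odd_sum_def)

lemma segments_partition:
  "segments True t \<union> segments False t = {..<partial_sum (length t) t}" "segments True t \<inter> segments False t = {}"
proof -
  have "\<exists>i\<in>{1..n}. q \<in> {partial_sum (i - 1) t..<partial_sum i t}" if "q < partial_sum n t" for n q
    using that
  proof (induction n)
    case (Suc n)
    show ?case
    proof (cases "q < partial_sum n t")
      case True
      then show ?thesis using Suc.IH by force
    next
      case False
      then have "q \<in> {partial_sum (Suc n - 1) t..<partial_sum (Suc n) t}" using Suc.prems by simp
      then show ?thesis by (intro bexI[of _ "Suc n"]) auto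
    qed
  qed simp
  note ex = this
  have lt: "q < partial_sum (length t) t" if "q \<in> segments b t" for b q
  proof -
    from that obtain i where "i \<in> {1..length t}" "q < partial_sum i t"
      unfolding segments_def by auto
    then show ?thesis using partial_sum_mono[of i "length t" t] by simp
  qed
  show "segments True t \<union> segments False t = {..<partial_sum (length t) t}"
  proof (intro equalityI subsetI)
    fix q assume "q \<in> {..<partial_sum (length t) t}"
    then obtain i where i: "i \<in> {1..length t}" "q \<in> {partial_sum (i - 1) t..<partial_sum i t}"
      using ex[of q "length t"] by blast
    show "q \<in> segments True t \<union> segments False t"
      using i unfolding segments_def by (cases "even i") blast+
  qed (use lt in blast)
  show "segments True t \<inter> segments False t = {}"
  proof (rule ccontr)
    assume "segments True t \<inter> segments False t \<noteq> {}"
    then obtain q where q: "q \<in> segments True t" "q \<in> segments False t" by blast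
    from q(1) obtain i where i: "even i" "q \<in> {partial_sum (i - 1) t..<partial_sum i t}"
      unfolding segments_def by blast
    from q(2) obtain j where j: "odd j" "q \<in> {partial_sum (j - 1) t..<partial_sum j t}"
      unfolding segments_def by blast
    show False using segment_index_unique[OF i(2) j(2)] i(1) j(1) by simp
  qed
qed

lemma even_sum_plus_odd_sum: "even_sum t + odd_sum t = partial_sum (length t) t"
proof -
  have "card (segments True t \<union> segments False t) = even_sum t + odd_sum t"
    by (subst card_Un_disjoint) (simp_all add: segments_partition)
  then show ?thesis by (simp add: segments_partition(1))
qed

lemma segments_lessThan:
  assumes "q \<in> segments b t"
  shows "q < odd_sum t + even_sum t"
proof -
  have "q \<in> segments True t \<union> segments False t" using assms by (cases b) auto
  then have "q < partial_sum (length t) t" unfolding segments_partition(1) by simp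
  then show ?thesis using even_sum_plus_odd_sum[of t] by simp
qed

lemma term_at_le_even_sum:
  assumes "even i"
  shows "term_at t i \<le> even_sum t"
proof (cases "i \<in> {1..length t}")
  case True
  then show ?thesis
    unfolding even_sum_def using assms by (intro member_le_sum) auto
qed (auto simp: term_at_def)

lemma bottom_triangles_eq:
  "bottom_triangles (i0, - int k) t = (\<Union>(l, r)\<in>(\<lambda>i. (2 * i0 + 2 * int (partial_sum (i - 1) t) - int k + 1,
      2 * i0 + 2 * int (partial_sum (i - 1) t) - int k + 2 * int (term_at t i) - 1)) ` {i \<in> {1..length t}. even i}.
    tri_region k l r)"
  unfolding bottom_triangles_def by (simp add: up_triangle_eq algebra_simps)

section \<open>Product formulas\<close>

text \<open>
  With an even number of levels, the dent above the unit piece \<open>q\<close> of the base has position \<open>2 * q + 1\<close>, and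
  with an odd number of levels position \<open>2 * q\<close>. This explains the shift by one for \<open>Q\<close>.
\<close>

lemma Q_eq_symp: "Q t = symp (Suc ` segments True t)"
proof -
  define n where "n = even_sum t"
  let ?I = "{i \<in> {1..length t}. even i}"
  let ?\<F> = "(\<lambda>i. (2 * int (partial_sum (i - 1) t) + 1, 2 * int (partial_sum (i - 1) t) + 2 * int (term_at t i) - 1)) ` ?I"
  let ?D = "(\<lambda>p. 2 * int p - 1) ` Suc ` segments True t"
  have "Q t = tiling_sum (\<lambda>_. 1) (trap (odd_sum t) (2 * n) - bottom_triangles (int n, - int (2 * n)) t)"
    unfolding Q_def Let_def n_def[symmetric] polygon_Q by simp
  also have "\<dots> = tiling_sum (std_weight 1) (trap (odd_sum t) (2 * n) - (\<Union>(l, r)\<in>?\<F>. tri_region (2 * n) l r) - row (- int (2 * n)) {})"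
    unfolding bottom_triangles_eq by simp
  also have "\<dots> = tsum 1 (odd_sum t) (2 * n) (?D \<union> {})"
  proof (rule tiling_sum_remove_triangles)
    fix l r assume "(l, r) \<in> ?\<F>"
    then obtain i where i: "even i" "l = 2 * int (partial_sum (i - 1) t) + 1"
      "r = 2 * int (partial_sum (i - 1) t) + 2 * int (term_at t i) - 1" by auto
    then show "odd (l + int (2 * n)) \<and> odd (r + int (2 * n)) \<and> (r < int (2 * n) \<or> r - l < 2 * int (2 * n)) \<and> (1 = (1::real) \<or> 1 \<le> l)"
      using term_at_le_even_sum[OF i(1), of t] unfolding n_def by auto
  next
    fix m
    show "m \<in> ?D \<longleftrightarrow> 0 \<le> m \<and> odd (m + int (2 * n)) \<and> (\<exists>(l, r)\<in>?\<F>. l \<le> m \<and> m \<le> r)" (is "_ \<longleftrightarrow> ?R")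
    proof
      assume "m \<in> ?D"
      then obtain q i where "m = 2 * int q + 1" "i \<in> ?I" "partial_sum (i - 1) t \<le> q" "q < partial_sum i t"
        by (auto simp: segments_def)
      then show ?R using partial_sum_pred[of i t] by (auto intro!: bexI[of _ i])
    next
      assume ?R
      then obtain i where i: "0 \<le> m" "odd m" "i \<in> ?I" "2 * int (partial_sum (i - 1) t) + 1 \<le> m"
        "m \<le> 2 * int (partial_sum (i - 1) t) + 2 * int (term_at t i) - 1"
        by auto
      define q where "q = nat ((m - 1) div 2)"
      have "(m - 1) div 2 \<ge> 0" using i(1,2) by presburger
      then have "int q = (m - 1) div 2" by (simp add: q_def)
      then have q: "m = 2 * int (Suc q) - 1" using i(2) by presburger
      then have "q \<in> {partial_sum (i - 1) t..<partial_sum i t}"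
        using i partial_sum_pred[of i t] by auto
      then have "q \<in> segments True t" using i(3) unfolding segments_def by blast
      then show "m \<in> ?D" using q by blast
    qed
  qed simp
  also have "\<dots> = (if card (Suc ` segments True t) = n then symp (Suc ` segments True t) else 0)"
    unfolding Un_empty_right
  proof (rule tsum_symp)
    show "1 \<le> p \<and> p \<le> odd_sum t + n" if "p \<in> Suc ` segments True t" for p
      using that segments_lessThan[of _ True t] by (auto simp: n_def Suc_le_eq)
    show "Suc ` segments True t = {}" if "n = 0"
      using that card_segments_True[of t] unfolding n_def by (simp del: card_segments_True)
  qed simp
  also have "card (Suc ` segments True t) = n"
    by (simp add: card_image n_def)
  finally show ?thesis by simp
qed

lemma K'_eq_orth:
  assumes "even_sum t \<ge> 1" "term_at t 1 \<ge> 1"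
  shows "K' t = orth (segments True t)"
proof -
  define n where "n = even_sum t"
  have n1: "n \<ge> 1" using assms by (simp add: n_def)
  then obtain n' where n': "n = Suc n'" by (cases n) auto
  let ?k = "2 * n - 1"
  let ?Z = "path_edges (0, 0) (repeat_steps (n - 1) [SW, SE] @ [SW])"
  let ?I = "{i \<in> {1..length t}. even i}"
  let ?\<F> = "(\<lambda>i. (2 * int (partial_sum (i - 1) t), 2 * int (partial_sum (i - 1) t) + 2 * int (term_at t i) - 2)) ` ?I"
  let ?D = "(\<lambda>p. 2 * int p) ` segments True t"
  have Z: "(move NE p, p) \<in> set ?Z \<and> (p, move SE p) \<in> set ?Z \<longleftrightarrow> (\<exists>h<n'. p = (int h, - 2 * int h - 1))" for p
    unfolding path_edges_append set_append Un_iff zigzag_west_edges by (cases p) (auto simp: n')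
  have ep: "endpoint (0, 0) (repeat_steps (n - 1) [SW, SE] @ [SW]) = (int n - 1, - int ?k)"
    by (simp add: n')
  have "K' t = tiling_sum (zigzag_weight ?Z) (trap (odd_sum t) ?k - bottom_triangles (int n - 1, - int ?k) t)"
    unfolding K'_def Let_def n_def[symmetric] polygon_K'[OF n1] ep ..
  also have "\<dots> = tiling_sum (std_weight (1 / 2)) (trap (odd_sum t) ?k - bottom_triangles (int n - 1, - int ?k) t)"
    by (rule tiling_sum_cong, rule zigzag_weight_eq_std_weight[OF Z]) (auto simp: n')
  also have "\<dots> = tiling_sum (std_weight (1 / 2)) (trap (odd_sum t) ?k - (\<Union>(l, r)\<in>?\<F>. tri_region ?k l r) - row (- int ?k) {})"
    unfolding bottom_triangles_eq by (simp add: n' algebra_simps)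
  also have "\<dots> = tsum (1 / 2) (odd_sum t) ?k (?D \<union> {})"
  proof (rule tiling_sum_remove_triangles)
    fix l r assume "(l, r) \<in> ?\<F>"
    then obtain i where i: "even i" "i \<ge> 1" "l = 2 * int (partial_sum (i - 1) t)"
      "r = 2 * int (partial_sum (i - 1) t) + 2 * int (term_at t i) - 2" by auto
    have "1 \<le> i - 1" using i(1,2) by presburger
    then have "1 \<le> partial_sum (i - 1) t"
      using partial_sum_mono[of 1 "i - 1" t] assms(2) by simp
    then show "odd (l + int ?k) \<and> odd (r + int ?k) \<and> (r < int ?k \<or> r - l < 2 * int ?k) \<and> (1 / 2 = (1::real) \<or> 1 \<le> l)"
      using term_at_le_even_sum[OF i(1), of t] i n' unfolding n_def[symmetric] by auto
  next
    fix m
    show "m \<in> ?D \<longleftrightarrow> 0 \<le> m \<and> odd (m + int ?k) \<and> (\<exists>(l, r)\<in>?\<F>. l \<le> m \<and> m \<le> r)" (is "_ \<longleftrightarrow> ?R")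
    proof
      assume "m \<in> ?D"
      then obtain q i where "m = 2 * int q" "i \<in> ?I" "partial_sum (i - 1) t \<le> q" "q < partial_sum i t"
        by (auto simp: segments_def)
      then show ?R using partial_sum_pred[of i t] n' by (auto intro!: bexI[of _ i])
    next
      assume ?R
      then obtain i where i: "0 \<le> m" "even m" "i \<in> ?I" "2 * int (partial_sum (i - 1) t) \<le> m"
        "m \<le> 2 * int (partial_sum (i - 1) t) + 2 * int (term_at t i) - 2"
        using n' by auto
      define q where "q = nat (m div 2)"
      have q: "m = 2 * int q" using i(1,2) unfolding q_def by auto
      then have "q \<in> {partial_sum (i - 1) t..<partial_sum i t}"
        using i partial_sum_pred[of i t] by auto
      then have "q \<in> segments True t" using i(3) unfolding segments_def by blast
      then show "m \<in> ?D" using q by blast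
    qed
  qed simp
  also have "\<dots> = (if card (segments True t) = n then orth (segments True t) else 0)"
    unfolding Un_empty_right
  proof (rule tsum_orth)
    show "p < odd_sum t + n" if "p \<in> segments True t" for p
      using that segments_lessThan[of _ True t] by (auto simp: n_def Suc_le_eq)
  qed (use n1 in auto)
  finally show ?thesis by (simp add: n_def)
qed

lemma P_eq_symp:
  assumes "a \<ge> 1"
  shows "P y (y + 2 * a - 2) c = symp ({1..<a} \<union> {a + c..<a + c + y})"
proof -
  let ?n = "y + a - 1"
  let ?\<F> = "{(- 2 * int (y + a) - 1, 2 * int a - 3), (2 * int (c + a) - 1, 2 * int (c + y + a) - 3)}"
  let ?S = "{1..<a} \<union> {a + c..<a + c + y}"
  let ?D = "(\<lambda>p. 2 * int p - 1) ` ?S"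
  have "P y (y + 2 * a - 2) c = tiling_sum (std_weight 1)
      (trap c (2 * ?n) - (\<Union>(l, r)\<in>?\<F>. tri_region (2 * ?n) l r) - row (- int (2 * ?n)) {})"
    unfolding P_def polygon_P[OF assms] by (simp add: Diff_eq Int_assoc)
  also have "\<dots> = tsum 1 c (2 * ?n) (?D \<union> {})"
  proof (rule tiling_sum_remove_triangles)
    fix l r assume "(l, r) \<in> ?\<F>"
    then show "odd (l + int (2 * ?n)) \<and> odd (r + int (2 * ?n)) \<and> (r < int (2 * ?n) \<or> r - l < 2 * int (2 * ?n)) \<and> (1 = (1::real) \<or> 1 \<le> l)"
      using assms by (auto simp: of_nat_diff)
  next
    fix m
    show "m \<in> ?D \<longleftrightarrow> 0 \<le> m \<and> odd (m + int (2 * ?n)) \<and> (\<exists>(l, r)\<in>?\<F>. l \<le> m \<and> m \<le> r)" (is "_ \<longleftrightarrow> ?R")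
    proof
      assume "m \<in> ?D"
      then show ?R using assms by auto
    next
      assume R: ?R
      define p where "p = nat ((m + 1) div 2)"
      have p: "m = 2 * int p - 1" using R unfolding p_def by (auto elim!: oddE)
      have "p \<in> ?S" using R unfolding p by auto
      then show "m \<in> ?D" using p by blast
    qed
  qed simp
  also have "\<dots> = (if card ?S = ?n then symp ?S else 0)"
    unfolding Un_empty_right by (rule tsum_symp) (use assms in auto)
  also have "card ?S = ?n"
    by (subst card_Un_disjoint) (use assms in auto)
  finally show ?thesis by simp
qed

lemma P'_eq_orth:
  assumes "c \<ge> 1"
  shows "P' n n c = orth {c..<c + n + 1}"
proof -
  let ?Z = "path_edges (0, 0) (repeat_steps n [SW, SE])"
  let ?D = "(\<lambda>i. 2 * int (c + i) + 1) ` {..<n}"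
  have Z: "(move NE p, p) \<in> set ?Z \<and> (p, move SE p) \<in> set ?Z \<longleftrightarrow> (\<exists>h<n. p = (int h, - 2 * int h - 1))" for p
    unfolding zigzag_west_edges by simp
  have poly: "polygon (0, 0) (P_path n n c) = trap c (2 * n) - tri_region (2 * n) (2 * int c + 1) (2 * int (c + n) - 1)"
  proof -
    have args: "n + 2 * 1 - 2 = n" "n + 1 - 1 = n" "2 * int (c + 1) - 1 = 2 * int c + 1"
      "2 * int (c + n + 1) - 3 = 2 * int (c + n) - 1"
      by simp_all
    have "trap c (2 * n) \<inter> tri_region (2 * n) l (2 * int 1 - 3) = {}" for l
      by (auto simp: trap_def tri_region_def)
    then show ?thesis
      using polygon_P[of 1 n c] unfolding args by blast
  qed
  have "P' n n c = tiling_sum (std_weight (1 / 2)) (polygon (0, 0) (P_path n n c))"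
    unfolding P'_def
    by (rule tiling_sum_cong, rule zigzag_weight_eq_std_weight[OF Z]) (auto simp: poly)
  also have "\<dots> = tiling_sum (std_weight (1 / 2))
      (trap c (2 * n) - (\<Union>(l, r)\<in>{(2 * int c + 1, 2 * int (c + n) - 1)}. tri_region (2 * n) l r) - row (- int (2 * n)) {})"
    by (simp add: poly)
  also have "\<dots> = tsum (1 / 2) c (2 * n) (?D \<union> {})"
  proof (rule tiling_sum_remove_triangles)
    fix m
    show "m \<in> ?D \<longleftrightarrow> 0 \<le> m \<and> odd (m + int (2 * n)) \<and> (\<exists>(l, r)\<in>{(2 * int c + 1, 2 * int (c + n) - 1)}. l \<le> m \<and> m \<le> r)" (is "_ \<longleftrightarrow> ?R")
    proof
      assume R: ?R
      define i where "i = nat ((m - 1) div 2 - int c)"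
      have "m = 2 * int (c + i) + 1" "i < n" using R unfolding i_def by (auto elim!: oddE)
      then show "m \<in> ?D" by blast
    qed auto
  qed (use assms in auto)
  also have "\<dots> = orth {c..<c + n + 1}"
  proof (cases "n = 0")
    case True
    have e: "{p \<in> {c}. p < q} = {}" if "q \<in> {c}" for q using that by auto
    have "vdm {c} = 1"
      unfolding vdm_def by (rule prod.neutral, intro ballI, simp only: e prod.empty)
    then show ?thesis using True by (simp add: orth_def)
  next
    case False
    let ?I = "\<lambda>i. {m. 2 * int (c + i) < m \<and> m < 2 * int (c + Suc i) \<and> odd m}"
    have "tsum (1 / 2) c (Suc (2 * n)) ((\<lambda>i. 2 * int (c + i)) ` {..<Suc n}) =
        (\<Sum>h\<in>Pi\<^sub>E {..<n} ?I. tsum (1 / 2) c (2 * n) (h ` {..<n}))"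
      by (rule tsum_to_odd) (use False in auto)
    moreover have I: "?I i = {2 * int (c + i) + 1}" for i
      by auto
    have "Pi\<^sub>E {..<n} ?I = Pi\<^sub>E {..<n} (\<lambda>i. {restrict (\<lambda>i. 2 * int (c + i) + 1) {..<n} i})"
      unfolding I by (rule PiE_cong) simp
    then have "Pi\<^sub>E {..<n} ?I = {restrict (\<lambda>i. 2 * int (c + i) + 1) {..<n}}"
      using PiE_singleton[of "restrict (\<lambda>i. 2 * int (c + i) + 1) {..<n}" "{..<n}"] by simp
    ultimately have "tsum (1 / 2) c (Suc (2 * n)) ((\<lambda>i. 2 * int (c + i)) ` {..<Suc n}) = tsum (1 / 2) c (2 * n) ?D"
      by simp
    moreover have "(\<lambda>i. 2 * int (c + i)) ` {..<Suc n} = (\<lambda>p. 2 * int p) ` {c..<c + n + 1}"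
    proof -
      have "{c..<c + n + 1} = (\<lambda>i. c + i) ` {..<Suc n}"
        using image_add_atLeastLessThan[of c 0 "Suc n"] by (simp add: atLeast0LessThan add.commute)
      then show ?thesis by (simp only: image_image)
    qed
    moreover have "tsum (1 / 2) c (2 * (n + 1) - 1) ((\<lambda>p. 2 * int p) ` {c..<c + n + 1}) =
        (if card {c..<c + n + 1} = n + 1 then orth {c..<c + n + 1} else 0)"
      by (rule tsum_orth) auto
    ultimately show ?thesis by simp
  qed
  finally show ?thesis .
qed

section \<open>Cutting the halved hexagon along the fern\<close>

text \<open>
  Reflection in a horizontal line, combined with a horizontal shift by \<open>e\<close> half units. It maps
  the level \<open>s\<close> to \<open>\<beta> - s\<close>.
\<close>

definition flip :: "int \<Rightarrow> int \<Rightarrow> tri \<Rightarrow> tri" where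
  "flip \<beta> e t = tri_at (\<beta> - 1 - strip t) (mid_x t + e)"

lemma flip_tri_at [simp]: "flip \<beta> e (tri_at s m) = tri_at (\<beta> - 1 - s) (m + e)"
  by (simp add: flip_def)

lemma flip_flip [simp]: "flip \<beta> (- e) (flip \<beta> e t) = t" "flip \<beta> e (flip \<beta> (- e) t) = t"
  by (simp_all add: flip_def)

lemma inj_flip: "inj (flip \<beta> e)"
  by (metis flip_flip(1) injI)

lemma flip_vert: "flip \<beta> e ` vert s m = vert (\<beta> - s) (m + e)"
  by (auto simp: vert_def)

lemma flip_lozenge:
  assumes "even (\<beta> + e)" "l \<in> lozenges"
  shows "flip \<beta> e ` l \<in> lozenges"
  using assms(2)
proof (cases rule: lozenge_cases)
  case (horizontal s m)
  then have "flip \<beta> e ` l = {tri_at (\<beta> - 1 - s) (m + e), tri_at (\<beta> - 1 - s) (m + e + 1)}"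
    by (simp add: algebra_simps)
  then show ?thesis unfolding lozenge_iff by blast
next
  case (vertical s m)
  have "odd (m + e + (\<beta> - s))"
    using vertical(1) assms(1) by presburger
  then show ?thesis
    unfolding vertical(2) flip_vert vert_lozenge_iff .
qed

lemma flip_lozenge_iff:
  assumes "even (\<beta> + e)"
  shows "flip \<beta> e ` l \<in> lozenges \<longleftrightarrow> l \<in> lozenges"
proof
  assume "flip \<beta> e ` l \<in> lozenges"
  then have "flip \<beta> (- e) ` flip \<beta> e ` l \<in> lozenges"
    by (rule flip_lozenge[rotated]) (use assms in simp)
  then show "l \<in> lozenges" by (simp add: image_image)
qed (rule flip_lozenge[OF assms])

lemma in_flip_image: "t \<in> flip \<beta> e ` R \<longleftrightarrow> flip \<beta> (- e) t \<in> R"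
  by (metis flip_flip imageE image_eqI)

lemma down_triangle_eq:
  "down_triangle (i, j) n = {t. strip t < j \<and> 2 * (i + j) \<le> mid_x t + strip t \<and> mid_x t - strip t \<le> 2 * (i + int n)}"
  unfolding down_triangle_def polygon_def by auto

lemma above_and_left_eq:
  "above_and_left_of_NW_line (i, j) = {t. j \<le> strip t \<and> mid_x t + strip t \<le> 2 * (i + j) - 1}"
proof -
  have "t \<in> above_and_left_of_NW_line (i, j) \<longleftrightarrow> j \<le> strip t \<and> mid_x t + strip t \<le> 2 * (i + j) - 1" for t
  proof (cases t)
    case (Up p)
    then show ?thesis by (cases p) (auto simp: above_and_left_of_NW_line_def)
  next
    case (Down p)
    then show ?thesis by (cases p) (auto simp: above_and_left_of_NW_line_def)
  qed
  then show ?thesis by auto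
qed

text \<open>
  The two assumptions are those under which the halved hexagon is defined. The line of the fern
  divides it into an upper part of \<open>2 * n1\<close> and a lower part of \<open>2 * n2 - 1\<close> strips.
\<close>

locale halved_hexagon =
  fixes x y z :: nat and a :: "nat list"
  assumes a1: "term_at a 1 \<ge> 1" and zE: "z + even_sum a \<ge> 1"
begin

abbreviation "Ob \<equiv> odd_sum a"
abbreviation "Eb \<equiv> even_sum a"
abbreviation "Nb \<equiv> Ob + Eb"

definition "n1 = y + Ob - 1"
definition "n2 = z + Eb"

lemma Ob1: "term_at a 1 \<le> Ob"
proof (cases "1 \<le> length a")
  case True
  then show ?thesis
    unfolding odd_sum_def by (intro member_le_sum) auto
next
  case False
  then show ?thesis using a1 by (simp add: term_at_def)
qed

lemma Ob_pos: "1 \<le> Ob"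
  using Ob1 a1 by simp

lemma odd_term_le:
  assumes "odd i" "i \<noteq> 1"
  shows "term_at a i + 1 \<le> Ob"
proof (cases "i \<in> {1..length a}")
  case True
  have "(\<Sum>j\<in>{1, i}. term_at a j) \<le> Ob"
    unfolding odd_sum_def using assms True by (intro sum_mono2) auto
  then show ?thesis using assms a1 by auto
next
  case False
  then show ?thesis using Ob_pos by (auto simp: term_at_def)
qed

text \<open>
  The point at which the line of the fern meets the western boundary.
\<close>

definition "W0 = (int n1 - 1, - 2 * int n1)"

lemma endpoint_upper: "endpoint (0, 0) (H8_upper y a) = W0"
  by (simp add: H8_upper_def W0_def n1_def)

lemma in_polygon_iff:
  "t \<in> H8_polygon x y z a \<longleftrightarrow>
    (- 2 * int n1 \<le> strip t \<and> strip t < 0 \<and> 0 \<le> mid_x t \<or>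
     - 2 * int n1 - 2 * int n2 + 1 \<le> strip t \<and> strip t < - 2 * int n1 \<and> - 1 \<le> mid_x t) \<and>
    (if strip t < 2 - int y - int z - 2 * int Ob
     then mid_x t - strip t \<le> 2 * (int n1 + int n2 + int x + int Ob - 1)
     else mid_x t + strip t < 2 * (int x + int Eb))"
proof -
  obtain o' where O: "Ob = Suc o'" using Ob_pos by (cases Ob) auto
  obtain n' where n': "z + Eb = Suc n'" using zE by (cases "z + Eb") auto
  have zE': "int z + int Eb = int n' + 1" using n' by linarith
  have e1: "y + Ob - 1 = y + o'" "n1 = y + o'" "n2 = Suc n'" "z + Eb - 1 = n'" "y + z + 2 * Ob - 2 = y + z + 2 * o'"
    "y + z + 2 * Eb - 1 = y + Eb + n'"
    using n' by (simp_all add: n1_def n2_def O)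
  have up: "H8_upper y a = repeat_steps (y + o') [SW, SE] @ replicate 1 West"
    and low: "H8_lower z a = repeat_steps n' [SE, SW] @ replicate 1 SE"
    unfolding H8_upper_def H8_lower_def e1 by simp_all
  show ?thesis
    unfolding H8_polygon_def polygon_def up low e1 O mem_Collect_eq
    using zE'
    by (auto split: if_splits simp del: winding_Cons replicate_Suc endpoint_Cons)
qed

text \<open>
  The triangles, given by the extent of their bottom sides, that have to be removed from a
  trapezoid to obtain the upper part: the half triangle at the first segment, which is completed
  to the west, the corner cut off by the NE side if \<open>y > z\<close>, and the remaining up-pointing triangles of the fern.
\<close>

definition "F1 = insert (- 2 * int n1 - 1, 2 * int (term_at a 1) - 3)
  (insert (2 * int (Nb + x + z) - 1, 2 * int (Nb + x + y) - 3)
    ((\<lambda>i. (2 * int (partial_sum (i - 1) a) - 1, 2 * int (partial_sum (i - 1) a) + 2 * int (term_at a i) - 3)) `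
      {i \<in> {2..length a}. odd i}))"

text \<open>
  The same for the reflected lower part. Here a corner is cut off if \<open>z > y\<close>, and the others are the down-pointing
  triangles of the fern.
\<close>

definition "F2 = insert (2 * int (Nb + x + y), 2 * int (Nb + x + z) - 2)
    ((\<lambda>i. (2 * int (partial_sum (i - 1) a), 2 * int (partial_sum (i - 1) a) + 2 * int (term_at a i) - 2)) `
      {i \<in> {2..length a}. even i})"

definition "upper = trap (x + Eb) (2 * n1) - (\<Union>(l, r)\<in>F1. tri_region (2 * n1) l r)"
definition "lower = flip (- 2 * int n1 - 2 * int n2 + 1) (- 1) `
  (trap (x + Ob) (2 * n2 - 1) - (\<Union>(l, r)\<in>F2. tri_region (2 * n2 - 1) l r))"

lemma n1_int: "int n1 = int y + int Ob - 1" and n2_int: "int n2 = int z + int Eb" and n2_pos: "n2 \<ge> 1"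
  using Ob_pos zE by (simp_all add: n1_def n2_def of_nat_diff)

lemma in_upper_iff:
  "t \<in> upper \<longleftrightarrow> t \<in> H8_polygon x y z a - fern W0 a \<and> - 2 * int n1 \<le> strip t"
proof (cases "- 2 * int n1 \<le> strip t")
  case True
  define h where "h = strip t + 2 * int n1"
  have fern: "t \<in> fern W0 a \<longleftrightarrow> mid_x t + h \<le> 2 * int (term_at a 1) - 3 \<or>
    (\<exists>i\<in>{i \<in> {2..length a}. odd i}. 2 * int (partial_sum (i - 1) a) - 1 \<le> mid_x t - h \<and>
        mid_x t + h \<le> 2 * int (partial_sum (i - 1) a) + 2 * int (term_at a i) - 3)"
  proof -
    have "t \<in> (if odd i then up_triangle else down_triangle) (int n1 - 1 + int (partial_sum (i - 1) a), - 2 * int n1) (term_at a i) \<longleftrightarrow>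
      odd i \<and> 2 * int (partial_sum (i - 1) a) - 1 \<le> mid_x t - h \<and>
        mid_x t + h \<le> 2 * int (partial_sum (i - 1) a) + 2 * int (term_at a i) - 3" for i
      using True up_triangle_eq[of "int n1 - 1 + int (partial_sum (i - 1) a)" "2 * n1" "term_at a i"]
      by (auto simp: down_triangle_eq tri_region_def h_def)
    moreover have "t \<in> above_and_left_of_NW_line (int n1 - 1 + int (term_at a 1), - 2 * int n1) \<longleftrightarrow>
        mid_x t + h \<le> 2 * int (term_at a 1) - 3"
      using True by (auto simp: above_and_left_eq h_def)
    ultimately show ?thesis
      unfolding fern_def W0_def fst_conv snd_conv Un_iff UN_iff by blast
  qed
  have upper: "t \<in> upper \<longleftrightarrow> t \<in> trap (x + Eb) (2 * n1) \<and> \<not> (mid_x t + h \<le> 2 * int (term_at a 1) - 3) \<and>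
    \<not> (2 * int (Nb + x + z) - 1 \<le> mid_x t - h \<and> mid_x t + h \<le> 2 * int (Nb + x + y) - 3) \<and>
    \<not> (\<exists>i\<in>{i \<in> {2..length a}. odd i}. 2 * int (partial_sum (i - 1) a) - 1 \<le> mid_x t - h \<and>
        mid_x t + h \<le> 2 * int (partial_sum (i - 1) a) + 2 * int (term_at a i) - 3)"
    using True unfolding upper_def F1_def h_def
    by (auto simp: tri_region_def trap_def)
  have poly: "t \<in> H8_polygon x y z a \<longleftrightarrow> t \<in> trap (x + Eb) (2 * n1) \<and>
    \<not> (2 * int (Nb + x + z) - 1 \<le> mid_x t - h \<and> mid_x t + h \<le> 2 * int (Nb + x + y) - 3)"
    using True n1_int n2_int n2_pos unfolding in_polygon_iff h_def trap_def mem_Collect_eq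
    by (auto split: if_splits)
  show ?thesis
    using True fern upper poly by blast
next
  case False
  then show ?thesis
    by (auto simp: upper_def trap_def)
qed

lemma in_lower_iff:
  "t \<in> lower \<longleftrightarrow> t \<in> H8_polygon x y z a - fern W0 a \<and> strip t < - 2 * int n1"
proof (cases "strip t < - 2 * int n1")
  case True
  define s m where "s = - 2 * int n1 - 2 * int n2 - strip t" and "m = mid_x t + 1"
  have sm: "strip t = - 2 * int n1 - 2 * int n2 - s" "mid_x t = m - 1"
    by (simp_all add: s_def m_def)
  define h where "h = s + int (2 * n2 - 1)"
  have hs: "h = s + 2 * int n2 - 1" using n2_pos by (simp add: h_def of_nat_diff)
  have h0: "0 \<le> h" using True unfolding hs sm by simp
  have fern: "t \<in> fern W0 a \<longleftrightarrow>
    (\<exists>i\<in>{i \<in> {2..length a}. even i}. 2 * int (partial_sum (i - 1) a) \<le> m - h \<and>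
        m + h \<le> 2 * int (partial_sum (i - 1) a) + 2 * int (term_at a i) - 2)"
  proof -
    have "t \<in> (if odd i then up_triangle else down_triangle) (int n1 - 1 + int (partial_sum (i - 1) a), - 2 * int n1) (term_at a i) \<longleftrightarrow>
      even i \<and> 2 * int (partial_sum (i - 1) a) \<le> m - h \<and>
        m + h \<le> 2 * int (partial_sum (i - 1) a) + 2 * int (term_at a i) - 2" for i
      using True up_triangle_eq[of "int n1 - 1 + int (partial_sum (i - 1) a)" "2 * n1" "term_at a i"]
      by (auto simp: down_triangle_eq tri_region_def hs sm)
    moreover have "t \<notin> above_and_left_of_NW_line (int n1 - 1 + int (term_at a 1), - 2 * int n1)"
      using True by (auto simp: above_and_left_eq)
    ultimately show ?thesis
      unfolding fern_def W0_def fst_conv snd_conv Un_iff UN_iff by blast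
  qed
  have lower: "t \<in> lower \<longleftrightarrow> (s < 0 \<and> 0 \<le> m \<and> m < 2 * int (x + Ob) - s) \<and>
    \<not> (2 * int (Nb + x + y) \<le> m - h \<and> m + h \<le> 2 * int (Nb + x + z) - 2) \<and>
    \<not> (\<exists>i\<in>{i \<in> {2..length a}. even i}. 2 * int (partial_sum (i - 1) a) \<le> m - h \<and>
        m + h \<le> 2 * int (partial_sum (i - 1) a) + 2 * int (term_at a i) - 2)"
  proof -
    have f: "flip (- 2 * int n1 - 2 * int n2 + 1) (- (- 1)) t = tri_at s m"
      by (simp add: flip_def s_def m_def)
    show ?thesis
      unfolding lower_def in_flip_image f F2_def
      using h0 by (auto simp: tri_region_def trap_def h_def)
  qed
  have poly: "t \<in> H8_polygon x y z a \<longleftrightarrow> (s < 0 \<and> 0 \<le> m \<and> m < 2 * int (x + Ob) - s) \<and>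
    \<not> (2 * int (Nb + x + y) \<le> m - h \<and> m + h \<le> 2 * int (Nb + x + z) - 2)"
    using True n1_int n2_int n2_pos h0 unfolding in_polygon_iff hs sm
    by (auto split: if_splits)
  show ?thesis
    using True fern lower poly by blast
next
  case False
  then show ?thesis
    using n2_pos by (auto simp: lower_def in_flip_image trap_def flip_def)
qed

lemma region_split: "H8_polygon x y z a - fern W0 a = upper \<union> lower"
  by (auto simp: in_upper_iff in_lower_iff)

end

context halved_hexagon
begin

text \<open>
  The unit pieces of the line of the fern are numbered from 0, beginning at \<open>W0\<close>. The sets below consist of the pieces
  in odd segments, in even segments, of the pieces that a vertical lozenge may cross, and of the pieces
  at the corners cut off above and below. Piece 0 bounds the half triangle and lies beyond the zigzag of the
  upper part. If \<open>n1 = 0\<close>, there is nothing above the line.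
\<close>

definition "ups = segments False a - {0}"
definition "downs = segments True a"
definition "gap = (if n1 = 0 then {} else {Nb..<Nb + x + min y z})"
definition "corner_up = {Nb + x + z..<Nb + x + y}"
definition "corner_down = {Nb + x + y..<Nb + x + z}"

lemma gap_iff: "p \<in> gap \<longleftrightarrow> n1 \<noteq> 0 \<and> Nb \<le> p \<and> p < Nb + x + min y z"
  by (simp add: gap_def)

lemma zero_in_segments: "0 \<in> segments False a"
proof -
  have "1 \<in> {i \<in> {1..length a}. even i = False}" using a1 by (auto simp: term_at_def split: if_splits)
  moreover have "0 \<in> {partial_sum (1 - 1) a..<partial_sum 1 a}" using a1 partial_sum_Suc[of 0 a] by simp
  ultimately show ?thesis unfolding segments_def by blast
qed

lemma finite_sets [simp]: "finite ups" "finite downs" "finite gap" "finite corner_up" "finite corner_down"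
  by (simp_all add: ups_def downs_def gap_def corner_up_def corner_down_def)

lemma ups_downs: "ups \<union> downs = {1..<Nb}" "ups \<inter> downs = {}"
proof -
  have 0: "0 \<notin> downs" using zero_in_segments segments_partition(2)[of a] unfolding downs_def by blast
  have "segments True a \<union> segments False a = {..<Nb}"
    using segments_partition(1)[of a] even_sum_plus_odd_sum[of a] by (simp add: add.commute)
  then have "ups \<union> downs = {..<Nb} - {0}" using 0 unfolding ups_def downs_def by blast
  moreover have "{..<Nb} - {0} = {1..<Nb}" by auto
  ultimately show "ups \<union> downs = {1..<Nb}" by (simp only:)
  show "ups \<inter> downs = {}" using segments_partition(2)[of a] unfolding ups_def downs_def by blast
qed

lemma card_ups: "card ups = Ob - 1" and card_downs: "card downs = Eb"
  using zero_in_segments by (simp_all add: ups_def downs_def)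

lemma ups_iff: "p \<in> ups \<longleftrightarrow> 1 \<le> p \<and> (p < term_at a 1 \<or>
    (\<exists>i\<in>{i \<in> {2..length a}. odd i}. partial_sum (i - 1) a \<le> p \<and> p < partial_sum (i - 1) a + term_at a i))"
proof -
  have len: "1 \<le> length a" using a1 by (auto simp: term_at_def split: if_splits)
  then have I: "{i \<in> {1..length a}. even i = False} = insert 1 {i \<in> {2..length a}. odd i}"
    by (auto simp: le_Suc_eq numeral_2_eq_2 Suc_le_eq)
  have eq: "{partial_sum (i - 1) a..<partial_sum i a} = {partial_sum (i - 1) a..<partial_sum (i - 1) a + term_at a i}"
    if "i \<in> insert 1 {i \<in> {2..length a}. odd i}" for i
    using that partial_sum_pred[of i a] by auto
  have "segments False a = (\<Union>i\<in>insert 1 {i \<in> {2..length a}. odd i}. {partial_sum (i - 1) a..<partial_sum (i - 1) a + term_at a i})"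
    unfolding segments_def I by (rule SUP_cong[OF refl eq])
  then show ?thesis
    unfolding ups_def by auto
qed

lemma downs_iff: "p \<in> downs \<longleftrightarrow>
    (\<exists>i\<in>{i \<in> {2..length a}. even i}. partial_sum (i - 1) a \<le> p \<and> p < partial_sum (i - 1) a + term_at a i)"
proof -
  have "1 \<le> i \<longleftrightarrow> 2 \<le> i" if "even i" for i :: nat
    using that by presburger
  then have I: "{i \<in> {1..length a}. even i = True} = {i \<in> {2..length a}. even i}"
    by auto
  have eq: "{partial_sum (i - 1) a..<partial_sum i a} = {partial_sum (i - 1) a..<partial_sum (i - 1) a + term_at a i}"
    if "i \<in> {i \<in> {2..length a}. even i}" for i
    using that partial_sum_pred[of i a] by auto
  have "downs = (\<Union>i\<in>{i \<in> {2..length a}. even i}. {partial_sum (i - 1) a..<partial_sum (i - 1) a + term_at a i})"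
    unfolding downs_def segments_def I by (rule SUP_cong[OF refl eq])
  then show ?thesis
    by auto
qed

lemma partial_sum_pos:
  assumes "i \<ge> 2"
  shows "1 \<le> partial_sum (i - 1) a"
proof -
  have "1 \<le> i - 1" using assms by simp
  from partial_sum_mono[OF this, of a] show ?thesis
    using a1 partial_sum_Suc[of 0 a] by simp
qed

lemma in_F1_iff: "(\<exists>(l, r)\<in>F1. l \<le> 2 * int p - 1 \<and> 2 * int p - 1 \<le> r) \<longleftrightarrow> p \<in> ups \<union> corner_up" if "1 \<le> p"
proof -
  have "(\<exists>(l, r)\<in>F1. l \<le> 2 * int p - 1 \<and> 2 * int p - 1 \<le> r) \<longleftrightarrow> p < term_at a 1 \<or> p \<in> corner_up \<or>
    (\<exists>i\<in>{i \<in> {2..length a}. odd i}. 2 * int (partial_sum (i - 1) a) - 1 \<le> 2 * int p - 1 \<and>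
      2 * int p - 1 \<le> 2 * int (partial_sum (i - 1) a) + 2 * int (term_at a i) - 3)"
    unfolding F1_def by (auto simp: corner_up_def)
  also have "\<dots> \<longleftrightarrow> p < term_at a 1 \<or> p \<in> corner_up \<or>
    (\<exists>i\<in>{i \<in> {2..length a}. odd i}. partial_sum (i - 1) a \<le> p \<and> p < partial_sum (i - 1) a + term_at a i)"
    by (intro arg_cong2[where f = "(\<or>)"] bex_cong refl) auto
  finally show ?thesis using ups_iff[of p] that by blast
qed

lemma in_F2_iff: "(\<exists>(l, r)\<in>F2. l \<le> 2 * int p \<and> 2 * int p \<le> r) \<longleftrightarrow> p \<in> downs \<union> corner_down"
proof -
  have "(\<exists>(l, r)\<in>F2. l \<le> 2 * int p \<and> 2 * int p \<le> r) \<longleftrightarrow> p \<in> corner_down \<or>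
    (\<exists>i\<in>{i \<in> {2..length a}. even i}. 2 * int (partial_sum (i - 1) a) \<le> 2 * int p \<and>
      2 * int p \<le> 2 * int (partial_sum (i - 1) a) + 2 * int (term_at a i) - 2)"
    unfolding F2_def by (auto simp: corner_down_def)
  also have "\<dots> \<longleftrightarrow> p \<in> corner_down \<or>
    (\<exists>i\<in>{i \<in> {2..length a}. even i}. partial_sum (i - 1) a \<le> p \<and> p < partial_sum (i - 1) a + term_at a i)"
    by (intro arg_cong2[where f = "(\<or>)"] bex_cong refl) auto
  finally show ?thesis using downs_iff[of p] by blast
qed

lemma F1_cases:
  assumes "(l, r) \<in> F1"
  shows "odd l \<and> odd r \<and> (r < int (2 * n1) \<or> r - l < 2 * int (2 * n1))"
proof -
  from assms consider "l = - 2 * int n1 - 1" "r = 2 * int (term_at a 1) - 3"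
    | "l = 2 * int (Nb + x + z) - 1" "r = 2 * int (Nb + x + y) - 3"
    | i where "i \<ge> 2" "odd i" "l = 2 * int (partial_sum (i - 1) a) - 1" "r = 2 * int (partial_sum (i - 1) a) + 2 * int (term_at a i) - 3"
    unfolding F1_def by auto
  then show ?thesis
  proof cases
    case (3 i)
    then show ?thesis using odd_term_le[of i] n1_int by auto
  qed (use Ob1 Ob_pos n1_int in auto)
qed

lemma F2_cases:
  assumes "(l, r) \<in> F2"
  shows "even l \<and> even r \<and> r - l < 2 * int (2 * n2 - 1) \<and> 1 \<le> l"
proof -
  from assms consider "l = 2 * int (Nb + x + y)" "r = 2 * int (Nb + x + z) - 2"
    | i where "i \<ge> 2" "even i" "l = 2 * int (partial_sum (i - 1) a)" "r = 2 * int (partial_sum (i - 1) a) + 2 * int (term_at a i) - 2"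
    unfolding F2_def by auto
  then show ?thesis
  proof cases
    case (2 i)
    then show ?thesis using term_at_le_even_sum[of i a] partial_sum_pos[of i] n2_int n2_pos by auto
  qed (use Ob_pos n2_int n2_pos in auto)
qed

lemma tiling_sum_upper:
  assumes "X \<subseteq> gap"
  shows "tiling_sum (\<lambda>_. 1) (upper - row (- 2 * int n1) ((\<lambda>p. 2 * int p - 1) ` X)) =
    (if card (ups \<union> corner_up \<union> X) = n1 then symp (ups \<union> corner_up \<union> X) else 0)"
proof -
  let ?o = "\<lambda>p::nat. 2 * int p - 1"
  have "tiling_sum (std_weight 1) (trap (x + Eb) (2 * n1) - (\<Union>(l, r)\<in>F1. tri_region (2 * n1) l r) - row (- int (2 * n1)) (?o ` X)) =
    tsum 1 (x + Eb) (2 * n1) (?o ` (ups \<union> corner_up) \<union> ?o ` X)"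
  proof (rule tiling_sum_remove_triangles)
    fix m
    show "m \<in> ?o ` (ups \<union> corner_up) \<longleftrightarrow> 0 \<le> m \<and> odd (m + int (2 * n1)) \<and> (\<exists>(l, r)\<in>F1. l \<le> m \<and> m \<le> r)"
    proof
      assume "m \<in> ?o ` (ups \<union> corner_up)"
      then obtain p where p: "p \<in> ups \<union> corner_up" "m = ?o p" by blast
      then have "1 \<le> p" using Ob_pos by (auto simp: ups_iff corner_up_def)
      then show "0 \<le> m \<and> odd (m + int (2 * n1)) \<and> (\<exists>(l, r)\<in>F1. l \<le> m \<and> m \<le> r)"
        using in_F1_iff[of p] p by auto
    next
      assume m: "0 \<le> m \<and> odd (m + int (2 * n1)) \<and> (\<exists>(l, r)\<in>F1. l \<le> m \<and> m \<le> r)"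
      define p where "p = nat ((m + 1) div 2)"
      have "odd m" using m by simp
      then have p: "m = ?o p" "1 \<le> p" using m unfolding p_def by (auto elim!: oddE)
      then show "m \<in> ?o ` (ups \<union> corner_up)"
        using in_F1_iff[of p] m by blast
    qed
  qed (use F1_cases in auto)
  also have "?o ` (ups \<union> corner_up) \<union> ?o ` X = ?o ` (ups \<union> corner_up \<union> X)" by blast
  also have "tsum 1 (x + Eb) (2 * n1) \<dots> =
    (if card (ups \<union> corner_up \<union> X) = n1 then symp (ups \<union> corner_up \<union> X) else 0)"
  proof (rule tsum_symp)
    show "finite (ups \<union> corner_up \<union> X)" using assms by (auto intro: finite_subset)
    have bound: "p < Nb + x + y" if "p \<in> ups \<union> corner_up \<union> X" for p
      using that subsetD[OF assms, of p] segments_lessThan[of p False a] by (auto simp: ups_def corner_up_def gap_iff)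
    show "1 \<le> p \<and> p \<le> x + Eb + n1" if "p \<in> ups \<union> corner_up \<union> X" for p
      using bound[OF that] that subsetD[OF assms, of p] Ob_pos n1_int by (auto simp: ups_iff corner_up_def gap_iff)
    show "ups \<union> corner_up \<union> X = {}" if "n1 = 0"
    proof -
      have "y = 0" "Ob = 1" using that n1_int Ob_pos by auto
      then have "card ups = 0" by (simp add: card_ups)
      then have "ups = {}" by simp
      moreover have "corner_up = {}" unfolding corner_up_def using \<open>y = 0\<close> by simp
      moreover have "gap = {}" unfolding gap_def using that by simp
      ultimately show ?thesis using assms by blast
    qed
  qed
  finally show ?thesis by (simp add: upper_def)
qed

definition "weight = zigzag_weight (path_edges W0 (H8_lower z a))"

lemma zigzag_edges:
  "(move NE p, p) \<in> set (path_edges W0 (H8_lower z a)) \<and> (p, move SE p) \<in> set (path_edges W0 (H8_lower z a)) \<longleftrightarrow>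
    (\<exists>h. 1 \<le> h \<and> h < n2 \<and> p = (int n1 - 1 + int h, - 2 * int n1 - 2 * int h))"
proof -
  obtain n' where n': "n2 = Suc n'" using n2_pos by (cases n2) auto
  then have e: "z + Eb - 1 = n'" by (simp add: n2_def)
  obtain i j where p: "p = (i, j)" by (cases p)
  have 1: "(move NE p, p) \<in> set (path_edges W0 (H8_lower z a)) \<longleftrightarrow>
      (\<exists>h<n'. p = (int n1 - 1 + int h + 1, - 2 * int n1 - 2 * int h - 2))"
    unfolding H8_lower_def e W0_def path_edges_append set_append Un_iff zigzag_east_edges by (auto simp: p)
  have 2: "(p, move SE p) \<in> set (path_edges W0 (H8_lower z a)) \<longleftrightarrow>
      (\<exists>h<Suc n'. p = (int n1 - 1 + int h, - 2 * int n1 - 2 * int h))"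
    unfolding H8_lower_def e W0_def path_edges_append set_append Un_iff zigzag_east_edges less_Suc_eq
    by (auto simp: p)
  show ?thesis
  proof
    assume "(move NE p, p) \<in> set (path_edges W0 (H8_lower z a)) \<and> (p, move SE p) \<in> set (path_edges W0 (H8_lower z a))"
    then obtain h where "h < n'" "p = (int n1 - 1 + int h + 1, - 2 * int n1 - 2 * int h - 2)"
      unfolding 1 by blast
    then show "\<exists>h. 1 \<le> h \<and> h < n2 \<and> p = (int n1 - 1 + int h, - 2 * int n1 - 2 * int h)"
      by (intro exI[of _ "Suc h"]) (auto simp: n')
  next
    assume "\<exists>h. 1 \<le> h \<and> h < n2 \<and> p = (int n1 - 1 + int h, - 2 * int n1 - 2 * int h)"
    then obtain h where h: "1 \<le> h" "h < n2" "p = (int n1 - 1 + int h, - 2 * int n1 - 2 * int h)" by blast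
    then obtain h' where h': "h = Suc h'" by (cases h) auto
    show "(move NE p, p) \<in> set (path_edges W0 (H8_lower z a)) \<and> (p, move SE p) \<in> set (path_edges W0 (H8_lower z a))"
      unfolding 1 2 using h h' n' by auto
  qed
qed

lemma weight_eq: "weight l = (if \<exists>h. 1 \<le> h \<and> h < n2 \<and> l = vert (- 2 * int n1 - 2 * int h) (- 1) then 1 / 2 else 1)"
proof -
  have "(\<exists>p. l = {Up p, Down p} \<and> (move NE p, p) \<in> set (path_edges W0 (H8_lower z a)) \<and>
      (p, move SE p) \<in> set (path_edges W0 (H8_lower z a))) \<longleftrightarrow>
    (\<exists>h. 1 \<le> h \<and> h < n2 \<and> l = vert (- 2 * int n1 - 2 * int h) (- 1))"
    unfolding zigzag_edges Up_Down_vert by force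
  then show ?thesis by (simp add: weight_def zigzag_weight_def)
qed

lemma tiling_sum_lower:
  assumes "X \<subseteq> gap"
  shows "tiling_sum weight (lower - row (- 2 * int n1 - 1) ((\<lambda>p. 2 * int p - 1) ` X)) =
    (if card (downs \<union> corner_down \<union> X) = n2 then orth (downs \<union> corner_down \<union> X) else 0)"
proof -
  let ?e = "\<lambda>p::nat. 2 * int p"
  let ?k = "2 * n2 - 1"
  let ?\<beta> = "- 2 * int n1 - 2 * int n2 + 1"
  let ?f = "flip ?\<beta> (- 1)"
  let ?R = "trap (x + Ob) ?k - (\<Union>(l, r)\<in>F2. tri_region ?k l r) - row (- int ?k) (?e ` X)"
  have k: "int ?k = 2 * int n2 - 1" using n2_pos by (simp add: of_nat_diff)
  have "?f ` row (- int ?k) (?e ` X) = row (- 2 * int n1 - 1) ((\<lambda>p. 2 * int p - 1) ` X)"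
    unfolding row_def image_image flip_tri_at k by (intro image_cong refl) simp
  then have "lower - row (- 2 * int n1 - 1) ((\<lambda>p. 2 * int p - 1) ` X) = ?f ` ?R"
    unfolding lower_def image_set_diff[OF inj_flip] by simp
  then have "tiling_sum weight (lower - row (- 2 * int n1 - 1) ((\<lambda>p. 2 * int p - 1) ` X)) =
      tiling_sum (\<lambda>l. weight (?f ` l)) ?R"
    using tiling_sum_image[of ?f weight ?R, OF inj_flip flip_lozenge_iff] by simp
  also have "\<dots> = tiling_sum (std_weight (1 / 2)) ?R"
  proof (rule tiling_sum_cong)
    fix l assume l: "l \<in> lozenges" "l \<subseteq> ?R"
    from l(1) show "weight (?f ` l) = std_weight (1 / 2) l"
    proof (cases rule: lozenge_cases)
      case (horizontal s m)
      then have "?f ` l \<noteq> vert s' m'" for s' m'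
        by (auto simp: vert_def doubleton_eq_iff)
      then show ?thesis using horizontal by (simp add: weight_eq)
    next
      case (vertical s m)
      have "tri_at s m \<in> trap (x + Ob) ?k" "tri_at (s - 1) m \<in> trap (x + Ob) ?k"
        using l(2) vertical by (auto simp: vert_def)
      then have s: "s < 0" "- int ?k \<le> s - 1" by (auto simp: trap_def)
      have "(\<exists>h. 1 \<le> h \<and> h < n2 \<and> ?f ` l = vert (- 2 * int n1 - 2 * int h) (- 1)) \<longleftrightarrow> m = 0"
      proof
        assume m: "m = 0"
        define h where "h = nat ((s + int ?k) div 2)"
        have "s = 2 * int h - int ?k" using s m vertical(1) unfolding h_def k by (auto elim!: oddE)
        then have "1 \<le> h" "h < n2" "?\<beta> - s = - 2 * int n1 - 2 * int h"
          using s vertical(1) m unfolding k by auto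
        then show "\<exists>h. 1 \<le> h \<and> h < n2 \<and> ?f ` l = vert (- 2 * int n1 - 2 * int h) (- 1)"
          unfolding vertical(2) flip_vert using m by auto
      qed (auto simp: vertical(2) flip_vert)
      then show ?thesis
        by (simp add: weight_eq vertical(2))
    qed
  qed
  also have "\<dots> = tsum (1 / 2) (x + Ob) ?k (?e ` (downs \<union> corner_down) \<union> ?e ` X)"
  proof (rule tiling_sum_remove_triangles)
    fix m
    show "m \<in> ?e ` (downs \<union> corner_down) \<longleftrightarrow> 0 \<le> m \<and> odd (m + int ?k) \<and> (\<exists>(l, r)\<in>F2. l \<le> m \<and> m \<le> r)"
    proof
      assume "m \<in> ?e ` (downs \<union> corner_down)"
      then obtain p where p: "p \<in> downs \<union> corner_down" "m = ?e p" by blast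
      then show "0 \<le> m \<and> odd (m + int ?k) \<and> (\<exists>(l, r)\<in>F2. l \<le> m \<and> m \<le> r)"
        using in_F2_iff[of p] n2_pos by auto
    next
      assume m: "0 \<le> m \<and> odd (m + int ?k) \<and> (\<exists>(l, r)\<in>F2. l \<le> m \<and> m \<le> r)"
      define p where "p = nat (m div 2)"
      have "even m" using m n2_pos unfolding k by auto
      then have p: "m = ?e p" using m unfolding p_def by auto
      then show "m \<in> ?e ` (downs \<union> corner_down)"
        using in_F2_iff[of p] m by blast
    qed
  next
    fix l r assume "(l, r) \<in> F2"
    then show "odd (l + int ?k) \<and> odd (r + int ?k) \<and> (r < int ?k \<or> r - l < 2 * int ?k) \<and> (1 / 2 = (1::real) \<or> 1 \<le> l)"
      using F2_cases[of l r] unfolding k by auto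
  qed (use n2_pos in \<open>auto simp: k\<close>)
  also have "?e ` (downs \<union> corner_down) \<union> ?e ` X = ?e ` (downs \<union> corner_down \<union> X)" by blast
  also have "tsum (1 / 2) (x + Ob) ?k \<dots> =
    (if card (downs \<union> corner_down \<union> X) = n2 then orth (downs \<union> corner_down \<union> X) else 0)"
  proof (rule tsum_orth)
    show "finite (downs \<union> corner_down \<union> X)" using assms by (auto intro: finite_subset)
    show "p < x + Ob + n2" if "p \<in> downs \<union> corner_down \<union> X" for p
      using that subsetD[OF assms, of p] segments_lessThan[of p True a]
      by (auto simp: downs_def corner_down_def gap_iff n2_def)
  qed (rule n2_pos)
  finally show ?thesis .
qed

lemma crossing_lozenges:
  "(\<lambda>p. vert (- 2 * int n1) (2 * int p - 1)) ` gap =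
    {l \<in> lozenges. l \<subseteq> upper \<union> lower \<and> l \<inter> upper \<noteq> {} \<and> l \<inter> lower \<noteq> {}}"
proof -
  let ?v = "\<lambda>p::nat. vert (- 2 * int n1) (2 * int p - 1)"
  have up: "tri_at (- 2 * int n1) (2 * int p - 1) \<in> upper \<longleftrightarrow> n1 \<noteq> 0 \<and> p < Nb + x + y \<and> p \<notin> ups \<union> corner_up"
    if "1 \<le> p" for p
    using that in_F1_iff[OF that] n1_int Ob_pos unfolding upper_def by (auto simp: trap_def tri_region_def)
  have low: "tri_at (- 2 * int n1 - 1) (2 * int p - 1) \<in> lower \<longleftrightarrow> p < Nb + x + z \<and> p \<notin> downs \<union> corner_down" for p
  proof -
    have "flip (- 2 * int n1 - 2 * int n2 + 1) (- (- 1)) (tri_at (- 2 * int n1 - 1) (2 * int p - 1)) = tri_at (- int (2 * n2 - 1)) (2 * int p)"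
      using n2_pos by (simp add: of_nat_diff)
    then show ?thesis
      using in_F2_iff[of p] n2_int n2_pos unfolding lower_def in_flip_image
      by (auto simp: trap_def tri_region_def)
  qed
  have gap: "p \<in> gap \<longleftrightarrow> tri_at (- 2 * int n1) (2 * int p - 1) \<in> upper \<and> tri_at (- 2 * int n1 - 1) (2 * int p - 1) \<in> lower"
    if "1 \<le> p" for p
  proof -
    have "p \<in> ups \<union> downs \<longleftrightarrow> p < Nb" using that by (simp add: ups_downs)
    then show ?thesis
      unfolding up[OF that] low gap_def corner_up_def corner_down_def by auto
  qed
  show ?thesis
  proof (intro equalityI subsetI)
    fix l assume "l \<in> ?v ` gap"
    then obtain p where p: "p \<in> gap" "l = ?v p" by blast
    then have "1 \<le> p" using Ob_pos by (auto simp: gap_iff)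
    then show "l \<in> {l \<in> lozenges. l \<subseteq> upper \<union> lower \<and> l \<inter> upper \<noteq> {} \<and> l \<inter> lower \<noteq> {}}"
      using gap[of p] p by (auto simp: vert_lozenge_iff) (auto simp: vert_def)
  next
    fix l assume l: "l \<in> {l \<in> lozenges. l \<subseteq> upper \<union> lower \<and> l \<inter> upper \<noteq> {} \<and> l \<inter> lower \<noteq> {}}"
    then obtain t u where tu: "t \<in> l" "t \<in> upper" "u \<in> l" "u \<in> lower" by blast
    then have st: "- 2 * int n1 \<le> strip t" "strip u < - 2 * int n1"
      by (auto simp: in_upper_iff in_lower_iff)
    have "l \<in> lozenges" using l by blast
    then show "l \<in> ?v ` gap"
    proof (cases rule: lozenge_cases)
      case (horizontal s m)
      then show ?thesis using tu st by auto
    next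
      case (vertical s m)
      then have s: "s = - 2 * int n1" "t = tri_at s m" "u = tri_at (s - 1) m"
        using tu st by (auto simp: in_vert_iff tri_eq_iff)
      have m: "0 \<le> m" "odd m" using tu(2) vertical(1) unfolding s by (auto simp: upper_def trap_def)
      define p where "p = nat ((m + 1) div 2)"
      have p: "m = 2 * int p - 1" "1 \<le> p" using m unfolding p_def by (auto elim!: oddE)
      then have "p \<in> gap" using gap[of p] tu s by simp
      then show ?thesis using vertical(2) s(1) p(1) by blast
    qed
  qed
qed

text \<open>
  For cardinality reasons every tiling has exactly \<open>min y z\<close> vertical lozenges across the line of the fern.
\<close>

theorem M_H8_eq_sum:
  "M_H8 x y z a = (\<Sum>X | X \<subseteq> {Nb..<Nb + x + min y z} \<and> card X = min y z.
     symp (ups \<union> corner_up \<union> X) * orth (downs \<union> corner_down \<union> X))"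
proof -
  let ?v = "\<lambda>p::nat. vert (- 2 * int n1) (2 * int p - 1)"
  let ?o = "\<lambda>p::nat. 2 * int p - 1"
  have inj: "inj ?v" by (auto simp: inj_def)
  have w1: "weight l = 1" if "l \<subseteq> upper" for l
  proof -
    have "strip t \<ge> - 2 * int n1" if "t \<in> l" for t
      using that \<open>l \<subseteq> upper\<close> by (auto simp: in_upper_iff)
    then have "l \<noteq> vert (- 2 * int n1 - 2 * int h) (- 1)" if "1 \<le> h" for h
      using that by (force simp: vert_def)
    then show ?thesis by (auto simp: weight_eq)
  qed
  have "M_H8 x y z a = tiling_sum weight (upper \<union> lower)"
    unfolding M_H8_def Let_def endpoint_upper weight_def region_split ..
  also have "\<dots> = (\<Sum>X\<in>Pow (?v ` gap). (\<Prod>l\<in>X. weight l) * tiling_sum weight (upper - \<Union>X) * tiling_sum weight (lower - \<Union>X))"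
  proof (rule tiling_sum_cut[OF crossing_lozenges])
    show "finite upper" "finite lower" by (simp_all add: upper_def lower_def)
    show "upper \<inter> lower = {}" by (auto simp: in_upper_iff in_lower_iff)
    show "disjoint (?v ` gap)" by (auto simp: disjoint_def in_vert_iff)
  qed
  also have "\<dots> = (\<Sum>X\<in>Pow gap. (\<Prod>l\<in>?v ` X. weight l) * tiling_sum weight (upper - \<Union>(?v ` X)) * tiling_sum weight (lower - \<Union>(?v ` X)))"
    unfolding image_Pow_surj[OF refl, symmetric]
    by (subst sum.reindex[OF inj_on_image_Pow]) (use inj in \<open>auto intro: inj_on_subset\<close>)
  also have "\<dots> = (\<Sum>X\<in>Pow gap. (if card (ups \<union> corner_up \<union> X) = n1 then symp (ups \<union> corner_up \<union> X) else 0) *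
      (if card (downs \<union> corner_down \<union> X) = n2 then orth (downs \<union> corner_down \<union> X) else 0))"
  proof (intro sum.cong refl)
    fix X assume "X \<in> Pow gap"
    then have X: "X \<subseteq> gap" by simp
    have 1: "(\<Prod>l\<in>?v ` X. weight l) = 1"
      by (intro prod.neutral) (auto simp: weight_eq)
    have 2: "upper - \<Union>(?v ` X) = upper - row (- 2 * int n1) (?o ` X)"
      by (auto simp: in_vert_iff in_row_iff in_upper_iff)
    have 3: "lower - \<Union>(?v ` X) = lower - row (- 2 * int n1 - 1) (?o ` X)"
      by (auto simp: in_vert_iff in_row_iff in_lower_iff)
    have 4: "tiling_sum weight (upper - row (- 2 * int n1) (?o ` X)) = tiling_sum (\<lambda>_. 1) (upper - row (- 2 * int n1) (?o ` X))"
      by (rule tiling_sum_cong) (use w1 in auto)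
    show "(\<Prod>l\<in>?v ` X. weight l) * tiling_sum weight (upper - \<Union>(?v ` X)) * tiling_sum weight (lower - \<Union>(?v ` X)) =
      (if card (ups \<union> corner_up \<union> X) = n1 then symp (ups \<union> corner_up \<union> X) else 0) *
      (if card (downs \<union> corner_down \<union> X) = n2 then orth (downs \<union> corner_down \<union> X) else 0)"
      unfolding 1 2 3 4 tiling_sum_upper[OF X] tiling_sum_lower[OF X] by simp
  qed
  also have "\<dots> = (\<Sum>X\<in>{X \<in> Pow gap. card X = min y z}.
      symp (ups \<union> corner_up \<union> X) * orth (downs \<union> corner_down \<union> X))"
  proof (rule sum.mono_neutral_cong_right)
    have cards: "card (ups \<union> corner_up \<union> X) = Ob - 1 + (y - z) + card X"
      "card (downs \<union> corner_down \<union> X) = Eb + (z - y) + card X" if "X \<in> Pow gap" for X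
    proof -
      have X: "finite X" "X \<subseteq> {Nb..<Nb + x + min y z}"
        using that by (auto simp: gap_def split: if_splits intro: finite_subset)
      have lt: "p < Nb" if "p \<in> ups \<union> downs" for p
        using that by (simp add: ups_downs)
      have "ups \<inter> corner_up = {}" "(ups \<union> corner_up) \<inter> X = {}" "downs \<inter> corner_down = {}" "(downs \<union> corner_down) \<inter> X = {}"
        using lt X(2) by (fastforce simp: corner_up_def corner_down_def)+
      then show "card (ups \<union> corner_up \<union> X) = Ob - 1 + (y - z) + card X"
        "card (downs \<union> corner_down \<union> X) = Eb + (z - y) + card X"
        using X(1) by (simp_all add: card_Un_disjoint card_ups card_downs corner_up_def corner_down_def)
    qed
    show "\<forall>X\<in>Pow gap - {X \<in> Pow gap. card X = min y z}.
      (if card (ups \<union> corner_up \<union> X) = n1 then symp (ups \<union> corner_up \<union> X) else 0) *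
      (if card (downs \<union> corner_down \<union> X) = n2 then orth (downs \<union> corner_down \<union> X) else 0) = 0"
      using cards Ob_pos by (auto simp: n1_def n2_def)
    show "(if card (ups \<union> corner_up \<union> X) = n1 then symp (ups \<union> corner_up \<union> X) else 0) *
      (if card (downs \<union> corner_down \<union> X) = n2 then orth (downs \<union> corner_down \<union> X) else 0) =
      symp (ups \<union> corner_up \<union> X) * orth (downs \<union> corner_down \<union> X)"
      if "X \<in> {X \<in> Pow gap. card X = min y z}" for X
    proof -
      have "card (ups \<union> corner_up \<union> X) = n1" "card (downs \<union> corner_down \<union> X) = n2"
        using cards[of X] that Ob_pos unfolding n1_def n2_def min_def by (auto split: if_splits)
      then show ?thesis by simp
    qed
  qed auto
  also have "{X \<in> Pow gap. card X = min y z} = {X. X \<subseteq> {Nb..<Nb + x + min y z} \<and> card X = min y z}"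
  proof (cases "n1 = 0")
    case True
    then have "y = 0" using n1_int Ob_pos by auto
    have "X = {}" if "X \<subseteq> {Nb..<Nb + x + min y z}" "card X = min y z" for X
      using that finite_subset[OF that(1)] \<open>y = 0\<close> by auto
    moreover have "gap = {}" unfolding gap_def using True by simp
    ultimately show ?thesis using \<open>y = 0\<close> by auto
  qed (auto simp: gap_def)
  finally show ?thesis .
qed

end

section \<open>Factoring the sum over the crossing positions\<close>

text \<open>
  The factors of a Vandermonde product that link \<open>A\<close> to \<open>B\<close>, for \<open>B\<close> to the right of \<open>A\<close>.
\<close>

definition cross :: "nat set \<Rightarrow> nat set \<Rightarrow> real" where
  "cross A B = (\<Prod>p\<in>A. \<Prod>q\<in>B. (real q)^2 - (real p)^2)"

text \<open>
  The denominators of \<open>symp\<close> and \<open>orth\<close>.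
\<close>

definition norm1 :: "nat \<Rightarrow> real" where "norm1 n = (\<Prod>j<n. fact (2 * j + 1))"
definition norm2 :: "nat \<Rightarrow> real" where "norm2 n = (\<Prod>j<n. fact (2 * j))"

lemma norm_nonzero [simp]: "norm1 n \<noteq> 0" "norm2 n \<noteq> 0"
  by (simp_all add: norm1_def norm2_def)

lemma cross_union_left:
  assumes "finite A" "finite B" "A \<inter> B = {}"
  shows "cross (A \<union> B) C = cross A C * cross B C"
  unfolding cross_def using assms by (rule prod.union_disjoint)

lemma cross_union_right:
  assumes "finite B" "finite C" "B \<inter> C = {}"
  shows "cross A (B \<union> C) = cross A B * cross A C"
  unfolding cross_def by (simp add: prod.union_disjoint[OF assms] prod.distrib)

lemma cross_empty [simp]: "cross {} B = 1" "cross A {} = 1"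
  by (simp_all add: cross_def)

lemma cross_nonzero:
  assumes "finite A" "finite B" "\<And>p q. p \<in> A \<Longrightarrow> q \<in> B \<Longrightarrow> p < q"
  shows "cross A B \<noteq> 0"
proof -
  have "(real q)^2 - (real p)^2 \<noteq> 0" if "p \<in> A" "q \<in> B" for p q
    using assms(3)[OF that] by (simp add: power2_eq_iff_nonneg)
  then show ?thesis
    unfolding cross_def using assms(1,2) by auto
qed

lemma vdm_nonzero: "finite A \<Longrightarrow> vdm A \<noteq> 0"
  unfolding vdm_def by (auto simp: power2_eq_iff_nonneg)

lemma vdm_union:
  assumes "finite A" "finite B" "\<And>p q. p \<in> A \<Longrightarrow> q \<in> B \<Longrightarrow> p < q"
  shows "vdm (A \<union> B) = vdm A * vdm B * cross A B"
proof -
  have disj: "A \<inter> B = {}" using assms(3) by fastforce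
  have 1: "{p \<in> A \<union> B. p < q} = {p \<in> A. p < q}" if "q \<in> A" for q
    using that assms(3) by fastforce
  have 2: "{p \<in> A \<union> B. p < q} = A \<union> {p \<in> B. p < q}" if "q \<in> B" for q
    using that assms(3) by auto
  have "vdm (A \<union> B) = (\<Prod>q\<in>A. \<Prod>p\<in>{p \<in> A \<union> B. p < q}. (real q)^2 - (real p)^2) *
      (\<Prod>q\<in>B. \<Prod>p\<in>{p \<in> A \<union> B. p < q}. (real q)^2 - (real p)^2)"
    unfolding vdm_def by (rule prod.union_disjoint[OF assms(1,2) disj])
  also have "(\<Prod>q\<in>A. \<Prod>p\<in>{p \<in> A \<union> B. p < q}. (real q)^2 - (real p)^2) = vdm A"
    unfolding vdm_def by (simp only: 1 cong: prod.cong)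
  also have "(\<Prod>q\<in>B. \<Prod>p\<in>{p \<in> A \<union> B. p < q}. (real q)^2 - (real p)^2) =
      (\<Prod>q\<in>B. (\<Prod>p\<in>A. (real q)^2 - (real p)^2) * (\<Prod>p\<in>{p \<in> B. p < q}. (real q)^2 - (real p)^2))"
  proof (rule prod.cong[OF refl])
    fix q assume q: "q \<in> B"
    have "A \<inter> {p \<in> B. p < q} = {}" using disj by blast
    then show "(\<Prod>p\<in>{p \<in> A \<union> B. p < q}. (real q)^2 - (real p)^2) =
        (\<Prod>p\<in>A. (real q)^2 - (real p)^2) * (\<Prod>p\<in>{p \<in> B. p < q}. (real q)^2 - (real p)^2)"
      unfolding 2[OF q] by (intro prod.union_disjoint) (use assms in auto)
  qed
  also have "\<dots> = (\<Prod>q\<in>B. \<Prod>p\<in>A. (real q)^2 - (real p)^2) * vdm B"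
    by (simp add: prod.distrib vdm_def)
  also have "(\<Prod>q\<in>B. \<Prod>p\<in>A. (real q)^2 - (real p)^2) = cross A B"
    unfolding cross_def by (rule prod.swap)
  finally show ?thesis by simp
qed

lemma symp_union:
  assumes "finite A" "finite B" "\<And>p q. p \<in> A \<Longrightarrow> q \<in> B \<Longrightarrow> p < q"
  shows "symp (A \<union> B) = (\<Prod>p\<in>A. real p) * (\<Prod>p\<in>B. real p) * vdm A * vdm B * cross A B / norm1 (card A + card B)"
proof -
  have disj: "A \<inter> B = {}" using assms(3) by fastforce
  have v: "vdm (A \<union> B) = vdm A * vdm B * cross A B"
    by (rule vdm_union) (use assms in auto)
  show ?thesis
    unfolding symp_def norm1_def v card_Un_disjoint[OF assms(1,2) disj] prod.union_disjoint[OF assms(1,2) disj]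
    by simp
qed

lemma orth_union:
  assumes "finite A" "finite B" "\<And>p q. p \<in> A \<Longrightarrow> q \<in> B \<Longrightarrow> p < q"
  shows "orth (A \<union> B) = vdm A * vdm B * cross A B / norm2 (card A + card B)"
proof -
  have disj: "A \<inter> B = {}" using assms(3) by fastforce
  have v: "vdm (A \<union> B) = vdm A * vdm B * cross A B"
    by (rule vdm_union) (use assms in auto)
  show ?thesis
    unfolding orth_def norm2_def v card_Un_disjoint[OF assms(1,2) disj]
    by simp
qed

text \<open>
  What the sum over the crossing positions becomes when all factors not containing them are
  taken out. The product over \<open>{1..<N}\<close> comes from both kinds of triangles of the fern, so that only their total
  width \<open>N\<close> matters. At most one of the last two factors differs from 1.
\<close>

definition gap_sum :: "nat \<Rightarrow> nat \<Rightarrow> nat \<Rightarrow> nat \<Rightarrow> real" where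
  "gap_sum N x y z = (\<Sum>X | X \<subseteq> {N..<N + x + min y z} \<and> card X = min y z.
     (\<Prod>p\<in>X. real p) * (vdm X)^2 * cross {1..<N} X *
     cross X {N + x + z..<N + x + y} * cross X {N + x + y..<N + x + z})"

lemma (in halved_hexagon) M_H8_factored:
  "M_H8 x y z a =
    (\<Prod>p\<in>ups. real p) * vdm ups * vdm downs * cross ups corner_up * cross downs corner_down *
    ((\<Prod>p\<in>corner_up. real p) * vdm corner_up * vdm corner_down * gap_sum Nb x y z / (norm1 n1 * norm2 n2))"
proof -
  let ?c = "(\<Prod>p\<in>ups. real p) * vdm ups * vdm downs * cross ups corner_up * cross downs corner_down"
  let ?d = "(\<Prod>p\<in>corner_up. real p) * vdm corner_up * vdm corner_down"
  have "symp (ups \<union> corner_up \<union> X) * orth (downs \<union> corner_down \<union> X) =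
     ?c * (?d * ((\<Prod>p\<in>X. real p) * (vdm X)^2 * cross {1..<Nb} X * cross X corner_up * cross X corner_down) / (norm1 n1 * norm2 n2))"
    if X: "X \<subseteq> {Nb..<Nb + x + min y z}" "card X = min y z" for X
  proof -
    have fX: "finite X" using X(1) by (rule finite_subset) simp
    have lt: "p < q" if "p \<in> ups \<union> downs" "q \<in> X \<union> corner_up \<union> corner_down" for p q
      using that X(1) unfolding ups_downs(1) by (auto simp: corner_up_def corner_down_def)
    have lt2: "p < q" if "p \<in> X" "q \<in> corner_up \<union> corner_down" for p q
      using that X(1) by (auto simp: corner_up_def corner_down_def)
    have c1: "card ups + (card X + card corner_up) = n1"
      using X(2) Ob_pos by (simp add: card_ups corner_up_def n1_def min_def)
    have c2: "card downs + (card X + card corner_down) = n2"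
      using X(2) by (simp add: card_downs corner_down_def n2_def min_def)
    have dj: "X \<inter> corner_up = {}" "X \<inter> corner_down = {}"
      using lt2 by fastforce+
    have "symp (ups \<union> (X \<union> corner_up)) = (\<Prod>p\<in>ups. real p) * (\<Prod>p\<in>X \<union> corner_up. real p) * vdm ups *
        vdm (X \<union> corner_up) * cross ups (X \<union> corner_up) / norm1 (card ups + card (X \<union> corner_up))"
      by (rule symp_union) (use fX lt in auto)
    also have "card ups + card (X \<union> corner_up) = n1"
      using fX c1 by (simp add: card_Un_disjoint dj)
    also have "(\<Prod>p\<in>ups. real p) * (\<Prod>p\<in>X \<union> corner_up. real p) * vdm ups * vdm (X \<union> corner_up) * cross ups (X \<union> corner_up) / norm1 n1 = (\<Prod>p\<in>ups. real p) * ((\<Prod>p\<in>X. real p) * (\<Prod>p\<in>corner_up. real p)) * vdm ups *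
        (vdm X * vdm corner_up * cross X corner_up) * (cross ups X * cross ups corner_up) / norm1 n1"
      using fX lt2 by (simp add: prod.union_disjoint[OF fX _ dj(1)] vdm_union cross_union_right dj)
    finally have s: "symp (ups \<union> corner_up \<union> X) = (\<Prod>p\<in>ups. real p) * ((\<Prod>p\<in>X. real p) * (\<Prod>p\<in>corner_up. real p)) * vdm ups *
        (vdm X * vdm corner_up * cross X corner_up) * (cross ups X * cross ups corner_up) / norm1 n1"
      by (simp add: Un_ac)
    have "orth (downs \<union> (X \<union> corner_down)) = vdm downs * vdm (X \<union> corner_down) * cross downs (X \<union> corner_down) /
        norm2 (card downs + card (X \<union> corner_down))"
      by (rule orth_union) (use fX lt in auto)
    also have "card downs + card (X \<union> corner_down) = n2"
      using fX c2 by (simp add: card_Un_disjoint dj)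
    also have "vdm downs * vdm (X \<union> corner_down) * cross downs (X \<union> corner_down) / norm2 n2 =
        vdm downs * (vdm X * vdm corner_down * cross X corner_down) * (cross downs X * cross downs corner_down) / norm2 n2"
      using fX lt2 by (simp add: vdm_union cross_union_right dj)
    finally have o: "orth (downs \<union> corner_down \<union> X) =
        vdm downs * (vdm X * vdm corner_down * cross X corner_down) * (cross downs X * cross downs corner_down) / norm2 n2"
      by (simp add: Un_ac)
    have "cross {1..<Nb} X = cross ups X * cross downs X"
      unfolding ups_downs(1)[symmetric] by (rule cross_union_left) (simp_all add: ups_downs(2))
    then show ?thesis
      unfolding s o by (simp add: field_simps power2_eq_square)
  qed
  then have "M_H8 x y z a = (\<Sum>X | X \<subseteq> {Nb..<Nb + x + min y z} \<and> card X = min y z.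
     ?c * (?d * ((\<Prod>p\<in>X. real p) * (vdm X)^2 * cross {1..<Nb} X * cross X corner_up * cross X corner_down) / (norm1 n1 * norm2 n2)))"
    unfolding M_H8_eq_sum by (intro sum.cong refl) auto
  then show ?thesis
    by (simp only: sum_distrib_left[symmetric] sum_divide_distrib[symmetric] gap_sum_def corner_up_def corner_down_def)
qed

section \<open>Products of rising factorials\<close>

text \<open>
  The conventions for negative \<open>n\<close> are such that a rising factorial is a quotient of factorials
  whenever these are defined.
\<close>

lemma rising_fact:
  assumes "int v + n \<ge> 0"
  shows "rising (real (Suc v)) n = fact (nat (int v + n)) / fact v"
proof (cases "n \<ge> 0")
  case True
  have "(\<Prod>j<k. real (Suc v) + real j) * fact v = fact (v + k)" for k
  proof (induction k)
    case (Suc k)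
    have "(\<Prod>j<Suc k. real (Suc v) + real j) * fact v =
        ((\<Prod>j<k. real (Suc v) + real j) * fact v) * real (Suc (v + k))"
      by (simp add: algebra_simps)
    then show ?case unfolding Suc by simp
  qed simp
  then have "(\<Prod>j<k. real (Suc v) + real j) = fact (v + k) / fact v" for k
    by (simp add: eq_divide_eq)
  then show ?thesis using True by (simp add: rising_def nat_add_distrib)
next
  case False
  have *: "(\<Prod>j = 1..k. real (Suc v) - real j) * fact (v - k) = fact v" if "k \<le> v" for k
    using that
  proof (induction k)
    case (Suc k)
    have 1: "fact (v - k) = real (v - k) * fact (v - Suc k)"
      using Suc.prems by (simp add: fact_reduce)
    have 2: "real (Suc v) - real (Suc k) = real (v - k)"
      using Suc.prems by (simp add: of_nat_diff)
    have 3: "(\<Prod>j = 1..Suc k. real (Suc v) - real j) = (\<Prod>j = 1..k. real (Suc v) - real j) * (real (Suc v) - real (Suc k))"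
      by simp
    have "(\<Prod>j = 1..Suc k. real (Suc v) - real j) * fact (v - Suc k) =
        (\<Prod>j = 1..k. real (Suc v) - real j) * fact (v - k)"
      unfolding 1 3 2 by (simp only: mult.assoc)
    then show ?case using Suc.IH Suc.prems by (simp only: Suc_leD)
  qed simp
  have "(\<Prod>j = 1..k. real (Suc v) - real j) = fact v / fact (v - k)" if "k \<le> v" for k
    using *[OF that] by (simp add: eq_divide_eq)
  from this[of "nat (- n)"] show ?thesis
    using False assms by (simp add: rising_def nat_diff_distrib[symmetric] nat_minus_as_int)
qed

lemma prod_rev: "(\<Prod>j<n. f j) = (\<Prod>j<n. f (n - 1 - j))" for n :: nat
  using prod.nat_diff_reindex[of f n] by simp

text \<open>
  The factors with the larger arguments are met in reversed order.
\<close>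

lemma T_fact:
  "T (real (Suc v)) (int r + int n - 1) n = (\<Prod>j<n. fact (v + r + j) / fact (v + j))"
proof -
  have "T (real (Suc v)) (int r + int n - 1) n =
      (\<Prod>i<n. fact (v + r + (n - 1 - i)) / fact (v + i))"
    unfolding T_def
  proof (rule prod.cong[OF refl])
    fix i assume "i \<in> {..<n}"
    then have i: "i < n" by simp
    have "rising (real (Suc v) + real i) (int r + int n - 1 - 2 * int i) =
        rising (real (Suc (v + i))) (int r + int n - 1 - 2 * int i)"
      by (simp add: add_ac)
    also have "\<dots> = fact (nat (int (v + i) + (int r + int n - 1 - 2 * int i))) / fact (v + i)"
      by (rule rising_fact) (use i in linarith)
    also have "nat (int (v + i) + (int r + int n - 1 - 2 * int i)) = v + r + (n - 1 - i)"
      using i by linarith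
    finally show "rising (real (Suc v) + real i) (int r + int n - 1 - 2 * int i) =
        fact (v + r + (n - 1 - i)) / fact (v + i)" .
  qed
  also have "\<dots> = (\<Prod>j<n. fact (v + r + j)) / (\<Prod>j<n. fact (v + j))"
    unfolding prod_dividef using prod_rev[of "\<lambda>j. fact (v + r + j) :: real" n] by simp
  finally show ?thesis by (simp add: prod_dividef)
qed

section \<open>Segments of modified sequences\<close>

lemma term_at_Cons: "term_at (u # t) i = (if i = 1 then u else if i = 0 then 0 else term_at t (i - 1))"
proof (cases "i \<le> 1")
  case False
  then obtain n where "i = Suc (Suc n)" by (metis Suc_pred not_less_eq_eq le0 One_nat_def not0_implies_Suc)
  then show ?thesis by (simp add: term_at_def)
qed (auto simp: term_at_def le_Suc_eq)

lemma partial_sum_Cons: "partial_sum (Suc i) (u # t) = u + partial_sum i t"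
  by (induction i) (simp_all add: term_at_Cons)

lemma segments_Cons: "segments b (u # t) = (if b then {} else {..<u}) \<union> (+) u ` segments (\<not> b) t"
proof -
  have I: "{i \<in> {1..length (u # t)}. even i = b} =
      (if b then {} else {1}) \<union> Suc ` {i \<in> {1..length t}. even i = (\<not> b)}"
  proof (intro equalityI subsetI)
    fix i assume i: "i \<in> {i \<in> {1..length (u # t)}. even i = b}"
    then obtain j where "i = Suc j" by (cases i) auto
    then show "i \<in> (if b then {} else {1}) \<union> Suc ` {i \<in> {1..length t}. even i = (\<not> b)}"
      using i by (cases "j = 0") auto
  qed (auto split: if_splits)
  have "partial_sum (Suc 0 - 1) (u # t) = 0" "partial_sum (Suc 0) (u # t) = u"
    using partial_sum_Cons[of 0 u t] by simp_all
  moreover have "{partial_sum (Suc i - 1) (u # t)..<partial_sum (Suc i) (u # t)} =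
      (+) u ` {partial_sum (i - 1) t..<partial_sum i t}" if "i \<ge> 1" for i
    using that partial_sum_Cons[of "i - 1" u t] partial_sum_Cons[of i u t] by (cases i) (auto simp: add.commute)
  ultimately show ?thesis
    unfolding segments_def I UN_Un by (auto simp: image_UN)
qed

lemma term_at_append1: "i \<le> length t \<Longrightarrow> term_at (t @ t') i = term_at t i"
  by (auto simp: term_at_def nth_append)

lemma partial_sum_append1: "i \<le> length t \<Longrightarrow> partial_sum i (t @ t') = partial_sum i t"
  unfolding partial_sum_def by (intro sum.cong) (auto simp: term_at_append1)

lemma segments_snoc:
  "segments b (t @ [u]) = segments b t \<union>
    (if odd (length t) = b then {partial_sum (length t) t..<partial_sum (length t) t + u} else {})"
proof -
  have I: "{i \<in> {1..length (t @ [u])}. even i = b} =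
      {i \<in> {1..length t}. even i = b} \<union> (if odd (length t) = b then {Suc (length t)} else {})"
    by (auto simp: le_Suc_eq)
  have eq: "{partial_sum (i - 1) (t @ [u])..<partial_sum i (t @ [u])} = {partial_sum (i - 1) t..<partial_sum i t}"
    if "i \<in> {i \<in> {1..length t}. even i = b}" for i
  proof -
    have "i - 1 \<le> length t" "i \<le> length t" using that by auto
    then show ?thesis by (simp only: partial_sum_append1)
  qed
  have "(\<Union>i\<in>{i \<in> {1..length t}. even i = b}. {partial_sum (i - 1) (t @ [u])..<partial_sum i (t @ [u])}) = segments b t"
    unfolding segments_def by (rule SUP_cong[OF refl eq])
  moreover have "{partial_sum (Suc (length t) - 1) (t @ [u])..<partial_sum (Suc (length t)) (t @ [u])} =
      {partial_sum (length t) t..<partial_sum (length t) t + u}"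
    by (simp add: partial_sum_append1) (simp add: term_at_def)
  ultimately show ?thesis
    unfolding segments_def[of b "t @ [u]"] I UN_Un by simp
qed

context halved_hexagon
begin

lemma nonempty: "a \<noteq> []"
  using a1 by (auto simp: term_at_def)

lemma total: "partial_sum (length a) a = Nb"
  using even_sum_plus_odd_sum[of a] by simp

lemma Q_modified:
  assumes "even (length a)"
  shows "Q ([0, term_at a 1 - 1] @ tl a @ [y]) = symp (ups \<union> {Nb..<Nb + y})"
proof -
  define u t where "u = hd a" and "t = tl a"
  have a: "a = u # t" using nonempty by (simp add: u_def t_def)
  have u: "term_at a 1 = u" "u \<ge> 1" using a1 by (simp_all add: a term_at_Cons)
  have odd: "odd (length t)" using assms by (simp add: a)
  have tot: "u + partial_sum (length t) t = Nb" using total partial_sum_Cons[of "length t" u t] by (simp add: a)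
  define W where "W = {partial_sum (length t) t..<partial_sum (length t) t + y}"
  have "segments True (t @ [y]) = segments True t \<union> W"
    using segments_snoc[of True t y] odd by (simp add: W_def)
  then have "segments True (0 # (u - 1) # t @ [y]) = {..<u - 1} \<union> (+) (u - 1) ` (segments True t \<union> W)"
    by (simp add: segments_Cons)
  moreover have "Suc ` {..<u - 1} = {1..<u}" using u(2) by (auto simp: image_iff Suc_le_eq gr0_conv_Suc)
  moreover have "Suc ` (+) (u - 1) ` S = (+) u ` S" for S
    using u(2) by (simp add: image_image)
  ultimately have "Suc ` segments True (0 # (u - 1) # t @ [y]) = {1..<u} \<union> (+) u ` segments True t \<union> (+) u ` W"
    by (simp only: image_Un Un_assoc)
  also have "(+) u ` W = {Nb..<Nb + y}"
  proof -
    have e: "partial_sum (length t) t + u = Nb" "partial_sum (length t) t + y + u = Nb + y"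
      using tot by linarith+
    show ?thesis unfolding W_def by (simp add: e)
  qed
  also have "{1..<u} \<union> (+) u ` segments True t = ups"
  proof -
    have "segments False a = {..<u} \<union> (+) u ` segments True t"
      by (subst a) (simp add: segments_Cons)
    then have "ups = ({..<u} - {0}) \<union> ((+) u ` segments True t - {0})"
      by (simp only: ups_def Un_Diff)
    moreover have "(+) u ` segments True t - {0} = (+) u ` segments True t"
      using u(2) by auto
    moreover have "{..<u} - {0} = {1..<u}"
      by auto
    ultimately show ?thesis by (simp only:)
  qed
  finally show ?thesis
    using u by (simp add: Q_eq_symp t_def)
qed

lemma K'_modified:
  assumes "even (length a)"
  shows "K' (butlast a @ [term_at a (length a) + z]) = orth (downs \<union> {Nb..<Nb + z})"
proof -
  define u t where "u = last a" and "t = butlast a"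
  have a: "a = t @ [u]" using nonempty by (simp add: u_def t_def)
  have u: "term_at a (length a) = u" by (simp add: a term_at_def)
  have odd: "odd (length t)" using assms by (simp add: a)
  have "partial_sum (length (t @ [u])) (t @ [u]) = partial_sum (length t) t + u"
    by (simp add: partial_sum_append1) (simp add: term_at_def)
  then have tot: "partial_sum (length t) t + u = Nb" using total by (simp add: a)
  have "segments True (t @ [u + z]) = segments True t \<union> {partial_sum (length t) t..<partial_sum (length t) t + (u + z)}"
    using segments_snoc[of True t "u + z"] odd by simp
  also have "{partial_sum (length t) t..<partial_sum (length t) t + (u + z)} =
      {partial_sum (length t) t..<partial_sum (length t) t + u} \<union> {Nb..<Nb + z}"
    using tot by auto
  finally have new: "segments True (t @ [u + z]) = segments True t \<union>
      ({partial_sum (length t) t..<partial_sum (length t) t + u} \<union> {Nb..<Nb + z})" .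
  then have seg: "segments True (t @ [u + z]) = downs \<union> {Nb..<Nb + z}"
  proof -
    have "downs = segments True t \<union> {partial_sum (length t) t..<partial_sum (length t) t + u}"
      unfolding downs_def by (subst a) (use segments_snoc[of True t u] odd in simp)
    then show ?thesis by (simp only: new Un_assoc)
  qed
  have "downs \<inter> {Nb..<Nb + z} = {}"
  proof -
    have "q < Nb" if "q \<in> ups \<union> downs" for q
      using that unfolding ups_downs(1) by simp
    then show ?thesis by force
  qed
  then have "card (downs \<union> {Nb..<Nb + z}) = Eb + z"
    by (simp add: card_Un_disjoint card_downs)
  then have "even_sum (t @ [u + z]) \<ge> 1"
    using zE card_segments_True[of "t @ [u + z]"] unfolding seg by simp
  moreover have "term_at (t @ [u + z]) 1 \<ge> 1"
  proof -
    have "1 \<le> length t" using odd by (cases t) auto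
    then show ?thesis using a1 by (simp add: a term_at_append1)
  qed
  ultimately have "K' (t @ [u + z]) = orth (segments True (t @ [u + z]))"
    by (rule K'_eq_orth)
  then show ?thesis
    unfolding u seg by (simp add: t_def)
qed

end

section \<open>The dependence on the shape of the fern\<close>

text \<open>
  This is made such that \<open>ph N w q / ph N u q\<close> is the product of \<open>r\<^sup>2 - q\<^sup>2\<close> over \<open>N + u \<le> r < N + w\<close>.
\<close>

definition ph :: "nat \<Rightarrow> nat \<Rightarrow> nat \<Rightarrow> real" where
  "ph N w q = fact (N + w - 1 - q) * fact (N + w - 1 + q)"

lemma ph_nonzero [simp]: "ph N w q \<noteq> 0"
  by (simp add: ph_def)

lemma ph_Suc:
  assumes "q < N"
  shows "ph N (Suc w) q = ((real (N + w))^2 - (real q)^2) * ph N w q"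
proof -
  obtain d where N: "N = Suc (q + d)" using assms less_iff_Suc_add by auto
  have "N + Suc w - 1 - q = Suc (d + w)" "N + w - 1 - q = d + w"
    "N + Suc w - 1 + q = Suc (d + w + 2 * q)" "N + w - 1 + q = d + w + 2 * q"
    using N by simp_all
  then show ?thesis
    unfolding ph_def by (simp add: N power2_eq_square algebra_simps)
qed

lemma prod_run_squares:
  assumes "q < N"
  shows "(\<Prod>r\<in>{N + u..<N + u + n}. (real r)^2 - (real q)^2) = ph N (u + n) q / ph N u q"
proof (induction n)
  case (Suc n)
  have "{N + u..<N + u + Suc n} = insert (N + (u + n)) {N + u..<N + u + n}" by auto
  then show ?case
    using Suc ph_Suc[OF assms, of "u + n"] by simp
qed simp

lemma cross_run:
  assumes "finite A" "\<And>q. q \<in> A \<Longrightarrow> q < N" "u \<le> v"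
  shows "cross A {N + u..<N + v} = (\<Prod>q\<in>A. ph N v q / ph N u q)"
proof -
  obtain n where v: "v = u + n" using assms(3) le_iff_add by blast
  show ?thesis
    unfolding cross_def v using assms(1,2) prod_run_squares[of _ N u n]
    by (intro prod.cong refl) (simp add: add.assoc)
qed

text \<open>
  The contribution of a piece \<open>q\<close> in an odd segment.
\<close>

definition psi :: "nat \<Rightarrow> nat \<Rightarrow> nat \<Rightarrow> nat \<Rightarrow> nat \<Rightarrow> real" where
  "psi N x y z q = ph N (x + y) q * ph N z q / (ph N (x + z) q * ph N y q)"

lemma psi_nonzero [simp]: "psi N x y z q \<noteq> 0"
  by (simp add: psi_def)

text \<open>
  The factor that is the same for all ferns of total width \<open>N\<close>.
\<close>

definition fern_factor :: "nat \<Rightarrow> nat \<Rightarrow> nat \<Rightarrow> nat \<Rightarrow> real" where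
  "fern_factor N x y z =
    cross {1..<N} {N + x + y..<N + x + z} * (\<Prod>p\<in>{N + x + z..<N + x + y}. real p) *
    vdm {N + x + z..<N + x + y} * vdm {N + x + y..<N + x + z} * gap_sum N x y z /
    ((\<Prod>p\<in>{N..<N + y}. real p) * vdm {N..<N + y} * vdm {N..<N + z} * cross {1..<N} {N..<N + z})"

lemma (in halved_hexagon) M_H8_product:
  "M_H8 x y z a = symp (ups \<union> {Nb..<Nb + y}) * orth (downs \<union> {Nb..<Nb + z}) *
     (\<Prod>q\<in>ups. psi Nb x y z q) * fern_factor Nb x y z"
proof -
  let ?I = "{1..<Nb}" and ?Y = "{Nb..<Nb + y}" and ?Z = "{Nb..<Nb + z}"
  have ltI: "q < Nb" if "q \<in> ups \<union> downs" for q using that unfolding ups_downs(1) by simp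
  have split: "cross ?I W = cross ups W * cross downs W" for W
    unfolding ups_downs(1)[symmetric] by (rule cross_union_left) (simp_all add: ups_downs(2))
  have nz: "cross ups W \<noteq> 0" "cross downs W \<noteq> 0" "cross ?I W \<noteq> 0" if "finite W" "\<And>r. r \<in> W \<Longrightarrow> Nb \<le> r" for W
    using that ltI by (intro cross_nonzero; force)+
  have ratio: "cross ups {Nb + u..<Nb + v} / cross ups {Nb + v..<Nb + u} = (\<Prod>q\<in>ups. ph Nb v q / ph Nb u q)" for u v
  proof (cases "u \<le> v")
    case True
    then show ?thesis using cross_run[of ups Nb u v] ltI by simp
  next
    case False
    then have "cross ups {Nb + u..<Nb + v} / cross ups {Nb + v..<Nb + u} = 1 / (\<Prod>q\<in>ups. ph Nb u q / ph Nb v q)"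
      using cross_run[of ups Nb v u] ltI by simp
    then show ?thesis by (simp add: prod_dividef)
  qed
  have "cross ups corner_up * cross downs corner_down = cross ?I corner_down * (cross ups corner_up / cross ups corner_down)"
    using split[of corner_down] nz(1)[of corner_down] by (simp add: corner_down_def)
  also have "cross ups corner_up / cross ups corner_down = (\<Prod>q\<in>ups. ph Nb (x + y) q / ph Nb (x + z) q)"
    using ratio[of "x + z" "x + y"] by (simp add: corner_up_def corner_down_def add.assoc)
  also have "\<dots> = (\<Prod>q\<in>ups. psi Nb x y z q) * (\<Prod>q\<in>ups. ph Nb y q / ph Nb z q)"
    by (simp add: psi_def prod.distrib[symmetric])
  also have "(\<Prod>q\<in>ups. ph Nb y q / ph Nb z q) = cross ups ?Y / cross ups ?Z"
    using ratio[of 0 y] ratio[of 0 z] by (simp add: prod_dividef)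
  also have "\<dots> = cross ups ?Y * cross downs ?Z / cross ?I ?Z"
    using split[of ?Z] nz(1,2)[of ?Z] by simp
  finally have key: "cross ups corner_up * cross downs corner_down =
      cross ?I corner_down * ((\<Prod>q\<in>ups. psi Nb x y z q) * (cross ups ?Y * cross downs ?Z / cross ?I ?Z))" .
  have c: "card ups + card ?Y = n1" "card downs + card ?Z = n2"
    using Ob_pos by (simp_all add: card_ups card_downs n1_def n2_def)
  have s: "symp (ups \<union> ?Y) = (\<Prod>p\<in>ups. real p) * (\<Prod>p\<in>?Y. real p) * vdm ups * vdm ?Y * cross ups ?Y / norm1 n1"
    unfolding c[symmetric] by (rule symp_union) (use ltI in force)+
  have o: "orth (downs \<union> ?Z) = vdm downs * vdm ?Z * cross downs ?Z / norm2 n2"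
    unfolding c[symmetric] by (rule orth_union) (use ltI in force)+
  have nzY: "(\<Prod>p\<in>?Y. real p) \<noteq> 0" using Ob_pos by auto
  have "M_H8 x y z a = (\<Prod>p\<in>ups. real p) * vdm ups * vdm downs * (cross ups corner_up * cross downs corner_down) *
    ((\<Prod>p\<in>corner_up. real p) * vdm corner_up * vdm corner_down * gap_sum Nb x y z / (norm1 n1 * norm2 n2))"
    unfolding M_H8_factored by simp
  also have "\<dots> = symp (ups \<union> ?Y) * orth (downs \<union> ?Z) * (\<Prod>q\<in>ups. psi Nb x y z q) * fern_factor Nb x y z"
    unfolding key s o fern_factor_def corner_up_def[symmetric] corner_down_def[symmetric]
    using nzY Ob_pos vdm_nonzero[of ?Y] vdm_nonzero[of ?Z] nz(3)[of ?Z] by (simp add: field_simps)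
  finally show ?thesis .
qed

section \<open>Moving the triangles of the fern\<close>

lemma odd_indices: "{i \<in> {1..2 * k}. odd i} = (\<lambda>i. 2 * i - 1) ` {1..k}" for k :: nat
proof (intro equalityI subsetI)
  fix i assume "i \<in> {i \<in> {1..2 * k}. odd i}"
  then show "i \<in> (\<lambda>i. 2 * i - 1) ` {1..k}"
    by (intro image_eqI[of _ _ "(i + 1) div 2"]) (auto elim!: oddE)
qed auto

lemma odd_tail_Suc: "i \<le> length a \<Longrightarrow> odd_tail i a = term_at a (2 * i - 1) + odd_tail (Suc i) a"
  unfolding odd_tail_def by (rule sum.atLeast_Suc_atMost)

lemma even_tail_Suc: "i \<le> length a \<Longrightarrow> even_tail i a = term_at a (2 * i) + even_tail (Suc i) a"
  unfolding even_tail_def by (rule sum.atLeast_Suc_atMost)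

lemma tails_vanish:
  assumes "length a \<le> 2 * k" "k < i"
  shows "odd_tail i a = 0" "even_tail i a = 0"
  unfolding odd_tail_def even_tail_def using assms by (auto intro!: sum.neutral simp: term_at_def)

lemma odd_sum_eq_tail:
  assumes "length a = 2 * k"
  shows "odd_sum a = odd_tail 1 a"
proof -
  have "odd_sum a = (\<Sum>i\<in>(\<lambda>i. 2 * i - 1) ` {1..k}. term_at a i)"
    unfolding odd_sum_def assms odd_indices[symmetric] by (intro sum.cong) auto
  also have "\<dots> = (\<Sum>i = 1..k. term_at a (2 * i - 1))"
    by (subst sum.reindex) (auto simp: inj_on_def)
  also have "\<dots> = odd_tail 1 a"
    unfolding odd_tail_def by (rule sum.mono_neutral_left) (auto simp: assms term_at_def)
  finally show ?thesis .
qed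

lemma partial_sum_tails:
  assumes "length a = 2 * k" "1 \<le> i" "i \<le> Suc k"
  shows "partial_sum (2 * i - 2) a + odd_tail i a + even_tail i a = partial_sum (2 * k) a"
proof -
  have "partial_sum (2 * (i + 1) - 2) a + odd_tail (i + 1) a + even_tail (i + 1) a =
      partial_sum (2 * i - 2) a + odd_tail i a + even_tail i a" if "1 \<le> i" "i \<le> k" for i
  proof -
    obtain j where "i = Suc j" using \<open>1 \<le> i\<close> by (cases i) auto
    then show ?thesis
      using odd_tail_Suc[of i a] even_tail_Suc[of i a] that assms(1) by simp
  qed
  then have "partial_sum (2 * (Suc k - d) - 2) a + odd_tail (Suc k - d) a + even_tail (Suc k - d) a = partial_sum (2 * k) a"
    if "d \<le> k" for d
    using that
  proof (induction d)
    case 0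
    then show ?case using tails_vanish[of a k "Suc k"] assms(1) by simp
  next
    case (Suc d)
    have "Suc k - d = (Suc k - Suc d) + 1" using Suc.prems by simp
    then show ?case using Suc by simp
  qed
  from this[of "Suc k - i"] show ?thesis using assms(2,3) by simp
qed

lemma prod_lessThan_add: "(\<Prod>j<m + n. g j) = (\<Prod>j<m. g j) * (\<Prod>j<n. g (m + j))" for m n :: nat
  by (induction n) (simp_all add: mult.assoc)

text \<open>
  For \<open>i\<close> from \<open>k\<close> down to 2, the run formed by the odd segments with index at least \<open>2 * i - 1\<close> is moved to
  the left by the length of the even segment before it and so joins the odd segment preceding that
  one. In the end all odd segments form a single one, which starts at 0.
\<close>

lemma prod_segments_telescope:
  fixes f :: "nat \<Rightarrow> real"
  assumes len: "length a = 2 * k" and f: "\<And>q. f q \<noteq> 0"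
  shows "(\<Prod>q\<in>segments False a. f q) = (\<Prod>q<odd_sum a. f q) *
    (\<Prod>i = 2..k. \<Prod>j<odd_tail i a. f (partial_sum (2 * i - 2) a + j) / f (partial_sum (2 * i - 3) a + j))"
proof -
  define seg where "seg i = (\<Prod>j<term_at a (2 * i - 1). f (partial_sum (2 * i - 2) a + j))" for i
  define ratio where "ratio i = (\<Prod>j<odd_tail i a. f (partial_sum (2 * i - 2) a + j) / f (partial_sum (2 * i - 3) a + j))" for i
  have step: "(\<Prod>i\<in>{1..n}. seg i) * (\<Prod>j<odd_tail (Suc n) a. f (partial_sum (2 * Suc n - 2) a + j)) =
      (\<Prod>j<odd_tail 1 a. f j) * (\<Prod>i\<in>{2..Suc n}. ratio i)" if "n \<le> k" for n
    using that
  proof (induction n)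
    case (Suc n)
    let ?i = "Suc n"
    have o: "odd_tail ?i a = term_at a (2 * ?i - 1) + odd_tail (Suc ?i) a"
      by (rule odd_tail_Suc) (use Suc.prems len in simp)
    have s: "partial_sum (2 * Suc ?i - 3) a = partial_sum (2 * ?i - 2) a + term_at a (2 * ?i - 1)"
      using partial_sum_Suc[of "2 * ?i - 2" a] by (simp add: numeral_3_eq_3)
    have "(\<Prod>j<odd_tail ?i a. f (partial_sum (2 * ?i - 2) a + j)) =
        seg ?i * (\<Prod>j<odd_tail (Suc ?i) a. f (partial_sum (2 * Suc ?i - 3) a + j))"
      unfolding o seg_def s by (simp only: prod_lessThan_add add.assoc)
    moreover have "(\<Prod>i\<in>{1..?i}. seg i) = (\<Prod>i\<in>{1..n}. seg i) * seg ?i"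
      by simp
    ultimately have 1: "(\<Prod>i\<in>{1..?i}. seg i) * (\<Prod>j<odd_tail (Suc ?i) a. f (partial_sum (2 * Suc ?i - 3) a + j)) =
        (\<Prod>j<odd_tail 1 a. f j) * (\<Prod>i\<in>{2..?i}. ratio i)"
      using Suc.IH Suc.prems by (simp only: mult.assoc Suc_leD)
    have 2: "(\<Prod>j<odd_tail (Suc ?i) a. f (partial_sum (2 * Suc ?i - 2) a + j)) =
        (\<Prod>j<odd_tail (Suc ?i) a. f (partial_sum (2 * Suc ?i - 3) a + j)) * ratio (Suc ?i)"
      unfolding ratio_def prod.distrib[symmetric] by (intro prod.cong refl) (simp add: f)
    have 3: "(\<Prod>i\<in>{2..Suc ?i}. ratio i) = (\<Prod>i\<in>{2..?i}. ratio i) * ratio (Suc ?i)"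
      by simp
    show ?case
      unfolding 2 3 using 1 by (simp only: mult.assoc[symmetric])
  qed simp
  have "(\<Prod>q\<in>segments False a. f q) = (\<Prod>i\<in>(\<lambda>i. 2 * i - 1) ` {1..k}. \<Prod>j<term_at a i. f (partial_sum (i - 1) a + j))"
    unfolding prod_segments odd_indices[symmetric] by (intro prod.cong) (auto simp: len)
  also have "\<dots> = (\<Prod>i\<in>{1..k}. seg i)"
    unfolding seg_def by (subst prod.reindex) (auto simp: inj_on_def numeral_2_eq_2)
  also have "\<dots> = (\<Prod>j<odd_tail 1 a. f j) * (\<Prod>i\<in>{2..Suc k}. ratio i)"
    using step[of k] tails_vanish[of a k "Suc k"] len by simp
  also have "(\<Prod>i\<in>{2..Suc k}. ratio i) = (\<Prod>i\<in>{2..k}. ratio i)"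
    using tails_vanish[of a k "Suc k"] len by (intro prod.mono_neutral_right) (auto simp: ratio_def le_Suc_eq)
  finally show ?thesis
    unfolding ratio_def odd_sum_eq_tail[OF len] .
qed

text \<open>
  The \<open>i\<close>-th step of the telescoping product, for one of the four factors of \<open>psi\<close>.
\<close>

lemma T_factor_ratio:
  assumes len: "length a = 2 * k" and i: "2 \<le> i" "i \<le> k" and N: "N = partial_sum (length a) a" "N \<ge> 1"
  shows "(\<Prod>j<odd_tail i a. ph N w (partial_sum (2 * i - 2) a + j) / ph N w (partial_sum (2 * i - 3) a + j)) =
    T_factor a i (real w + sigma a i) / T_factor a i (real w + real (even_tail i a) + 1)"
proof -
  define n where "n = odd_tail i a"
  define e where "e = even_tail i a"
  define r where "r = term_at a (2 * i - 2)"
  define s where "s = partial_sum (2 * i - 3) a"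
  have s': "partial_sum (2 * i - 2) a = s + r"
    using partial_sum_pred[of "2 * i - 2" a] i by (simp add: s_def r_def numeral_3_eq_3)
  have N': "s + r + n + e = N"
    using partial_sum_tails[OF len, of i] i by (simp add: N(1) len n_def e_def s'[symmetric])
  have T1: "T_factor a i (real w + real e + 1) = (\<Prod>j<n. fact (w + e + r + j) / fact (w + e + j))"
    using T_fact[of "w + e" r n] by (simp add: T_factor_def r_def n_def algebra_simps)
  have sig: "real w + sigma a i = real (Suc (w + s + (N - 1)))"
    using N by (simp add: sigma_def s_def)
  have T2: "T_factor a i (real w + sigma a i) = (\<Prod>j<n. fact (w + s + (N - 1) + r + j) / fact (w + s + (N - 1) + j))"
    unfolding sig using T_fact[of "w + s + (N - 1)" r n] by (simp add: T_factor_def r_def n_def)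
  have ph: "(\<Prod>j<n. ph N w (t + j)) = (\<Prod>j<n. fact (w + e + r' + j)) * (\<Prod>j<n. fact (w + t + (N - 1) + j))"
    if "t + n + e + r' = N" for t r'
  proof -
    have "(\<Prod>j<n. ph N w (t + j)) = (\<Prod>j<n. fact (w + e + r' + (n - 1 - j)) * fact (w + t + (N - 1) + j))"
    proof (rule prod.cong[OF refl])
      fix j assume "j \<in> {..<n}"
      then have "N + w - 1 - (t + j) = w + e + r' + (n - 1 - j)" "N + w - 1 + (t + j) = w + t + (N - 1) + j"
        using that N(2) by auto
      then show "ph N w (t + j) = fact (w + e + r' + (n - 1 - j)) * fact (w + t + (N - 1) + j)"
        by (simp only: ph_def)
    qed
    then show ?thesis
      using prod_rev[of "\<lambda>j. fact (w + e + r' + j) :: real" n] by (simp add: prod.distrib)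
  qed
  have "(\<Prod>j<n. ph N w (s + r + j) / ph N w (s + j)) =
      ((\<Prod>j<n. fact (w + e + 0 + j)) * (\<Prod>j<n. fact (w + (s + r) + (N - 1) + j))) /
      ((\<Prod>j<n. fact (w + e + r + j)) * (\<Prod>j<n. fact (w + s + (N - 1) + j)))"
    unfolding prod_dividef using ph[of "s + r" 0] ph[of s r] N' by (simp add: add_ac)
  also have "\<dots> = (\<Prod>j<n. fact (w + s + (N - 1) + r + j) / fact (w + s + (N - 1) + j)) /
      (\<Prod>j<n. fact (w + e + r + j) / fact (w + e + j))"
    by (simp add: prod_dividef ac_simps)
  finally show ?thesis
    unfolding n_def[symmetric] e_def[symmetric] s_def[symmetric] s' T1 T2 .
qed

lemma two_term_list:
  "segments False [u, v] = {..<u}" "segments True [u, v] = {u..<u + v}" "odd_sum [u, v] = u" "even_sum [u, v] = v"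
proof -
  have e: "segments b [] = {}" for b by (simp add: segments_def)
  show 1: "segments False [u, v] = {..<u}" by (simp add: segments_Cons e)
  show 2: "segments True [u, v] = {u..<u + v}" by (simp add: segments_Cons e atLeast0LessThan[symmetric] add.commute)
  show "odd_sum [u, v] = u" using card_segments_False[of "[u, v]"] unfolding 1 by simp
  show "even_sum [u, v] = v" using card_segments_True[of "[u, v]"] unfolding 2 by simp
qed

lemma halved_hexagon_two: "u \<ge> 1 \<Longrightarrow> z + v \<ge> 1 \<Longrightarrow> halved_hexagon z [u, v]"
  by unfold_locales (simp_all add: two_term_list term_at_def)

lemma M_H8_two:
  assumes "u \<ge> 1" "z + v \<ge> 1"
  shows "M_H8 x y z [u, v] = P y (y + 2 * u - 2) v * P' (z + v - 1) (z + v - 1) u *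
    (\<Prod>q\<in>{1..<u}. psi (u + v) x y z q) * fern_factor (u + v) x y z"
proof -
  interpret halved_hexagon x y z "[u, v]" using assms by (rule halved_hexagon_two)
  have "{..<u} - {0} = {1..<u}" by auto
  then have ups: "ups = {1..<u}" by (simp add: ups_def two_term_list)
  have downs: "downs = {u..<u + v}" by (simp add: downs_def two_term_list)
  have "P' (z + v - 1) (z + v - 1) u = orth {u..<u + (z + v - 1) + 1}"
    by (rule P'_eq_orth) (rule assms(1))
  also have "{u..<u + (z + v - 1) + 1} = {u..<u + v} \<union> {u + v..<u + v + z}"
    using assms(2) by auto
  finally show ?thesis
    using M_H8_product by (simp add: ups downs two_term_list P_eq_symp[OF assms(1)])
qed

lemma symp_nonzero: "finite D \<Longrightarrow> 0 \<notin> D \<Longrightarrow> symp D \<noteq> 0"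
  using vdm_nonzero[of D] norm_nonzero(1)[of "card D"] by (auto simp: symp_def norm1_def)

lemma orth_nonzero: "finite D \<Longrightarrow> orth D \<noteq> 0"
  using vdm_nonzero[of D] norm_nonzero(2)[of "card D"] by (auto simp: orth_def norm2_def)

theorem M_H8_fern:
  assumes "k \<ge> 2" and len: "length a = 2 * k" and a: "term_at a 1 \<ge> 1" "z + even_sum a \<ge> 1"
  shows "M_H8 x y z a =
          M_H8 x y z [odd_sum a, even_sum a]
          * (Q ([0, term_at a 1 - 1] @ tl a @ [y])
             * K' (butlast a @ [term_at a (2 * k) + z])
             / (P y (y + 2 * odd_sum a - 2) (even_sum a)
                * P' (z + even_sum a - 1) (z + even_sum a - 1) (odd_sum a)))
          * (\<Prod>i = 2..k.
               T_factor a i (real x + real z + real (even_tail i a) + 1)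
               * T_factor a i (real y + real (even_tail i a) + 1)
               / (T_factor a i (real x + real y + real (even_tail i a) + 1)
                  * T_factor a i (real z + real (even_tail i a) + 1))
               * (T_factor a i (real x + real y + sigma a i)
                  * T_factor a i (real z + sigma a i)
                  / (T_factor a i (real x + real z + sigma a i)
                     * T_factor a i (real y + sigma a i))))"
    (is "_ = _ * (?Q * ?K / (?P * ?P')) * ?prod")
proof -
  interpret halved_hexagon x y z a using a by unfold_locales
  let ?psi = "psi Nb x y z"
  have Q: "?Q = symp (ups \<union> {Nb..<Nb + y})"
    by (rule Q_modified) (simp add: len)
  have K: "?K = orth (downs \<union> {Nb..<Nb + z})"
    using K'_modified by (simp add: len)
  have P: "?P = symp ({1..<Ob} \<union> {Ob + Eb..<Ob + Eb + y})"
    by (rule P_eq_symp) (rule Ob_pos)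
  have P': "?P' = orth {Ob..<Ob + (z + Eb - 1) + 1}"
    by (rule P'_eq_orth) (rule Ob_pos)
  have nz1: "?P \<noteq> 0"
    unfolding P by (rule symp_nonzero) (use Ob_pos in auto)
  have nz2: "?P' \<noteq> 0"
    unfolding P' by (rule orth_nonzero) simp
  have N: "Nb = partial_sum (length a) a" "Nb \<ge> 1"
    using total Ob_pos by simp_all
  have "?prod = (\<Prod>i = 2..k. \<Prod>j<odd_tail i a. ?psi (partial_sum (2 * i - 2) a + j) / ?psi (partial_sum (2 * i - 3) a + j))"
  proof (rule prod.cong[OF refl])
    fix i assume i: "i \<in> {2..k}"
    let ?r = "\<lambda>w. \<Prod>j<odd_tail i a. ph Nb w (partial_sum (2 * i - 2) a + j) / ph Nb w (partial_sum (2 * i - 3) a + j)"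
    have r: "?r w = T_factor a i (real w + sigma a i) / T_factor a i (real w + real (even_tail i a) + 1)" for w
      by (rule T_factor_ratio[OF len _ _ N]) (use i in auto)
    have "(\<Prod>j<odd_tail i a. ?psi (partial_sum (2 * i - 2) a + j) / ?psi (partial_sum (2 * i - 3) a + j)) =
        ?r (x + y) * ?r z / (?r (x + z) * ?r y)"
      by (simp add: psi_def prod_dividef prod.distrib)
    then show "T_factor a i (real x + real z + real (even_tail i a) + 1)
               * T_factor a i (real y + real (even_tail i a) + 1)
               / (T_factor a i (real x + real y + real (even_tail i a) + 1)
                  * T_factor a i (real z + real (even_tail i a) + 1))
               * (T_factor a i (real x + real y + sigma a i)
                  * T_factor a i (real z + sigma a i)
                  / (T_factor a i (real x + real z + sigma a i)
                     * T_factor a i (real y + sigma a i))) =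
        (\<Prod>j<odd_tail i a. ?psi (partial_sum (2 * i - 2) a + j) / ?psi (partial_sum (2 * i - 3) a + j))"
      unfolding r by (simp add: field_simps)
  qed
  moreover have "(\<Prod>q\<in>segments False a. ?psi q) = (\<Prod>q<Ob. ?psi q) *
      (\<Prod>i = 2..k. \<Prod>j<odd_tail i a. ?psi (partial_sum (2 * i - 2) a + j) / ?psi (partial_sum (2 * i - 3) a + j))"
    by (rule prod_segments_telescope[OF len]) simp
  moreover have "(\<Prod>q\<in>segments False a. ?psi q) = ?psi 0 * (\<Prod>q\<in>ups. ?psi q)"
    unfolding ups_def by (rule prod.remove) (simp_all add: zero_in_segments)
  moreover have "(\<Prod>q<Ob. ?psi q) = ?psi 0 * (\<Prod>q\<in>{1..<Ob}. ?psi q)"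
  proof -
    have "{..<Ob} - {0} = {1..<Ob}" by auto
    then show ?thesis using prod.remove[of "{..<Ob}" 0 ?psi] Ob_pos by simp
  qed
  ultimately have tele: "(\<Prod>q\<in>ups. ?psi q) = (\<Prod>q\<in>{1..<Ob}. ?psi q) * ?prod"
    by (simp add: mult.assoc)
  have "M_H8 x y z a = ?Q * ?K * ((\<Prod>q\<in>{1..<Ob}. ?psi q) * ?prod) * fern_factor Nb x y z"
    unfolding Q K tele[symmetric] by (rule M_H8_product)
  moreover have "M_H8 x y z [Ob, Eb] = ?P * ?P' * (\<Prod>q\<in>{1..<Ob}. ?psi q) * fern_factor Nb x y z"
    by (rule M_H8_two) (use Ob_pos zE in auto)
  ultimately show ?thesis
    using nz1 nz2 by simp
qed

section \<open>Summation over the crossing positions\<close>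

text \<open>
  The Vandermonde product of the squares of the entries of a tuple.
\<close>

definition disc :: "nat \<Rightarrow> (nat \<Rightarrow> nat) \<Rightarrow> real" where
  "disc m h = (\<Prod>j<m. \<Prod>i<j. (real (h j))^2 - (real (h i))^2)"

lemma disc_fdet: "disc m h = fdet m (\<lambda>i j. \<Prod>l<j. (real (h i))^2 - t l)"
  by (simp add: disc_def fdet_newton)

lemma disc_permute:
  assumes "p permutes {..<m}"
  shows "(disc m (h \<circ> p))^2 = (disc m h)^2"
proof -
  have "disc m (h \<circ> p) = signof p * disc m h"
    unfolding disc_fdet[where t = "\<lambda>_. 0"]
    using fdet_permute_rows[OF assms, of "\<lambda>i j. \<Prod>l<j. (real (h i))^2 - 0"] by simp
  then show ?thesis by (simp add: power_mult_distrib sign_def)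
qed

text \<open>
  Tuples with a repeated entry do not contribute, and every set of \<open>m\<close> elements arises from \<open>m!\<close>
  tuples.
\<close>

lemma sum_tuples_eq_sum_sets:
  assumes "finite G"
  shows "(\<Sum>h\<in>Pi\<^sub>E {..<m} (\<lambda>_. G). (\<Prod>i<m. w (h i)) * (disc m h)^2) =
    fact m * (\<Sum>X | X \<subseteq> G \<and> card X = m. (\<Prod>p\<in>X. w p) * (vdm X)^2)"
proof -
  let ?F = "\<lambda>h. (\<Prod>i<m. w (h i)) * (disc m h)^2"
  let ?H = "{h \<in> Pi\<^sub>E {..<m} (\<lambda>_. G). inj_on h {..<m}}"
  let ?T = "{X. X \<subseteq> G \<and> card X = m}"
  have fin: "finite (Pi\<^sub>E {..<m} (\<lambda>_. G))" using assms by (intro finite_PiE) auto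
  have "(\<Sum>h\<in>Pi\<^sub>E {..<m} (\<lambda>_. G). ?F h) = (\<Sum>h\<in>?H. ?F h)"
  proof (rule sum.mono_neutral_right)
    show "\<forall>h\<in>Pi\<^sub>E {..<m} (\<lambda>_. G) - ?H. ?F h = 0"
    proof
      fix h assume "h \<in> Pi\<^sub>E {..<m} (\<lambda>_. G) - ?H"
      then obtain i j where "i < m" "j < m" "h i = h j" "i \<noteq> j"
        by (auto simp: inj_on_def)
      then obtain i j where ij: "i < j" "j < m" "h i = h j"
        by (metis linorder_neqE_nat)
      have "(\<Prod>i'<j. (real (h j))^2 - (real (h i'))^2) = 0"
        by (rule prod_zero, simp, rule bexI[of _ i]) (use ij in simp_all)
      then have "disc m h = 0" unfolding disc_def
        by (intro prod_zero, simp, intro bexI[of _ j]) (use ij in simp_all)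
      then show "?F h = 0" by simp
    qed
  qed (use fin in auto)
  also have "\<dots> = (\<Sum>X\<in>?T. \<Sum>h\<in>{h \<in> ?H. h ` {..<m} = X}. ?F h)"
  proof (rule sum.group[symmetric])
    show "finite ?T" by (rule finite_subset[of _ "Pow G"]) (use assms in auto)
    show "(\<lambda>h. h ` {..<m}) ` ?H \<subseteq> ?T" by (auto simp: card_image PiE_def Pi_def)
  qed (use fin in simp)
  also have "\<dots> = (\<Sum>X\<in>?T. fact m * ((\<Prod>p\<in>X. w p) * (vdm X)^2))"
  proof (rule sum.cong[OF refl])
    fix X assume "X \<in> ?T"
    then have X: "X \<subseteq> G" "card X = m" "finite X" using assms finite_subset by auto
    obtain d where d: "\<And>i j. i < j \<Longrightarrow> j < m \<Longrightarrow> d i < d j" "X = d ` {..<m}" "inj_on d {..<m}"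
      using increasing_enumeration[OF X(3)] X(2) by metis
    let ?P = "{p. p permutes {..<m}}"
    let ?e = "\<lambda>p. restrict (d \<circ> p) {..<m}"
    have img: "{h \<in> ?H. h ` {..<m} = X} = ?e ` ?P"
    proof (intro equalityI subsetI)
      fix h assume "h \<in> {h \<in> ?H. h ` {..<m} = X}"
      then have h: "h \<in> Pi\<^sub>E {..<m} (\<lambda>_. G)" "inj_on h {..<m}" "h ` {..<m} = X" by auto
      define p where "p = (\<lambda>i. if i < m then the_inv_into {..<m} d (h i) else i)"
      have dp: "d (p i) = h i \<and> p i < m" if "i < m" for i
      proof -
        have "h i \<in> d ` {..<m}" using h(3) d(2) that by auto
        then show ?thesis
          using f_the_inv_into_f[OF d(3)] the_inv_into_into[OF d(3), of "h i" "{..<m}"] that by (auto simp: p_def)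
      qed
      have "inj_on p {..<m}"
      proof (rule inj_onI)
        fix i j assume ij: "i \<in> {..<m}" "j \<in> {..<m}" "p i = p j"
        then have "h i = h j" using dp[of i] dp[of j] by simp
        then show "i = j" using inj_onD[OF h(2)] ij by blast
      qed
      then have "bij_betw p {..<m} {..<m}"
        using dp by (intro bij_betw_imageI endo_inj_surj) auto
      then have "p permutes {..<m}" by (rule bij_imp_permutes) (simp add: p_def)
      moreover have "h = ?e p"
      proof
        fix i show "h i = ?e p i"
          using PiE_arb[OF h(1), of i] dp[of i] by (cases "i < m") auto
      qed
      ultimately show "h \<in> ?e ` ?P" by blast
    next
      fix h assume "h \<in> ?e ` ?P"
      then obtain p where p: "p permutes {..<m}" "h = ?e p" by blast
      have "h ` {..<m} = (d \<circ> p) ` {..<m}" unfolding p(2) by simp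
      also have "\<dots> = d ` (p ` {..<m})" by (rule image_comp[symmetric])
      finally have "h ` {..<m} = X" using permutes_image[OF p(1)] d(2) by simp
      moreover have "inj_on h {..<m}"
      proof (rule inj_onI)
        fix i j assume ij: "i \<in> {..<m}" "j \<in> {..<m}" "h i = h j"
        then have "d (p i) = d (p j)" by (simp add: p(2))
        moreover have "p i \<in> {..<m}" "p j \<in> {..<m}" using ij permutes_in_image[OF p(1)] by simp_all
        ultimately have "p i = p j" using inj_onD[OF d(3)] by blast
        then show "i = j" using permutes_inj[OF p(1)] by (simp add: inj_eq)
      qed
      ultimately show "h \<in> {h \<in> ?H. h ` {..<m} = X}"
        using X(1) p(2) by (auto simp: PiE_def Pi_def subset_iff image_iff)
    qed
    have inj: "inj_on ?e ?P"
    proof (rule inj_onI)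
      fix p q assume pq: "p \<in> ?P" "q \<in> ?P" "?e p = ?e q"
      show "p = q"
      proof
        fix i
        show "p i = q i"
        proof (cases "i < m")
          case True
          then have "d (p i) = d (q i)" using fun_cong[OF pq(3), of i] by simp
          moreover have "p i < m" "q i < m" using pq True permutes_in_image[of p "{..<m}" i] permutes_in_image[of q "{..<m}" i] by simp_all
          ultimately show ?thesis using inj_onD[OF d(3)] by auto
        next
          case False
          then show ?thesis using pq permutes_not_in[of p "{..<m}" i] permutes_not_in[of q "{..<m}" i] by simp
        qed
      qed
    qed
    have val: "?F (?e p) = (\<Prod>p\<in>X. w p) * (vdm X)^2" if "p \<in> ?P" for p
    proof -
      have p: "p permutes {..<m}" using that by simp
      have "disc m (?e p) = disc m (d \<circ> p)"
        unfolding disc_def by (intro prod.cong refl) auto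
      then have "(disc m (?e p))^2 = (disc m d)^2"
        using disc_permute[OF p, of d] by simp
      also have "disc m d = vdm X"
        unfolding disc_def d(2) by (rule vdm_enumeration[symmetric]) (use d in auto)
      finally have 1: "(disc m (?e p))^2 = (vdm X)^2" .
      have "(\<Prod>i<m. w (?e p i)) = (\<Prod>i<m. (w \<circ> d) (p i))" by simp
      also have "\<dots> = (\<Prod>i<m. (w \<circ> d) i)"
        using prod.permute[OF p, of "w \<circ> d"] by (simp add: o_def)
      also have "\<dots> = (\<Prod>p\<in>X. w p)"
        unfolding d(2) by (simp add: prod.reindex[OF d(3)])
      finally show ?thesis using 1 by simp
    qed
    have "(\<Sum>h\<in>{h \<in> ?H. h ` {..<m} = X}. ?F h) = (\<Sum>p\<in>?P. ?F (?e p))"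
      unfolding img by (subst sum.reindex[OF inj]) (simp add: o_def)
    also have "\<dots> = (\<Sum>p\<in>?P. (\<Prod>p\<in>X. w p) * (vdm X)^2)"
      by (rule sum.cong[OF refl val])
    finally show "(\<Sum>h\<in>{h \<in> ?H. h ` {..<m} = X}. ?F h) = fact m * ((\<Prod>p\<in>X. w p) * (vdm X)^2)"
      by (simp add: card_permutations)
  qed
  finally show ?thesis by (simp add: sum_distrib_left)
qed

text \<open>
  The weight of a crossing position \<open>s\<close> is the product of \<open>wt0 N s\<close> and, with the other arguments as they
  occur there, \<open>upper_factor B n s\<close>. The former vanishes for \<open>1 \<le> s < N\<close>, the latter for \<open>B \<le> s < B + n\<close>.
\<close>

definition wt0 :: "nat \<Rightarrow> nat \<Rightarrow> real" where
  "wt0 N s = real s * (\<Prod>q\<in>{1..<N}. (real s)^2 - (real q)^2)"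

definition upper_factor :: "nat \<Rightarrow> nat \<Rightarrow> nat \<Rightarrow> real" where
  "upper_factor B n s = (\<Prod>r\<in>{B..<B + n}. (real r)^2 - (real s)^2)"

lemma wt0_Suc: "1 \<le> N \<Longrightarrow> wt0 (Suc N) s = wt0 N s * ((real s)^2 - (real N)^2)"
  by (simp add: wt0_def prod.atLeastLessThan_Suc)

lemma wt0_shift: "1 \<le> N \<Longrightarrow> wt0 (N + i) s = wt0 N s * (\<Prod>l<i. (real s)^2 - (real (N + l))^2)"
  by (induction i) (simp_all add: wt0_Suc mult.assoc)

lemma wt0_zero:
  assumes "1 \<le> s" "s < N"
  shows "wt0 N s = 0"
proof -
  have "(\<Prod>q\<in>{1..<N}. (real s)^2 - (real q)^2) = 0"
    using assms by (intro prod_zero) auto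
  then show ?thesis by (simp add: wt0_def)
qed

lemma wt0_fact: "wt0 (Suc N) (Suc N + n) = fact (2 * N + 1 + n) / fact n"
proof (induction N arbitrary: n)
  case 0
  then show ?case by (simp add: wt0_def)
next
  case (Suc N)
  have "wt0 (Suc (Suc N)) (Suc (Suc N) + n) = wt0 (Suc N) (Suc N + Suc n) * ((real (Suc N + Suc n))^2 - (real (Suc N))^2)"
    by (simp add: wt0_Suc)
  also have "\<dots> = fact (2 * N + 1 + Suc n) / fact (Suc n) * (real (Suc n) * real (2 * N + 3 + n))"
    unfolding Suc.IH by (simp add: power2_eq_square algebra_simps)
  also have "\<dots> = fact (2 * Suc N + 1 + n) / fact n"
  proof -
    have "fact (2 * Suc N + 1 + n) = real (2 * N + 3 + n) * fact (2 * N + 1 + Suc n)"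
      by (simp add: algebra_simps)
    moreover have "fact (Suc n) = real (Suc n) * (fact n :: real)" by simp
    ultimately show ?thesis by (simp add: field_simps del: of_nat_Suc fact_Suc)
  qed
  finally show ?case .
qed

text \<open>
  For \<open>r = 0\<close> the sum telescopes. In the step, the new factor is split as
  \<open>(B + r)\<^sup>2 - s\<^sup>2 = ((B + r)\<^sup>2 - (N + 1)\<^sup>2) - (s\<^sup>2 - (N + 1)\<^sup>2)\<close> with \<open>B = N + 1 + n\<close>.
\<close>

lemma sum_wt0_upper_factor:
  "(\<Sum>s\<in>{Suc N..<Suc N + n}. wt0 (Suc N) s * upper_factor (Suc N + n) r s) =
    fact r * fact (N + n + r) * fact N * fact (2 * N + 1 + n + r) * real n /
    (2 * fact (N + n) * fact (N + 1 + r) * fact n)"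
proof (induction r arbitrary: N n)
  case 0
  have "(\<Sum>s\<in>{Suc N..<Suc N + n}. wt0 (Suc N) s) = fact (2 * N + 1 + n) * real n / (2 * real (Suc N) * fact n)"
  proof (induction n)
    case (Suc n)
    have "{Suc N..<Suc N + Suc n} = insert (Suc N + n) {Suc N..<Suc N + n}" by auto
    then have "(\<Sum>s\<in>{Suc N..<Suc N + Suc n}. wt0 (Suc N) s) =
        wt0 (Suc N) (Suc N + n) + (\<Sum>s\<in>{Suc N..<Suc N + n}. wt0 (Suc N) s)"
      by (simp only:) (rule sum.insert; simp)
    also have "\<dots> = fact (2 * N + 1 + n) / fact n + fact (2 * N + 1 + n) * real n / (2 * real (Suc N) * fact n)"
      unfolding Suc.IH wt0_fact ..
    also have "\<dots> = fact (2 * N + 1 + n) * (2 * real (Suc N) + real n) / (2 * real (Suc N) * fact n)"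
    proof -
      have "A / B + A * t / (2 * s * B) = A * (2 * s + t) / (2 * s * B)" if "s \<noteq> 0" "B \<noteq> 0" for A B s t :: real
        using that by (simp add: field_simps)
      from this[of "real (Suc N)" "fact n" "fact (2 * N + 1 + n)" "real n"] show ?thesis
        by (metis fact_nonzero of_nat_neq_0)
    qed
    also have "2 * real (Suc N) + real n = real (2 * N + 2 + n)"
      by simp
    also have "fact (2 * N + 1 + n) * real (2 * N + 2 + n) / (2 * real (Suc N) * fact n) =
        fact (2 * N + 1 + Suc n) * real (Suc n) / (2 * real (Suc N) * fact (Suc n))"
    proof -
      have 1: "fact (2 * N + 1 + Suc n) = real (2 * N + 2 + n) * fact (2 * N + 1 + n)"
        by (simp add: algebra_simps)
      have 2: "fact (Suc n) = real (Suc n) * (fact n :: real)" by simp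
      have aux: "A * K / (2 * s * B) = K * A * S / (2 * s * (S * B))" if "S \<noteq> 0" for A K s B S :: real
        using that by (simp add: mult_ac)
      show ?thesis unfolding 1 2 by (rule aux) (rule of_nat_neq_0)
    qed
    finally show ?case .
  qed simp
  note single = this
  have 1: "(\<Sum>s\<in>{Suc N..<Suc N + n}. wt0 (Suc N) s * upper_factor (Suc N + n) 0 s) =
      (\<Sum>s\<in>{Suc N..<Suc N + n}. wt0 (Suc N) s)"
    by (simp add: upper_factor_def)
  have 2: "fact (N + 1) = real (Suc N) * (fact N :: real)" by simp
  have aux: "K * t / (2 * s * B) = 1 * F * G * K * t / (2 * F * (s * G) * B)" if "F \<noteq> 0" "G \<noteq> 0" for F G K t s B :: real
    using that by (simp add: mult_ac)
  show ?case
    unfolding 1 single add_0_right fact_0 2 by (rule aux) (rule fact_nonzero)+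
next
  case (Suc r)
  let ?B = "Suc N + n"
  let ?S = "{Suc N..<?B}"
  have split: "upper_factor ?B (Suc r) s = upper_factor ?B r s * ((real (?B + r))^2 - (real s)^2)" for s
    by (simp add: upper_factor_def)
  have "(\<Sum>s\<in>?S. wt0 (Suc N) s * upper_factor ?B (Suc r) s) =
      ((real (?B + r))^2 - (real (Suc N))^2) * (\<Sum>s\<in>?S. wt0 (Suc N) s * upper_factor ?B r s) -
      (\<Sum>s\<in>?S. wt0 (Suc (Suc N)) s * upper_factor ?B r s)"
    unfolding split sum_distrib_left sum_subtractf[symmetric]
    by (intro sum.cong refl) (simp add: wt0_Suc algebra_simps)
  also have "(\<Sum>s\<in>?S. wt0 (Suc (Suc N)) s * upper_factor ?B r s) =
      fact r * fact (N + n + r) * fact (Suc N) * fact (2 * N + 2 + n + r) * real n * real (n - 1) /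
        (2 * fact (N + n) * fact (N + 2 + r) * fact n)"
  proof (cases n)
    case n: (Suc k)
    have args: "Suc N + k + r = N + n + r" "2 * Suc N + 1 + k + r = 2 * N + 2 + n + r" "Suc N + k = N + n"
      "Suc N + 1 + r = N + 2 + r" "n - 1 = k"
      using n by simp_all
    have fn: "fact n = real n * fact k" using n by simp
    have "(\<Sum>s\<in>?S. wt0 (Suc (Suc N)) s * upper_factor ?B r s) =
        (\<Sum>s\<in>{Suc (Suc N)..<Suc (Suc N) + k}. wt0 (Suc (Suc N)) s * upper_factor (Suc (Suc N) + k) r s)"
      unfolding n by (rule sum.mono_neutral_cong_right) (auto simp: wt0_zero Suc_le_eq)
    also have "\<dots> = fact r * fact (Suc N + k + r) * fact (Suc N) * fact (2 * Suc N + 1 + k + r) * real k /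
        (2 * fact (Suc N + k) * fact (Suc N + 1 + r) * fact k)"
      by (rule Suc.IH)
    also have "\<dots> = fact r * fact (N + n + r) * fact (Suc N) * fact (2 * N + 2 + n + r) * real n * real k /
        (2 * fact (N + n) * fact (N + 2 + r) * (real n * fact k))"
    proof -
      have aux: "A * t / (2 * F * G * B) = A * s * t / (2 * F * G * (s * B))" if "s \<noteq> 0" for A t F G B s :: real
        using that by (simp add: mult_ac)
      show ?thesis unfolding args by (rule aux) (use n in simp)
    qed
    finally show ?thesis unfolding args fn .
  qed simp
  also have "(\<Sum>s\<in>?S. wt0 (Suc N) s * upper_factor ?B r s) = 
    fact r * fact (N + n + r) * fact N * fact (2 * N + 1 + n + r) * real n / (2 * fact (N + n) * fact (N + 1 + r) * fact n)"
    by (rule Suc.IH)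
  also have "((real (?B + r))^2 - (real (Suc N))^2) * (fact r * fact (N + n + r) * fact N * fact (2 * N + 1 + n + r) * real n / (2 * fact (N + n) * fact (N + 1 + r) * fact n)) -
      fact r * fact (N + n + r) * fact (Suc N) * fact (2 * N + 2 + n + r) * real n * real (n - 1) /
        (2 * fact (N + n) * fact (N + 2 + r) * fact n) =
      fact (Suc r) * fact (N + n + Suc r) * fact N * fact (2 * N + 1 + n + Suc r) * real n /
        (2 * fact (N + n) * fact (N + 1 + Suc r) * fact n)"
  proof (cases "n = 0")
    case False
    have f: "fact (N + n + Suc r) = (real N + real n + real r + 1) * fact (N + n + r)"
      "fact (2 * N + 1 + n + Suc r) = (2 * real N + real n + real r + 2) * fact (2 * N + 1 + n + r)"
      "fact (2 * N + 2 + n + r) = (2 * real N + real n + real r + 2) * fact (2 * N + 1 + n + r)"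
      "fact (N + 1 + Suc r) = (real N + real r + 2) * fact (N + 1 + r)"
      "fact (N + 2 + r) = (real N + real r + 2) * fact (N + 1 + r)"
      "fact (Suc N) = (real N + 1) * fact N" "fact (Suc r) = (real r + 1) * fact r"
      "real (n - 1) = real n - 1" "real (?B + r) = real N + real n + real r + 1" "real (Suc N) = real N + 1"
      using False by (simp_all add: algebra_simps)
    define c where "c = fact r * fact (N + n + r) * fact N * fact (2 * N + 1 + n + r) * real n / (2 * fact (N + n) * fact (N + 1 + r) * fact n)"
    have nz: "real N + real r + 2 \<noteq> 0" by linarith
    have "((real N + real n + real r + 1)^2 - (real N + 1)^2) * c - c * ((real N + 1) * (2 * real N + real n + real r + 2) * (real n - 1) / (real N + real r + 2)) =
        c * ((real r + 1) * (real N + real n + real r + 1) * (2 * real N + real n + real r + 2) / (real N + real r + 2))"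
      using nz by (simp add: field_simps power2_eq_square)
    then show ?thesis unfolding f c_def by (simp add: mult_ac)
  qed simp
  finally show ?case .
qed

lemma wt0_nonneg:
  assumes "N \<le> s"
  shows "0 \<le> wt0 N s"
proof -
  have "0 \<le> (real s)^2 - (real q)^2" if "q \<in> {1..<N}" for q
    using that assms by (simp add: power_mono)
  then show ?thesis by (auto simp: wt0_def intro!: mult_nonneg_nonneg prod_nonneg)
qed

lemma upper_factor_nonneg:
  assumes "s < B"
  shows "0 \<le> upper_factor B n s"
proof -
  have "0 \<le> (real r)^2 - (real s)^2" if "r \<in> {B..<B + n}" for r
    using that assms by (simp add: power_mono)
  then show ?thesis by (auto simp: upper_factor_def intro!: prod_nonneg)
qed

lemma upper_factor_zero: "B \<le> s \<Longrightarrow> s < B + n \<Longrightarrow> upper_factor B n s = 0"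
  unfolding upper_factor_def by (rule prod_zero) (auto intro!: bexI[of _ s])

lemma upper_factor_extend:
  "j \<le> B \<Longrightarrow> upper_factor B n s * (\<Prod>l<j. (real s)^2 - (real (B - 1 - l))^2) = (- 1) ^ j * upper_factor (B - j) (n + j) s"
proof (induction j)
  case (Suc j)
  have "{B - Suc j..<B - Suc j + (n + Suc j)} = insert (B - Suc j) {B - j..<B - j + (n + j)}"
    using Suc.prems by auto
  then have "upper_factor (B - Suc j) (n + Suc j) s = ((real (B - Suc j))^2 - (real s)^2) * upper_factor (B - j) (n + j) s"
    unfolding upper_factor_def using Suc.prems by (simp only:) (rule prod.insert; auto)
  moreover have "upper_factor B n s * (\<Prod>l<Suc j. (real s)^2 - (real (B - 1 - l))^2) =
      (upper_factor B n s * (\<Prod>l<j. (real s)^2 - (real (B - 1 - l))^2)) * ((real s)^2 - (real (B - Suc j))^2)"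
    by simp
  moreover have "upper_factor B n s * (\<Prod>l<j. (real s)^2 - (real (B - 1 - l))^2) = (- 1) ^ j * upper_factor (B - j) (n + j) s"
    by (rule Suc.IH) (rule Suc_leD, rule Suc.prems)
  moreover have "p * U * (c - d) = - 1 * p * ((d - c) * U)" for p U c d :: real
    by (simp add: algebra_simps)
  ultimately show ?case
    by (simp only: power_Suc)
qed simp

text \<open>
  An entry of the determinant for \<open>gap_sum\<close>. The factors of the Newton bases extend the two products in
  the weight, so that the sum is again of the form just evaluated.
\<close>

lemma moment:
  fixes N x m r i j :: nat
  assumes "j < m"
  defines "A \<equiv> N + x + m + r" and "B \<equiv> Suc N + x + m"
  shows "(\<Sum>s\<in>{Suc N..<B}. wt0 (Suc N) s * upper_factor B r s *
      (\<Prod>l<i. (real s)^2 - (real (Suc N + l))^2) * (\<Prod>l<j. (real s)^2 - (real (B - 1 - l))^2)) =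
    (fact (N + i) * fact (A + N + 1 + i) / 2) * ((- 1) ^ j * (fact (r + j) / fact (N + x + m - j))) *
    real (A choose (N + 1 + r + i + j))" (is "?L = _")
proof -
  have jB: "j \<le> B" using assms(1) by (simp add: B_def)
  have "?L = (\<Sum>s\<in>{Suc N..<B}. (- 1) ^ j * (wt0 (Suc (N + i)) s * upper_factor (B - j) (r + j) s))"
  proof (rule sum.cong[OF refl])
    fix s
    show "wt0 (Suc N) s * upper_factor B r s * (\<Prod>l<i. (real s)^2 - (real (Suc N + l))^2) * (\<Prod>l<j. (real s)^2 - (real (B - 1 - l))^2) =
        (- 1) ^ j * (wt0 (Suc (N + i)) s * upper_factor (B - j) (r + j) s)"
      using wt0_shift[of "Suc N" i s] upper_factor_extend[OF jB, of r s] by (simp add: mult_ac)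
  qed
  also have "\<dots> = (- 1) ^ j * (\<Sum>s\<in>{Suc N..<B}. wt0 (Suc (N + i)) s * upper_factor (B - j) (r + j) s)"
    by (simp add: sum_distrib_left)
  also have "(\<Sum>s\<in>{Suc N..<B}. wt0 (Suc (N + i)) s * upper_factor (B - j) (r + j) s) =
      (\<Sum>s\<in>{Suc (N + i)..<B - j}. wt0 (Suc (N + i)) s * upper_factor (B - j) (r + j) s)"
  proof (rule sum.mono_neutral_right)
    show "\<forall>s\<in>{Suc N..<B} - {Suc (N + i)..<B - j}. wt0 (Suc (N + i)) s * upper_factor (B - j) (r + j) s = 0"
    proof
      fix s assume "s \<in> {Suc N..<B} - {Suc (N + i)..<B - j}"
      then have "s < Suc (N + i) \<and> 1 \<le> s \<or> B - j \<le> s \<and> s < B - j + (r + j)" by auto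
      then show "wt0 (Suc (N + i)) s * upper_factor (B - j) (r + j) s = 0"
        using wt0_zero[of s "Suc (N + i)"] upper_factor_zero[of "B - j" s "r + j"] by auto
    qed
  qed auto
  also have "\<dots> = (fact (N + i) * fact (A + N + 1 + i) / 2) * (fact (r + j) / fact (N + x + m - j)) *
    real (A choose (N + 1 + r + i + j))"
  proof (cases "i + j < x + m")
    case True
    define n where "n = x + m - i - j"
    have n: "n \<ge> 1" "B - j = Suc (N + i) + n" using True by (auto simp: n_def B_def)
    have args: "N + i + n + (r + j) = A" "2 * (N + i) + 1 + n + (r + j) = A + N + 1 + i" "N + i + n = N + x + m - j"
      "N + i + 1 + (r + j) = N + 1 + r + i + j" "A - (N + 1 + r + i + j) = n - 1" "N + 1 + r + i + j \<le> A"
      using True by (simp_all add: n_def A_def)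
    have "(\<Sum>s\<in>{Suc (N + i)..<B - j}. wt0 (Suc (N + i)) s * upper_factor (B - j) (r + j) s) =
        fact (r + j) * fact A * fact (N + i) * fact (A + N + 1 + i) * real n /
        (2 * fact (N + x + m - j) * fact (N + 1 + r + i + j) * fact n)"
      unfolding n(2) sum_wt0_upper_factor unfolding args(1) unfolding args(2-4) ..
    moreover have "real (A choose (N + 1 + r + i + j)) = fact A / (fact (N + 1 + r + i + j) * fact (n - 1))"
      using binomial_fact[OF args(6), where 'a = real] unfolding args(5) .
    moreover have "fact n = real n * fact (n - 1)"
      using n(1) by (simp add: fact_reduce)
    moreover have "R * F * G * H * t / (2 * X * Y * (t * f)) = (G * H / 2) * (R / X) * (F / (Y * f))"
      if "t \<noteq> 0" for R F G H t X Y f :: real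
      using that by (simp add: mult_ac)
    moreover have "real n \<noteq> 0" using n(1) by simp
    ultimately show ?thesis by (simp only: not_False_eq_True)
  next
    case False
    then have "{Suc (N + i)..<B - j} = {}" "A < N + 1 + r + i + j" by (auto simp: B_def A_def)
    then show ?thesis by (simp only: sum.empty binomial_eq_0 of_nat_0 mult_zero_right)
  qed
  finally show ?thesis by (simp only: mult_ac)
qed

lemma binomial_column_sum:
  "(A + j choose (a + j)) = (\<Sum>k\<le>j. (j choose k) * (A choose (a + k)))" for A j a :: nat
proof -
  have "(j + A choose (a + j)) = (\<Sum>k\<le>a + j. (j choose k) * (A choose (a + j - k)))"
    by (rule vandermonde[symmetric])
  also have "\<dots> = (\<Sum>k\<le>j. (j choose k) * (A choose (a + j - k)))"
    by (rule sum.mono_neutral_right) auto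
  also have "\<dots> = (\<Sum>k\<le>j. (j choose (j - k)) * (A choose (a + k)))"
    by (rule sum.reindex_bij_witness[where i = "\<lambda>k. j - k" and j = "\<lambda>k. j - k"]) auto
  also have "\<dots> = (\<Sum>k\<le>j. (j choose k) * (A choose (a + k)))"
    by (intro sum.cong refl) (simp add: binomial_symmetric[symmetric])
  finally show ?thesis by (simp add: add.commute)
qed

lemma prod_differences: "(\<Prod>i<j. real j - real i) = fact j"
proof -
  have "(\<Prod>i<j. real j - real i) = (\<Prod>i<j. real (Suc i))"
    using prod.nat_diff_reindex[of "\<lambda>i. real (Suc i)" j] by (simp add: of_nat_diff cong: prod.cong_simp)
  then show ?thesis by (simp add: fact_prod_Suc atLeast0LessThan)
qed

text \<open>
  Signs may be ignored in the evaluation, since the sum in question is nonnegative.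
\<close>

lemma abs_fdet_reversed_newton:
  "\<bar>fdet m (\<lambda>i j. \<Prod>l<m - 1 - j. real i - t l)\<bar> = (\<Prod>j<m. fact j)"
proof -
  define p where "p = (\<lambda>j. if j < m then m - 1 - j else j)"
  have p: "p permutes {..<m}"
    by (rule bij_imp_permutes, rule bij_betw_byWitness[where f' = p]) (auto simp: p_def)
  have "fdet m (\<lambda>i j. \<Prod>l<m - 1 - j. real i - t l) = fdet m (\<lambda>i j. \<Prod>l<p j. real i - t l)"
    by (rule fdet_cong) (simp add: p_def)
  also have "\<dots> = fdet m (\<lambda>i j. \<Prod>l<p i. real j - t l)"
    by (rule fdet_transpose[symmetric])
  also have "\<dots> = signof p * fdet m (\<lambda>i j. \<Prod>l<i. real j - t l)"
    by (rule fdet_permute_rows[OF p])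
  also have "fdet m (\<lambda>i j. \<Prod>l<i. real j - t l) = fdet m (\<lambda>i j. \<Prod>l<j. real i - t l)"
    by (rule fdet_transpose)
  also have "\<dots> = (\<Prod>j<m. fact j)"
    unfolding fdet_newton prod_differences ..
  finally show ?thesis by (simp add: abs_mult sign_def prod_nonneg)
qed

text \<open>
  By Vandermonde's convolution, column operations raise the upper index of column \<open>j\<close> by \<open>j\<close>. Then the
  factorials split off, up to a polynomial in the row index of degree \<open>m - 1 - j\<close>.
\<close>

lemma abs_fdet_binomials:
  assumes "m \<ge> 1"
  shows "\<bar>fdet m (\<lambda>i j. real (b + x + m - 1 choose (b + i + j)))\<bar> =
    (\<Prod>i<m. fact (b + x + m - 1 + i) * fact i / (fact (x + m - 1 - i) * fact (b + m - 1 + i)))"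
proof -
  let ?A = "b + x + m - 1"
  have "fdet m (\<lambda>i j. real (?A choose (b + i + j))) = fdet m (\<lambda>i j. real (?A + j choose (b + i + j)))"
    by (rule fdet_column_operations[where c = "\<lambda>j k. real (j choose k)", symmetric])
      (simp_all only: binomial_column_sum of_nat_sum of_nat_mult binomial_n_n of_nat_1)
  also have "\<dots> = fdet m (\<lambda>i j. (1 / (fact (x + m - 1 - i) * fact (b + m - 1 + i))) * fact (?A + j) *
      (\<Prod>l<m - 1 - j. real i - (- real (b + m - 1 - l))))"
  proof (rule fdet_cong)
    fix i j assume ij: "i < m" "j < m"
    have "fact (b + i + j + n) = fact (b + i + j) * (\<Prod>l<n. real (b + i + j + n - l))" for n
    proof (induction n)
      case (Suc n)
      have "(\<Prod>l<Suc n. real (b + i + j + Suc n - l)) = real (b + i + j + Suc n) * (\<Prod>l<n. real (b + i + j + n - l))"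
        by (simp add: prod.lessThan_Suc_shift del: prod.lessThan_Suc)
      then show ?case using Suc by (simp add: algebra_simps)
    qed simp
    from this[of "m - 1 - j"] have "fact (b + m - 1 + i) = fact (b + i + j) * (\<Prod>l<m - 1 - j. real (b + m - 1 + i - l))"
      using ij by (simp add: algebra_simps)
    also have "(\<Prod>l<m - 1 - j. real (b + m - 1 + i - l)) = (\<Prod>l<m - 1 - j. real i - (- real (b + m - 1 - l)))"
      by (intro prod.cong refl) (use ij in \<open>auto simp: of_nat_diff\<close>)
    finally have f: "fact (b + m - 1 + i) = fact (b + i + j) * (\<Prod>l<m - 1 - j. real i - (- real (b + m - 1 - l)))" .
    have nz: "(\<Prod>l<m - 1 - j. real i - (- real (b + m - 1 - l))) \<noteq> 0"
      using f fact_nonzero[of "b + m - 1 + i", where 'a = real] by (metis mult_zero_right)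
    have "b + i + j \<le> ?A + j" "?A + j - (b + i + j) = x + m - 1 - i"
      using ij by auto
    then have "real (?A + j choose (b + i + j)) = fact (?A + j) / (fact (b + i + j) * fact (x + m - 1 - i))"
      using binomial_fact[of "b + i + j" "?A + j", where 'a = real] by simp
    then show "real (?A + j choose (b + i + j)) = (1 / (fact (x + m - 1 - i) * fact (b + m - 1 + i))) * fact (?A + j) *
      (\<Prod>l<m - 1 - j. real i - (- real (b + m - 1 - l)))"
      unfolding f using nz by simp
  qed
  also have "\<dots> = (\<Prod>i<m. 1 / (fact (x + m - 1 - i) * fact (b + m - 1 + i))) * (\<Prod>j<m. fact (?A + j)) *
      fdet m (\<lambda>i j. \<Prod>l<m - 1 - j. real i - (- real (b + m - 1 - l)))"
    by (rule fdet_scale)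
  finally have e: "fdet m (\<lambda>i j. real (?A choose (b + i + j))) = \<dots>" .
  have nn: "\<bar>p * q * c\<bar> = p * q * \<bar>c\<bar>" if "0 \<le> p" "0 \<le> q" for p q c :: real
    using that by (simp add: abs_mult)
  have "\<bar>fdet m (\<lambda>i j. real (?A choose (b + i + j)))\<bar> =
      (\<Prod>i<m. 1 / (fact (x + m - 1 - i) * fact (b + m - 1 + i))) * (\<Prod>j<m. fact (?A + j)) *
      \<bar>fdet m (\<lambda>i j. \<Prod>l<m - 1 - j. real i - (- real (b + m - 1 - l)))\<bar>"
    unfolding e by (rule nn) (intro prod_nonneg; simp)+
  then show ?thesis
    unfolding abs_fdet_reversed_newton by (simp only: prod.distrib prod_dividef mult_1 prod.neutral_const times_divide_eq_left)
qed

theorem gap_sum_product: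
  fixes y z :: nat
  defines "m \<equiv> min y z" and "M \<equiv> max y z"
  shows "gap_sum (Suc N) x y z = (\<Prod>i<m. fact (N + i) * fact (2 * N + 1 + x + M + i) * fact (M - m + i) * fact (N + x + M + i) * fact i /
    (2 * fact (N + x + 1 + i) * fact (x + i) * fact (N + M + i)))"
proof (cases "m = 0")
  case True
  have "{X. X \<subseteq> {Suc N..<Suc N + x} \<and> card X = 0} = {{}}"
    using finite_subset by (auto simp: card_eq_0_iff)
  then show ?thesis using True by (simp add: gap_sum_def m_def vdm_def)
next
  case False
  then have m1: "m \<ge> 1" by simp
  define r where "r = M - m"
  define B where "B = Suc N + x + m"
  define A where "A = N + x + m + r"
  have M: "M = m + r" by (simp add: r_def M_def m_def)
  let ?W = "\<lambda>s. wt0 (Suc N) s * upper_factor B r s"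
  let ?G = "{Suc N..<B}"
  let ?f = "\<lambda>i s. \<Prod>l<i. (real s)^2 - (real (Suc N + l))^2"
  let ?g = "\<lambda>j s. \<Prod>l<j. (real s)^2 - (real (B - 1 - l))^2"
  have "gap_sum (Suc N) x y z = (\<Sum>X | X \<subseteq> ?G \<and> card X = m. (\<Prod>p\<in>X. ?W p) * (vdm X)^2)"
    unfolding gap_sum_def m_def[symmetric]
  proof (rule sum.cong)
    show "{X. X \<subseteq> {Suc N..<Suc N + x + m} \<and> card X = m} = {X. X \<subseteq> ?G \<and> card X = m}"
      by (simp add: B_def)
    fix X assume "X \<in> {X. X \<subseteq> ?G \<and> card X = m}"
    have w: "(\<Prod>p\<in>X. real p) * cross {1..<Suc N} X = (\<Prod>p\<in>X. wt0 (Suc N) p)"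
      unfolding cross_def wt0_def prod.distrib by (subst prod.swap) (rule refl)
    have "cross X {Suc N + x + z..<Suc N + x + y} * cross X {Suc N + x + y..<Suc N + x + z} = cross X {B..<B + r}"
    proof (cases "z \<le> y")
      case True
      then have "m = z" "r = y - z" by (simp_all add: m_def r_def M_def)
      then have e: "Suc N + x + z = B" "Suc N + x + y = B + r" using True by (simp_all add: B_def)
      show ?thesis unfolding e by simp
    next
      case False
      then have "m = y" "r = z - y" by (simp_all add: m_def r_def M_def)
      then have e: "Suc N + x + y = B" "Suc N + x + z = B + r" using False by (simp_all add: B_def)
      show ?thesis unfolding e by simp
    qed
    also have "\<dots> = (\<Prod>p\<in>X. upper_factor B r p)"
      by (simp add: cross_def upper_factor_def)
    finally have u: "cross X {Suc N + x + z..<Suc N + x + y} * cross X {Suc N + x + y..<Suc N + x + z} = (\<Prod>p\<in>X. upper_factor B r p)" .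
    show "(\<Prod>p\<in>X. real p) * (vdm X)^2 * cross {1..<Suc N} X * cross X {Suc N + x + z..<Suc N + x + y} *
        cross X {Suc N + x + y..<Suc N + x + z} = (\<Prod>p\<in>X. ?W p) * (vdm X)^2"
      unfolding prod.distrib w[symmetric] u[symmetric] by (simp only: mult_ac)
  qed
  also have "\<dots> = fdet m (\<lambda>i j. \<Sum>s\<in>?G. ?W s * ?f i s * ?g j s)"
  proof -
    have "fact m * (\<Sum>X | X \<subseteq> ?G \<and> card X = m. (\<Prod>p\<in>X. ?W p) * (vdm X)^2) =
        (\<Sum>h\<in>Pi\<^sub>E {..<m} (\<lambda>_. ?G). (\<Prod>i<m. ?W (h i)) * (disc m h)^2)"
      by (rule sum_tuples_eq_sum_sets[symmetric]) simp
    also have "\<dots> = (\<Sum>h\<in>Pi\<^sub>E {..<m} (\<lambda>_. ?G). (\<Prod>i<m. ?W (h i)) * fdet m (\<lambda>i j. ?f j (h i)) * fdet m (\<lambda>i j. ?g j (h i)))"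
    proof (rule sum.cong[OF refl])
      fix h
      have 1: "disc m h = fdet m (\<lambda>i j. ?f j (h i))" by (rule disc_fdet)
      have 2: "disc m h = fdet m (\<lambda>i j. ?g j (h i))" by (rule disc_fdet)
      have "(disc m h)^2 = fdet m (\<lambda>i j. ?f j (h i)) * fdet m (\<lambda>i j. ?g j (h i))"
        unfolding 1[symmetric] 2[symmetric] by (rule power2_eq_square)
      then show "(\<Prod>i<m. ?W (h i)) * (disc m h)^2 =
          (\<Prod>i<m. ?W (h i)) * fdet m (\<lambda>i j. ?f j (h i)) * fdet m (\<lambda>i j. ?g j (h i))"
        by (simp only: mult.assoc)
    qed
    also have "\<dots> = fact m * fdet m (\<lambda>i j. \<Sum>s\<in>?G. ?W s * ?f i s * ?g j s)"
      by (rule fdet_andreief) simp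
    finally show ?thesis by (simp only: mult_cancel_left fact_nonzero simp_thms)
  qed
  also have "\<dots> = fdet m (\<lambda>i j. (fact (N + i) * fact (A + N + 1 + i) / 2) * ((- 1) ^ j * (fact (r + j) / fact (N + x + m - j))) *
      real (N + 1 + r + x + m - 1 choose (N + 1 + r + i + j)))"
  proof (rule fdet_cong)
    fix i j assume "i < m" "j < m"
    have A: "N + 1 + r + x + m - 1 = N + x + m + r" by simp
    show "(\<Sum>s\<in>?G. ?W s * ?f i s * ?g j s) = (fact (N + i) * fact (A + N + 1 + i) / 2) * ((- 1) ^ j * (fact (r + j) / fact (N + x + m - j))) *
      real (N + 1 + r + x + m - 1 choose (N + 1 + r + i + j))"
      unfolding A B_def A_def by (rule moment) (rule \<open>j < m\<close>)
  qed
  also have "\<dots> = (\<Prod>i<m. fact (N + i) * fact (A + N + 1 + i) / 2) * (\<Prod>j<m. (- 1) ^ j * (fact (r + j) / fact (N + x + m - j))) *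
      fdet m (\<lambda>i j. real (N + 1 + r + x + m - 1 choose (N + 1 + r + i + j)))"
    by (rule fdet_scale)
  finally have eq: "gap_sum (Suc N) x y z = \<dots>" .
  have "0 \<le> gap_sum (Suc N) x y z"
  proof -
    have "0 \<le> (\<Sum>X | X \<subseteq> ?G \<and> card X = m. (\<Prod>p\<in>X. ?W p) * (vdm X)^2)"
    proof (rule sum_nonneg)
      fix X assume "X \<in> {X. X \<subseteq> ?G \<and> card X = m}"
      then have "0 \<le> ?W p" if "p \<in> X" for p
        using that wt0_nonneg[of "Suc N" p] upper_factor_nonneg[of p B r] by (auto simp: subset_iff)
      then show "0 \<le> (\<Prod>p\<in>X. ?W p) * (vdm X)^2" by (intro mult_nonneg_nonneg[OF prod_nonneg zero_le_power2]) blast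
    qed
    then show ?thesis
      using \<open>gap_sum (Suc N) x y z = (\<Sum>X | X \<subseteq> ?G \<and> card X = m. (\<Prod>p\<in>X. ?W p) * (vdm X)^2)\<close> by simp
  qed
  then have "gap_sum (Suc N) x y z = \<bar>gap_sum (Suc N) x y z\<bar>" by simp
  also have "\<dots> = (\<Prod>i<m. fact (N + i) * fact (A + N + 1 + i) / 2) * (\<Prod>j<m. fact (r + j) / fact (N + x + m - j)) *
     (\<Prod>i<m. fact (N + 1 + r + x + m - 1 + i) * fact i / (fact (x + m - 1 - i) * fact (N + 1 + r + m - 1 + i)))"
    unfolding eq abs_mult abs_fdet_binomials[OF m1] abs_prod by (simp add: abs_mult power_abs)
  also have "(\<Prod>j<m. fact (r + j) / fact (N + x + m - j)) = (\<Prod>j<m. fact (r + j)) / (\<Prod>j<m. fact (N + x + 1 + j) :: real)"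
  proof -
    have "(\<Prod>j<m. fact (N + x + 1 + j) :: real) = (\<Prod>j<m. fact (N + x + 1 + (m - 1 - j)))"
      by (rule prod_rev)
    also have "\<dots> = (\<Prod>j<m. fact (N + x + m - j))"
      by (rule prod.cong[OF refl], rule arg_cong[where f = fact]) auto
    finally show ?thesis by (simp add: prod_dividef)
  qed
  also have "(\<Prod>i<m. fact (N + 1 + r + x + m - 1 + i) * fact i / (fact (x + m - 1 - i) * fact (N + 1 + r + m - 1 + i))) =
     (\<Prod>i<m. fact (N + x + M + i)) * (\<Prod>i<m. fact i) / ((\<Prod>i<m. fact (x + i)) * (\<Prod>i<m. fact (N + M + i) :: real))"
  proof -
    have "(\<Prod>j<m. fact (x + j) :: real) = (\<Prod>j<m. fact (x + (m - 1 - j)))"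
      by (rule prod_rev)
    also have "\<dots> = (\<Prod>j<m. fact (x + m - 1 - j))"
      by (rule prod.cong[OF refl], rule arg_cong[where f = fact]) auto
    finally have "(\<Prod>j<m. fact (x + m - 1 - j) :: real) = (\<Prod>j<m. fact (x + j))" ..
    moreover have "N + 1 + r + x + m - 1 + i = N + x + M + i" "N + 1 + r + m - 1 + i = N + M + i" for i
      using M by simp_all
    ultimately show ?thesis
      by (simp only: prod_dividef prod.distrib)
  qed
  finally have "gap_sum (Suc N) x y z = (\<Prod>i<m. fact (N + i) * fact (A + N + 1 + i) / 2) *
      ((\<Prod>j<m. fact (r + j)) / (\<Prod>j<m. fact (N + x + 1 + j))) *
      ((\<Prod>i<m. fact (N + x + M + i)) * (\<Prod>i<m. fact i) / ((\<Prod>i<m. fact (x + i)) * (\<Prod>i<m. fact (N + M + i))))" .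
  moreover have A': "A + N + 1 + i = 2 * N + 1 + x + M + i" for i
    using M by (simp add: A_def)
  moreover have aux: "p * q / w * (c / e) * (f * g / (h * k)) = p * q * c * f * g / (w * e * h * k)"
    for p q w c e f g h k :: real
    by (simp add: mult_ac)
  ultimately show ?thesis
    unfolding prod_dividef prod.distrib r_def[symmetric] A' aux by simp
qed

section \<open>Products of consecutive factorials\<close>

text \<open>
  The superfactorial.
\<close>

definition sf :: "nat \<Rightarrow> real" where "sf n = (\<Prod>i<n. fact i)"

lemma sf_Suc: "sf (Suc n) = sf n * fact n"
  by (simp add: sf_def)

lemma sf_nonzero [simp]: "sf n \<noteq> 0"
  by (simp add: sf_def)

lemma sf_0 [simp]: "sf 0 = 1"
  by (simp add: sf_def)

lemma fact_sf: "fact n = sf (Suc n) / sf n"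
  by (simp add: sf_Suc)

lemma prod_fact_run: "(\<Prod>i<n. fact (c + i)) = sf (c + n) / sf c"
  by (induction n) (simp_all add: sf_Suc del: fact_Suc)

lemma norm1_Suc: "norm1 (Suc n) = norm1 n * fact (2 * n + 1)"
  unfolding norm1_def by simp

lemma prod_odd_fact_run: "(\<Prod>i<n. fact (2 * (c + i) + 1)) = norm1 (c + n) / norm1 c"
proof (induction n)
  case (Suc n)
  show ?case unfolding prod.lessThan_Suc Suc add_Suc_right norm1_Suc by (rule times_divide_eq_left)
qed simp

lemma prod_ph:
  "u \<le> v \<Longrightarrow> v \<le> Suc n \<Longrightarrow> (\<Prod>q\<in>{u..<v}. ph (Suc n) w q) =
    sf (Suc n + w - u) * sf (n + w + v) / (sf (Suc n + w - v) * sf (n + w + u))"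
proof (induction v)
  case (Suc v)
  show ?case
  proof (cases "u = Suc v")
    case False
    then have uv: "u \<le> v" "v \<le> Suc n" using Suc.prems by auto
    have ph: "ph (Suc n) w v = fact (n + w - v) * fact (n + w + v)"
      by (simp add: ph_def)
    have a1: "Suc n + w - v = Suc (n + w - v)" "Suc n + w - Suc v = n + w - v" "n + w + Suc v = Suc (n + w + v)"
      using Suc.prems by auto
    have "(\<Prod>q\<in>{u..<Suc v}. ph (Suc n) w q) = (\<Prod>q\<in>{u..<v}. ph (Suc n) w q) * ph (Suc n) w v"
      using uv(1) by (rule prod.atLeastLessThan_Suc)
    also have "\<dots> = sf (Suc n + w - u) * sf (n + w + v) / (sf (Suc (n + w - v)) * sf (n + w + u)) * (fact (n + w - v) * fact (n + w + v))"
      unfolding Suc.IH[OF uv] ph a1 ..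
    also have "\<dots> = sf (Suc n + w - u) * sf (Suc (n + w + v)) / (sf (n + w - v) * sf (n + w + u))"
    proof -
      have "s * t / (p * f * r) * (f * g) = s * (t * g) / (p * r)" if "f \<noteq> 0" for s t p f r g :: real
        using that by simp
      then show ?thesis unfolding sf_Suc by (metis fact_nonzero)
    qed
    finally show ?thesis unfolding a1 .
  qed simp
qed simp

lemma cross_full_run:
  assumes "u \<le> v"
  shows "cross {1..<Suc n} {Suc n + u..<Suc n + v} =
    sf (n + v) * sf (2 * n + 1 + v) * sf u * sf (Suc n + u) / (sf v * sf (Suc n + v) * sf (n + u) * sf (2 * n + 1 + u))"
proof -
  have r: "(\<Prod>q\<in>{1..<Suc n}. ph (Suc n) w q) = sf (n + w) * sf (2 * n + 1 + w) / (sf w * sf (Suc n + w))" for w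
  proof -
    have "n + w + Suc n = 2 * n + 1 + w" "Suc n + w - 1 = n + w" "Suc n + w - Suc n = w" "n + w + 1 = Suc n + w" by simp_all
    then show ?thesis using prod_ph[of 1 "Suc n" n w] by (simp only:)
  qed
  show ?thesis
    by (subst cross_run) (use assms in \<open>simp_all only: prod_dividef r\<close>, auto)
qed

lemma prod_run: "(\<Prod>p\<in>{Suc e..<Suc e + n}. real p) = fact (e + n) / fact e"
proof (induction n)
  case (Suc n)
  have "{Suc e..<Suc e + Suc n} = insert (Suc (e + n)) {Suc e..<Suc e + n}" by auto
  then have "(\<Prod>p\<in>{Suc e..<Suc e + Suc n}. real p) = real (Suc (e + n)) * (\<Prod>p\<in>{Suc e..<Suc e + n}. real p)"
    by (simp only:) (rule prod.insert; simp)
  then show ?case unfolding Suc by simp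
qed simp

lemma vdm_empty: "vdm {} = 1"
  by (simp add: vdm_def)

lemma vdm_run:
  "vdm {Suc e..<Suc e + n} = sf n * norm1 (e + n) * sf (2 * e + 1) / (norm1 e * sf (2 * e + 1 + n))"
proof (induction n)
  case 0
  then show ?case by (simp add: vdm_def)
next
  case (Suc n)
  let ?A = "{Suc e..<Suc e + n}"
  have "{Suc e..<Suc e + Suc n} = ?A \<union> {Suc (e + n)}" by auto
  then have "vdm {Suc e..<Suc e + Suc n} = vdm ?A * vdm {Suc (e + n)} * cross ?A {Suc (e + n)}"
    by (simp only:) (rule vdm_union; auto)
  moreover have "vdm {Suc (e + n)} = 1"
    unfolding vdm_def by (intro prod.neutral ballI) auto
  moreover have "cross ?A {Suc (e + n)} = (\<Prod>l<n. (real (Suc e + n))^2 - (real (Suc e + l))^2)"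
  proof -
    have "cross ?A {Suc (e + n)} = (\<Prod>q\<in>?A. (real (Suc e + n))^2 - (real q)^2)"
      by (simp add: cross_def)
    also have "\<dots> = (\<Prod>l<n. (real (Suc e + n))^2 - (real (Suc e + l))^2)"
      by (rule prod.reindex_bij_witness[where i = "\<lambda>l. Suc e + l" and j = "\<lambda>q. q - Suc e"]) auto
    finally show ?thesis .
  qed
  moreover have "fact (2 * (e + n) + 1) = fact (2 * e + 1 + n) / fact n * (\<Prod>l<n. (real (Suc e + n))^2 - (real (Suc e + l))^2)"
    using wt0_shift[of "Suc e" n "Suc e + n"] wt0_fact[of e n] wt0_fact[of "e + n" 0] by simp
  ultimately have v: "vdm {Suc e..<Suc e + Suc n} = vdm ?A * (fact (2 * (e + n) + 1) * fact n / fact (2 * e + 1 + n))"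
    by (simp del: fact_Suc)
  have a: "e + Suc n = Suc (e + n)" "2 * e + 1 + Suc n = Suc (2 * e + 1 + n)" by simp_all
  have "s * m * c / (p * q) * (f * g / h) = s * g * (m * f) * c / (p * (q * h))" for s m c p q f g h :: real
    by (simp add: mult_ac)
  then show ?case unfolding v Suc a sf_Suc norm1_Suc .
qed

text \<open>
  This relates the superfactorials of doubled arguments from \<open>vdm_run\<close> to the others and produces the
  power of 2 that cancels the one in \<open>gap_sum\<close>.
\<close>

lemma sf_double:
  "sf (2 * (e + n) + 1) * (norm1 e)^2 * sf (e + n) * sf (Suc e) =
    sf (2 * e + 1) * (norm1 (e + n))^2 * 2 ^ n * sf (Suc (e + n)) * sf e"
proof (induction n)
  case 0
  then show ?case by simp
next
  case (Suc n)
  have a: "e + Suc n = Suc (e + n)" "2 * Suc (e + n) + 1 = Suc (Suc (2 * (e + n) + 1))" by simp_all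
  have f: "fact (Suc (2 * (e + n) + 1)) = 2 * real (Suc (e + n)) * fact (2 * (e + n) + 1)"
    by (simp add: algebra_simps)
  have g: "fact (Suc (e + n)) = real (Suc (e + n)) * fact (e + n)" by simp
  have aux: "S * F * (2 * r * F) * M * (s * f) * c = d * (m * F)^2 * (2 * 2 ^ n) * (s * f * (r * f)) * b"
    if "S * M * s * c = d * m^2 * 2 ^ n * (s * f) * b" for S F r M s f c d m b :: real
  proof -
    have "S * F * (2 * r * F) * M * (s * f) * c = (S * M * s * c) * (2 * r * f * F^2)"
      by (simp add: power2_eq_square)
    also have "\<dots> = d * (m * F)^2 * (2 * 2 ^ n) * (s * f * (r * f)) * b"
      unfolding that by (simp add: power_mult_distrib power2_eq_square)
    finally show ?thesis .
  qed
  show ?case unfolding a sf_Suc[of "Suc (2 * (e + n) + 1)"] sf_Suc[of "2 * (e + n) + 1"] sf_Suc[of "Suc (e + n)"] sf_Suc[of "e + n"]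
      norm1_Suc f g power_Suc
    by (rule aux) (use Suc in \<open>simp only: sf_Suc[of "e + n"]\<close>)
qed

lemma gap_sum_sf:
  assumes "m = min y z" "M = max y z"
  shows "gap_sum (Suc n) x y z * (2 ^ m * sf (n + x + 1 + m) * sf (x + m) * sf (n + M + m) * sf n * sf (2 * n + 1 + x + M) * sf (M - m) * sf (n + x + M)) =
    sf (n + m) * sf (2 * n + 1 + x + M + m) * sf M * sf (n + x + M + m) * sf m * sf (n + x + 1) * sf x * sf (n + M)"
proof -
  have M: "M - m + m = M" using assms by simp
  have "gap_sum (Suc n) x y z = (\<Prod>i<m. fact (n + i) * fact (2 * n + 1 + x + M + i) * fact (M - m + i) * fact (n + x + M + i) * fact i /
    (2 * fact (n + x + 1 + i) * fact (x + i) * fact (n + M + i)))"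
    unfolding assms by (rule gap_sum_product)
  also have "\<dots> = sf (n + m) / sf n * (sf (2 * n + 1 + x + M + m) / sf (2 * n + 1 + x + M)) * (sf M / sf (M - m)) *
      (sf (n + x + M + m) / sf (n + x + M)) * sf m /
      (2 ^ m * (sf (n + x + 1 + m) / sf (n + x + 1)) * (sf (x + m) / sf x) * (sf (n + M + m) / sf (n + M)))"
    unfolding prod_dividef prod.distrib prod_fact_run prod_constant card_lessThan sf_def[symmetric] M ..
  also have "\<dots> * (2 ^ m * sf (n + x + 1 + m) * sf (x + m) * sf (n + M + m) * sf n * sf (2 * n + 1 + x + M) * sf (M - m) * sf (n + x + M)) =
    sf (n + m) * sf (2 * n + 1 + x + M + m) * sf M * sf (n + x + M + m) * sf m * sf (n + x + 1) * sf x * sf (n + M)"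
  proof -
    have "p1 / p2 * (q1 / q2) * (r1 / r2) * (s1 / s2) * t / (w * (u1 / u2) * (v1 / v2) * (x1 / x2)) *
        (w * u1 * v1 * x1 * p2 * q2 * r2 * s2) = p1 * q1 * r1 * s1 * t * u2 * v2 * x2"
      if "p2 \<noteq> 0" "q2 \<noteq> 0" "r2 \<noteq> 0" "s2 \<noteq> 0" "w \<noteq> 0" "u1 \<noteq> 0" "v1 \<noteq> 0" "x1 \<noteq> 0" "u2 \<noteq> 0" "v2 \<noteq> 0" "x2 \<noteq> 0"
      for p1 p2 q1 q2 r1 r2 s1 s2 t w u1 u2 v1 v2 x1 x2 :: real
      unfolding times_divide_eq_left times_divide_eq_right divide_divide_eq_left divide_divide_eq_right
      by (subst nonzero_divide_eq_eq) (use that in \<open>simp_all only: mult_eq_0_iff de_Morgan_disj simp_thms mult_ac\<close>)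
    then show ?thesis by simp
  qed
  finally show ?thesis .
qed

section \<open>The value of the factor common to all ferns\<close>

text \<open>
  Which of the four factors are trivial depends on the order of \<open>y\<close> and \<open>z\<close>, but the product has the same form in
  both cases.
\<close>

lemma fern_core:
  fixes n x y z :: nat
  defines "d \<equiv> n + x"
  shows "cross {1..<Suc n} {Suc n + x + y..<Suc n + x + z} * (\<Prod>p\<in>{Suc n + x + z..<Suc n + x + y}. real p) *
    vdm {Suc n + x + z..<Suc n + x + y} * vdm {Suc n + x + y..<Suc n + x + z} * gap_sum (Suc n) x y z =
    sf (Suc (d + y)) * sf d * sf (2 * n + 1 + (x + y + z)) * sf (d + y + z) * sf x * norm1 (d + y) * norm1 (d + z) *
      sf (2 * d + 1) * sf y * sf z * sf (n + z) * sf (n + y) /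
    (sf (d + y) * sf (2 * n + 1 + (x + y)) * sf (d + y) * sf (Suc (d + z)) * sf (x + z) * norm1 d * norm1 d *
      sf (2 * d + 1 + (y + z)) * sf n * sf (n + y + z))" (is "?L = ?R")
proof (cases "z \<le> y")
  case True
  then obtain t where t: "y = z + t" using le_iff_add by blast
  define e where "e = d + z"
  have s: "{Suc n + x + y..<Suc n + x + z} = {}" "{Suc n + x + z..<Suc n + x + y} = {Suc e..<Suc e + t}"
    using t by (auto simp: e_def d_def)
  have c: "e + t = d + y" "2 * e + 1 + t = 2 * d + 1 + (y + z)" "d + z = e"
    using t by (simp_all add: e_def)
  have P: "(\<Prod>p\<in>{Suc e..<Suc e + t}. real p) = sf (Suc (d + y)) * sf e / (sf (d + y) * sf (Suc e))"
    unfolding prod_run c fact_sf by simp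
  have V: "vdm {Suc e..<Suc e + t} = sf t * norm1 (d + y) * sf (2 * e + 1) / (norm1 e * sf (2 * d + 1 + (y + z)))"
    unfolding vdm_run c ..
  have S: "sf (2 * e + 1) * (norm1 d)^2 * sf e * sf (Suc d) = sf (2 * d + 1) * (norm1 e)^2 * 2 ^ z * sf (Suc e) * sf d"
    using sf_double[of d z] unfolding c .
  have m: "z = min y z" "y = max y z" "y - z = t" using t by simp_all
  have args: "n + x + 1 + z = Suc e" "n + y + z = n + y + z" "2 * n + 1 + x + y = 2 * n + 1 + (x + y)" "n + x + y + z = d + y + z" "n + x + y = d + y"
    "2 * n + 1 + x + y + z = 2 * n + 1 + (x + y + z)" "n + x + 1 = Suc d"
    by (simp_all add: d_def e_def)
  have G: "gap_sum (Suc n) x y z * (2 ^ z * sf (Suc e) * sf (x + z) * sf (n + y + z) * sf n * sf (2 * n + 1 + (x + y)) * sf t * sf (d + y)) =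
    sf (n + z) * sf (2 * n + 1 + (x + y + z)) * sf y * sf (d + y + z) * sf z * sf (Suc d) * sf x * sf (n + y)"
    using gap_sum_sf[OF m(1,2), of n x] unfolding m(3) unfolding args(1) args(4) args(6) unfolding args(3) args(5) args(7) .
  have "1 * (p1 * p2 / (p3 * p4)) * (v1 * v2 * v3 / (v4 * v5)) * 1 * g =
      p1 * d1 * g2 * g4 * g7 * v2 * v4 * d2 * g3 * g5 * g1 * g8 / (p3 * h5 * p3 * p4 * h3 * d3 * d3 * v5 * h6 * h4)"
    if "v3 * d3^2 * p2 * g6 = d2 * v4^2 * w * p4 * d1"
      "g * (w * p4 * h3 * h4 * h6 * h5 * v1 * p3) = g1 * g2 * g3 * g4 * g5 * g6 * g7 * g8"
      "p3 \<noteq> 0" "p4 \<noteq> 0" "v4 \<noteq> 0" "v5 \<noteq> 0" "h3 \<noteq> 0" "h4 \<noteq> 0" "h5 \<noteq> 0" "h6 \<noteq> 0" "d3 \<noteq> 0" "w \<noteq> 0" "v1 \<noteq> 0" "g6 \<noteq> 0"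
    for p1 p2 p3 p4 v1 v2 v3 v4 v5 g d1 d2 d3 g1 g2 g3 g4 g5 g6 g7 g8 h3 h4 h5 h6 w :: real
  proof -
    have v3: "v3 * p2 = d2 * v4^2 * w * p4 * d1 / (d3^2 * g6)"
      by (rule eq_divide_imp) (use that(3-) in simp, use that(1) in \<open>simp only: mult_ac\<close>)
    have g: "g = g1 * g2 * g3 * g4 * g5 * g6 * g7 * g8 / (w * p4 * h3 * h4 * h6 * h5 * v1 * p3)"
      by (rule eq_divide_imp) (use that(3-) in simp, rule that(2))
    have h: "1 * (p1 * p2 / (p3 * p4)) * (v1 * v2 * v3 / (v4 * v5)) * 1 * g = (v3 * p2) * (p1 * v1 * v2 / (p3 * p4 * v4 * v5) * g)"
      by (simp add: mult_ac)
    show ?thesis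
      unfolding h unfolding v3 g power2_eq_square times_divide_eq_left times_divide_eq_right divide_divide_eq_left
        divide_divide_eq_right mult_1_left mult_1_right
      by (subst frac_eq_eq) (use that(3-) in \<open>simp_all only: mult_eq_0_iff de_Morgan_disj simp_thms mult_ac\<close>)
  qed
  note aux = this
  show ?thesis
    unfolding s P V cross_empty c(3) vdm_empty
    by (rule aux[OF S G]) simp_all
next
  case False
  then have "y \<le> z" by simp
  then obtain t where t: "z = y + t" using le_iff_add by blast
  define e where "e = d + y"
  have s: "{Suc n + x + z..<Suc n + x + y} = {}" "{Suc n + x + y..<Suc n + x + z} = {Suc e..<Suc e + t}"
    using t by (auto simp: e_def d_def)
  have c: "e + t = d + z" "2 * e + 1 + t = 2 * d + 1 + (y + z)" "d + y = e" "d + y + z = e + z"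
    using t by (simp_all add: e_def)
  have V: "vdm {Suc e..<Suc e + t} = sf t * norm1 (d + z) * sf (2 * e + 1) / (norm1 e * sf (2 * d + 1 + (y + z)))"
    unfolding vdm_run c ..
  have S: "sf (2 * e + 1) * (norm1 d)^2 * sf e * sf (Suc d) = sf (2 * d + 1) * (norm1 e)^2 * 2 ^ y * sf (Suc e) * sf d"
    using sf_double[of d y] unfolding c .
  have i: "{Suc n + (x + y)..<Suc n + (x + z)} = {Suc e..<Suc e + t}"
    unfolding s(2)[symmetric] by (simp only: add.assoc)
  have C: "cross {1..<Suc n} {Suc e..<Suc e + t} =
    sf (d + z) * sf (2 * n + 1 + (x + z)) * sf (x + y) * sf (Suc e) / (sf (x + z) * sf (Suc (d + z)) * sf e * sf (2 * n + 1 + (x + y)))"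
  proof -
    have "n + (x + z) = d + z" "n + (x + y) = e" "Suc n + (x + z) = Suc (d + z)" "Suc n + (x + y) = Suc e"
      by (simp_all add: d_def e_def)
    moreover have "x + y \<le> x + z" using t by simp
    ultimately show ?thesis using cross_full_run[of "x + y" "x + z" n] unfolding i by (simp only:)
  qed
  have m: "y = min y z" "z = max y z" "z - y = t" using t by simp_all
  have args: "n + x + 1 + y = Suc e" "n + z + y = n + y + z" "2 * n + 1 + x + z = 2 * n + 1 + (x + z)" "n + x + z + y = e + z" "n + x + z = d + z"
    "2 * n + 1 + x + z + y = 2 * n + 1 + (x + y + z)" "n + x + 1 = Suc d"
    by (simp_all add: d_def e_def)
  have G: "gap_sum (Suc n) x y z * (2 ^ y * sf (Suc e) * sf (x + y) * sf (n + y + z) * sf n * sf (2 * n + 1 + (x + z)) * sf t * sf (d + z)) =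
    sf (n + y) * sf (2 * n + 1 + (x + y + z)) * sf z * sf (e + z) * sf y * sf (Suc d) * sf x * sf (n + z)"
    using gap_sum_sf[OF m(1,2), of n x] unfolding m(3) unfolding args(1) args(4) args(6) unfolding args(2) args(3) args(5) args(7) .
  have "(c1 * c2 * c3 * c4 / (c5 * c6 * c7 * c8)) * 1 * 1 * (v1 * v2 * v3 / (v4 * v5)) * g =
      c4 * d1 * g2 * g4 * g7 * v4 * v2 * d2 * g5 * g3 * g8 * g1 / (c7 * c8 * c7 * c6 * c5 * d3 * d3 * v5 * h5 * h4)"
    if "v3 * d3^2 * c7 * g6 = d2 * v4^2 * w * c4 * d1"
      "g * (w * c4 * c3 * h4 * h5 * c2 * v1 * c1) = g1 * g2 * g3 * g4 * g5 * g6 * g7 * g8"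
      "c1 \<noteq> 0" "c2 \<noteq> 0" "c3 \<noteq> 0" "c4 \<noteq> 0" "c5 \<noteq> 0" "c6 \<noteq> 0" "c7 \<noteq> 0" "c8 \<noteq> 0" "v4 \<noteq> 0" "v5 \<noteq> 0" "h4 \<noteq> 0" "h5 \<noteq> 0" "d3 \<noteq> 0" "w \<noteq> 0" "v1 \<noteq> 0" "g6 \<noteq> 0"
    for c1 c2 c3 c4 c5 c6 c7 c8 v1 v2 v3 v4 v5 g d1 d2 d3 g1 g2 g3 g4 g5 g6 g7 g8 h4 h5 w :: real
  proof -
    have v3: "v3 = d2 * v4^2 * w * c4 * d1 / (d3^2 * c7 * g6)"
      by (rule eq_divide_imp) (use that(3-) in simp, use that(1) in \<open>simp only: mult_ac\<close>)
    have g: "g = g1 * g2 * g3 * g4 * g5 * g6 * g7 * g8 / (w * c4 * c3 * h4 * h5 * c2 * v1 * c1)"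
      by (rule eq_divide_imp) (use that(3-) in simp, rule that(2))
    show ?thesis
      unfolding v3 g power2_eq_square times_divide_eq_left times_divide_eq_right divide_divide_eq_left
        divide_divide_eq_right mult_1_left mult_1_right
      by (subst frac_eq_eq) (use that(3-) in \<open>simp_all only: mult_eq_0_iff de_Morgan_disj simp_thms mult_ac\<close>)
  qed
  note aux = this
  show ?thesis
    unfolding s C V c(4) c(3) vdm_empty prod.empty
    by (rule aux[OF S G]) simp_all
qed

lemma fern_factor_value:
  "fern_factor (Suc n) x y z =
    (sf (Suc (n + x + y)) * sf (n + x) * sf (2 * n + 1 + (x + y + z)) * sf (n + x + y + z) * sf x * norm1 (n + x + y) * norm1 (n + x + z) *
      sf (2 * (n + x) + 1) * sf y * sf z * sf (n + z) * sf (n + y) /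
    (sf (n + x + y) * sf (2 * n + 1 + (x + y)) * sf (n + x + y) * sf (Suc (n + x + z)) * sf (x + z) * norm1 (n + x) * norm1 (n + x) *
      sf (2 * (n + x) + 1 + (y + z)) * sf n * sf (n + y + z))) /
    (sf (Suc (n + y)) / sf (n + y) / (sf (Suc n) / sf n) *
     (sf y * norm1 (n + y) * sf (2 * n + 1) / (norm1 n * sf (2 * n + 1 + y))) *
     (sf z * norm1 (n + z) * sf (2 * n + 1) / (norm1 n * sf (2 * n + 1 + z))) *
     (sf (n + z) * sf (2 * n + 1 + z) * sf (Suc n) / (sf z * sf (Suc n + z) * sf n * sf (2 * n + 1))))"
proof -
  have c: "cross {1..<Suc n} {Suc n..<Suc n + z} = sf (n + z) * sf (2 * n + 1 + z) * sf (Suc n) / (sf z * sf (Suc n + z) * sf n * sf (2 * n + 1))"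
    using cross_full_run[of 0 z n] by (simp only: add_0_right sf_0 mult_1_right le0 simp_thms)
  show ?thesis
    unfolding fern_factor_def fern_core prod_run vdm_run c unfolding fact_sf ..
qed

section \<open>The products T and V as products of factorials\<close>

text \<open>
  The product of the first \<open>k\<close> odd numbers.
\<close>

definition oddf :: "nat \<Rightarrow> real" where "oddf k = (\<Prod>j<k. real (2 * j + 1))"

lemma oddf_pos: "0 < oddf k"
  unfolding oddf_def by (rule prod_pos) simp

lemma rising2_oddf:
  assumes "int k + l \<ge> 0"
  shows "rising2 (2 * real k + 1) l = oddf (nat (int k + l)) / oddf k"
proof (cases "l \<ge> 0")
  case True
  have "rising2 (2 * real k + 1) l = (\<Prod>j<nat l. real (2 * (k + j) + 1))"
    using True by (simp add: rising2_def algebra_simps)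
  moreover have "nat (int k + l) = k + nat l"
    using True by linarith
  ultimately show ?thesis
    using oddf_pos[of k] by (simp only: oddf_def prod_lessThan_add) simp
next
  case False
  have *: "(\<Prod>j = 1..r. 2 * real k + 1 - 2 * real j) * oddf (k - r) = oddf k" if "r \<le> k" for r
    using that
  proof (induction r)
    case (Suc r)
    have "k - r = Suc (k - Suc r)" using Suc.prems by simp
    then have 1: "oddf (k - r) = oddf (k - Suc r) * real (2 * (k - Suc r) + 1)"
      by (simp only: oddf_def prod.lessThan_Suc)
    have 2: "2 * real k + 1 - 2 * real (Suc r) = real (2 * (k - Suc r) + 1)"
      using Suc.prems by (simp add: of_nat_diff)
    have 3: "(\<Prod>j = 1..Suc r. 2 * real k + 1 - 2 * real j) =
        (\<Prod>j = 1..r. 2 * real k + 1 - 2 * real j) * (2 * real k + 1 - 2 * real (Suc r))"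
      by simp
    have "(\<Prod>j = 1..Suc r. 2 * real k + 1 - 2 * real j) * oddf (k - Suc r) =
        (\<Prod>j = 1..r. 2 * real k + 1 - 2 * real j) * oddf (k - r)"
      unfolding 1 3 2 by (simp only: mult_ac)
    then show ?case using Suc.IH Suc.prems by (simp only: Suc_leD)
  qed simp
  have r: "nat (- l) \<le> k" "nat (int k + l) = k - nat (- l)" using False assms by linarith+
  have "rising2 (2 * real k + 1) l = 1 / (\<Prod>j = 1..nat (- l). 2 * real k + 1 - 2 * real j)"
    using False by (simp add: rising2_def)
  also have "\<dots> = oddf (k - nat (- l)) / oddf k"
  proof -
    have "1 / p = q / o'" if "p * q = o'" "0 < o'" for p q o' :: real
      using that by (auto simp: field_simps)
    from this[OF *[OF r(1)] oddf_pos] show ?thesis .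
  qed
  finally show ?thesis unfolding r(2) .
qed

lemma V_oddf:
  "V (2 * real c + 1) (int y + int z - 1) y = (\<Prod>i<y. oddf (c + z + i)) / (\<Prod>i<y. oddf (c + i))"
proof -
  have "V (2 * real c + 1) (int y + int z - 1) y = (\<Prod>i<y. oddf (c + z + (y - 1 - i)) / oddf (c + i))"
    unfolding V_def
  proof (rule prod.cong[OF refl])
    fix i assume "i \<in> {..<y}"
    then have i: "i < y" by simp
    have "2 * real c + 1 + 2 * real i = 2 * real (c + i) + 1" by simp
    moreover have "rising2 (2 * real (c + i) + 1) (int y + int z - 1 - 2 * int i) =
        oddf (nat (int (c + i) + (int y + int z - 1 - 2 * int i))) / oddf (c + i)"
      by (rule rising2_oddf) (use i in linarith)
    moreover have "nat (int (c + i) + (int y + int z - 1 - 2 * int i)) = c + z + (y - 1 - i)"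
      using i by linarith
    ultimately show "rising2 (2 * real c + 1 + 2 * real i) (int y + int z - 1 - 2 * int i) =
        oddf (c + z + (y - 1 - i)) / oddf (c + i)"
      by (simp only:)
  qed
  then show ?thesis
    unfolding prod_dividef using prod_rev[of "\<lambda>i. oddf (c + z + i)" y] by simp
qed

lemma oddf_fact: "oddf (Suc k) = fact (2 * k + 1) / (2 ^ k * fact k)"
proof -
  have "oddf (Suc k) * (2 ^ k * fact k) = fact (2 * k + 1)"
  proof (induction k)
    case (Suc k)
    have o: "oddf (Suc (Suc k)) = oddf (Suc k) * real (2 * k + 3)"
      unfolding oddf_def by (subst prod.lessThan_Suc) simp
    have f: "fact (2 * Suc k + 1) = real (2 * k + 3) * (2 * real (Suc k) * fact (2 * k + 1))"
      by (simp add: algebra_simps)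
    have g: "fact (Suc k) = real (Suc k) * (fact k :: real)" by simp
    have "p * t * (2 * q * (s * f)) = t * (2 * s * (p * (q * f)))" for p t q s f :: real
      by simp
    then show ?case unfolding o f g power_Suc Suc[symmetric] .
  qed (simp add: oddf_def)
  then show ?thesis by (simp add: eq_divide_eq)
qed

lemma prod_oddf_run:
  "(\<Prod>i<y. oddf (Suc c + i)) = norm1 (c + y) * sf c / (norm1 c * (\<Prod>i<y. 2 ^ (c + i)) * sf (c + y))"
proof -
  have "(\<Prod>i<y. oddf (Suc c + i)) = (\<Prod>i<y. fact (2 * (c + i) + 1) / (2 ^ (c + i) * fact (c + i)))"
    by (simp only: add_Suc oddf_fact)
  also have "\<dots> = norm1 (c + y) / norm1 c / ((\<Prod>i<y. 2 ^ (c + i)) * (sf (c + y) / sf c))"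
    unfolding prod_dividef prod.distrib prod_odd_fact_run prod_fact_run ..
  finally show ?thesis
    by (simp only: times_divide_eq_left times_divide_eq_right divide_divide_eq_left divide_divide_eq_right mult.assoc)
qed

lemma V_run:
  "V (2 * real (Suc e) + 1) (int y + int z - 1) y =
    norm1 (e + z + y) * sf (e + z) * norm1 e * sf (e + y) / (norm1 (e + z) * 2 ^ (z * y) * sf (e + z + y) * norm1 (e + y) * sf e)"
proof -
  have two: "(\<Prod>i<y. 2 ^ (e + z + i)) = 2 ^ (z * y) * (\<Prod>i<y. 2 ^ (e + i) :: real)"
  proof -
    have "(\<Prod>i<y. 2 ^ (e + z + i) :: real) = (\<Prod>i<y. 2 ^ z * 2 ^ (e + i))"
      by (simp add: power_add mult_ac)
    then show ?thesis by (simp only: prod.distrib prod_constant card_lessThan power_mult)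
  qed
  have nz: "(\<Prod>i<y. 2 ^ (e + i) :: real) \<noteq> 0" by simp
  have "(p1 * p2 / (p3 * (w * t) * p4)) / (q1 * q2 / (q3 * t * q4)) = p1 * p2 * q3 * q4 / (p3 * w * p4 * q1 * q2)"
    if "t \<noteq> 0" for p1 p2 p3 p4 q1 q2 q3 q4 w t :: real
    using that by (simp add: mult_ac)
  note aux = this[OF nz]
  show ?thesis
    unfolding V_oddf add_Suc[of e z] prod_oddf_run two by (rule aux)
qed

lemma T_sf:
  assumes "u = real (Suc v)" "k = int r + int m - 1"
  shows "T u k m = sf (v + r + m) / sf (v + r) / (sf (v + m) / sf v)"
  unfolding assms T_fact prod_dividef prod_fact_run ..

section \<open>The two-segment fern\<close>

lemma psi_product:
  "(\<Prod>q\<in>{1..<Suc a}. psi (Suc (a + b)) x y z q) =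
    sf (a + b + (x + y)) * sf (a + b + (x + y) + Suc a) / (sf (b + (x + y)) * sf (Suc (a + b) + (x + y))) *
    (sf (a + b + z) * sf (a + b + z + Suc a) / (sf (b + z) * sf (Suc (a + b) + z))) /
    (sf (a + b + (x + z)) * sf (a + b + (x + z) + Suc a) / (sf (b + (x + z)) * sf (Suc (a + b) + (x + z))) *
     (sf (a + b + y) * sf (a + b + y + Suc a) / (sf (b + y) * sf (Suc (a + b) + y))))"
proof -
  have "(\<Prod>q\<in>{1..<Suc a}. ph (Suc (a + b)) w q) =
      sf (a + b + w) * sf (a + b + w + Suc a) / (sf (b + w) * sf (Suc (a + b) + w))" for w
  proof -
    have "Suc (a + b) + w - 1 = a + b + w" "Suc (a + b) + w - Suc a = b + w" "a + b + w + 1 = Suc (a + b) + w" by simp_all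
    then show ?thesis using prod_ph[of 1 "Suc a" "a + b" w] by (simp only:)
  qed
  then show ?thesis unfolding psi_def prod_dividef prod.distrib by (simp only:)
qed

lemma K'_over_P':
  assumes "b + w \<ge> 1"
  shows "K' [Suc a, b, x, w] / P' (w + b - 1) (w + b - 1) (Suc a) =
    sf w * norm1 (a + b + x + w) * sf (2 * (a + b + x) + 1) / (norm1 (a + b + x) * sf (2 * (a + b + x) + 1 + w)) /
    (sf w * norm1 (a + b + w) * sf (2 * (a + b) + 1) / (norm1 (a + b) * sf (2 * (a + b) + 1 + w))) *
    (sf (b + (x + w)) * sf (2 * (a + b) + 1 + (x + w)) / (sf (x + w) * sf (a + b + (x + w) + Suc a)) /
     (sf (b + x) * sf (2 * (a + b) + 1 + x) / (sf x * sf (a + b + x + Suc a)))) /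
    (sf (b + w) * sf (2 * (a + b) + 1 + w) / (sf w * sf (a + b + w + Suc a)) /
     (sf b * sf (2 * (a + b) + 1) / sf (a + b + Suc a)))"
proof -
  let ?n = "a + b"
  let ?B = "{Suc a..<Suc ?n}"
  let ?X = "{Suc ?n + x..<Suc ?n + (x + w)}" and ?Y = "{Suc ?n..<Suc ?n + w}"
  have "segments True [Suc a, b, x, w] = (+) (Suc a) ` ({..<b} \<union> (+) b ` {x..<x + w})"
    by (subst segments_Cons, subst segments_Cons) (simp add: two_term_list)
  also have "\<dots> = ?B \<union> ?X"
    unfolding image_Un lessThan_atLeast0 image_add_atLeastLessThan
    by (simp only: add_0_left add_ac add_Suc add_Suc_right)
  finally have seg: "segments True [Suc a, b, x, w] = ?B \<union> ?X" .
  have dj: "?B \<inter> ?X = {}" by auto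
  have "card (segments True [Suc a, b, x, w]) = b + w"
    unfolding seg by (subst card_Un_disjoint[OF _ _ dj]) simp_all
  then have "K' [Suc a, b, x, w] = orth (?B \<union> ?X)"
    unfolding seg[symmetric] using assms by (intro K'_eq_orth) (simp_all add: term_at_def)
  also have "\<dots> = vdm ?B * vdm ?X * cross ?B ?X / norm2 (b + w)"
    using orth_union[of ?B ?X] by simp
  finally have K: "K' [Suc a, b, x, w] = \<dots>" .
  have "P' (w + b - 1) (w + b - 1) (Suc a) = orth {Suc a..<Suc a + (w + b - 1) + 1}"
    by (rule P'_eq_orth) simp
  also have "{Suc a..<Suc a + (w + b - 1) + 1} = ?B \<union> ?Y"
    using assms by auto
  also have "orth (?B \<union> ?Y) = vdm ?B * vdm ?Y * cross ?B ?Y / norm2 (b + w)"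
    using orth_union[of ?B ?Y] by simp
  finally have P: "P' (w + b - 1) (w + b - 1) (Suc a) = \<dots>" .
  have ph: "(\<Prod>q\<in>?B. ph (Suc ?n) v q) = sf (b + v) * sf (2 * ?n + 1 + v) / (sf v * sf (?n + v + Suc a))" for v
  proof -
    have "Suc ?n + v - Suc a = b + v" "Suc ?n + v - Suc ?n = v" "?n + v + Suc ?n = 2 * ?n + 1 + v" by simp_all
    then show ?thesis using prod_ph[of "Suc a" "Suc ?n" ?n v] by (simp only:)
  qed
  have cX: "cross ?B ?X = (\<Prod>q\<in>?B. ph (Suc ?n) (x + w) q) / (\<Prod>q\<in>?B. ph (Suc ?n) x q)"
    by (subst cross_run) (auto simp: prod_dividef)
  have cY: "cross ?B ?Y = (\<Prod>q\<in>?B. ph (Suc ?n) w q) / (\<Prod>q\<in>?B. ph (Suc ?n) 0 q)"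
    using cross_run[of ?B "Suc ?n" 0 w] by (simp add: prod_dividef)
  have X: "?X = {Suc (?n + x)..<Suc (?n + x) + w}" by (simp add: add.assoc)
  have "K' [Suc a, b, x, w] / P' (w + b - 1) (w + b - 1) (Suc a) = vdm ?X / vdm ?Y * cross ?B ?X / cross ?B ?Y"
    unfolding K P using vdm_nonzero[of ?B] norm_nonzero(2)[of "b + w"] by (simp add: field_simps)
  then show ?thesis
    unfolding cX cY ph unfolding X vdm_run add_0_right sf_0 mult_1_left .
qed

theorem M_H8_two_product:
  assumes a: "a \<ge> 1" and b: "z + b \<ge> 1"
  shows "M_H8 x y z [a, b] =
          P y (y + 2 * a - 2) b * P' (z + b - 1) (z + b - 1) a * K' [a, b, x, y + z]
            / P' (y + z + b - 1) (y + z + b - 1) a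
          * (V (2 * real a + 2 * real b + 1) (int y + int z - 1) y
             / V (2 * real x + 2 * real a + 2 * real b + 1) (int y + int z - 1) y)
          * (T (real x + real b + 1) (int y + int z + 2 * int a - 2) y
             * T (2 * real a + real b) (int y + int b - 1) b
             * T (real z + 1) (int y + int b - 1) b
             / (T (real b + 1) (int y + int z + 2 * int a - 2) y
                * T (real x + 2 * real a + real b) (int y + int b - 1) b
                * T (real x + real z + 1) (int y + int b - 1) b))"
proof -
  obtain c where c: "a = Suc c" using a by (cases a) auto
  have V1: "V (2 * real a + 2 * real b + 1) (int y + int z - 1) y = V (2 * real (Suc (c + b)) + 1) (int y + int z - 1) y"
    by (simp add: c algebra_simps)
  have V2: "V (2 * real x + 2 * real a + 2 * real b + 1) (int y + int z - 1) y = V (2 * real (Suc (c + b + x)) + 1) (int y + int z - 1) y"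
    by (simp add: c algebra_simps)
  have T1: "T (real x + real b + 1) (int y + int z + 2 * int a - 2) y =
      sf (x + b + (z + 2 * c + 1) + y) / sf (x + b + (z + 2 * c + 1)) / (sf (x + b + y) / sf (x + b))"
    by (rule T_sf) (simp_all add: c)
  have T2: "T (2 * real a + real b) (int y + int b - 1) b =
      sf (2 * c + 1 + b + y + b) / sf (2 * c + 1 + b + y) / (sf (2 * c + 1 + b + b) / sf (2 * c + 1 + b))"
    by (rule T_sf) (simp_all add: c)
  have T3: "T (real z + 1) (int y + int b - 1) b = sf (z + y + b) / sf (z + y) / (sf (z + b) / sf z)"
    by (rule T_sf) simp_all
  have T4: "T (real b + 1) (int y + int z + 2 * int a - 2) y =
      sf (b + (z + 2 * c + 1) + y) / sf (b + (z + 2 * c + 1)) / (sf (b + y) / sf b)"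
    by (rule T_sf) (simp_all add: c)
  have T5: "T (real x + 2 * real a + real b) (int y + int b - 1) b =
      sf (x + 2 * c + 1 + b + y + b) / sf (x + 2 * c + 1 + b + y) / (sf (x + 2 * c + 1 + b + b) / sf (x + 2 * c + 1 + b))"
    by (rule T_sf) (simp_all add: c)
  have T6: "T (real x + real z + 1) (int y + int b - 1) b = sf (x + z + y + b) / sf (x + z + y) / (sf (x + z + b) / sf (x + z))"
    by (rule T_sf) simp_all
  have "(\<Prod>q\<in>{1..<Suc c}. psi (Suc (c + b)) x y z q) * fern_factor (Suc (c + b)) x y z =
      K' [Suc c, b, x, y + z] / P' (y + z + b - 1) (y + z + b - 1) (Suc c) *
      (V (2 * real (Suc (c + b)) + 1) (int y + int z - 1) y / V (2 * real (Suc (c + b + x)) + 1) (int y + int z - 1) y) *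
      (T (real x + real b + 1) (int y + int z + 2 * int a - 2) y
             * T (2 * real a + real b) (int y + int b - 1) b
             * T (real z + 1) (int y + int b - 1) b
             / (T (real b + 1) (int y + int z + 2 * int a - 2) y
                * T (real x + 2 * real a + real b) (int y + int b - 1) b
                * T (real x + real z + 1) (int y + int b - 1) b))"
    \<comment> \<open>Both sides become quotients of products of superfactorials and of \<open>norm1\<close>. After
      cross-multiplication the same factors occur on both sides, once their arguments are brought into
      the form of sorted sums.\<close>
    apply (subst psi_product, subst fern_factor_value, subst K'_over_P')
    subgoal using b by linarith
    apply (simp only: V_run T1 T2 T3 T4 T5 T6)
    apply (simp only: times_divide_eq_left times_divide_eq_right divide_divide_eq_left divide_divide_eq_right)
    apply (subst frac_eq_eq)
    subgoal by simp
    subgoal by simp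
    apply (simp only: mult_2 Suc_eq_plus1 add_0_left add_0_right add_ac)
    by (simp only: mult_ac)
  moreover have "a + b = Suc (c + b)" by (simp add: c)
  ultimately show ?thesis
    unfolding M_H8_two[OF a b] V1 V2 by (simp only: c mult.assoc times_divide_eq_left times_divide_eq_right)
qed
theorem theorem2p9:
  fixes x y z :: nat
  shows
    "(\<forall>a b :: nat. a \<ge> 1 \<and> z + b \<ge> 1 \<longrightarrow>
        M_H8 x y z [a, b] =
          P y (y + 2 * a - 2) b * P' (z + b - 1) (z + b - 1) a * K' [a, b, x, y + z]
            / P' (y + z + b - 1) (y + z + b - 1) a
          * (V (2 * real a + 2 * real b + 1) (int y + int z - 1) y
             / V (2 * real x + 2 * real a + 2 * real b + 1) (int y + int z - 1) y)
          * (T (real x + real b + 1) (int y + int z + 2 * int a - 2) y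
             * T (2 * real a + real b) (int y + int b - 1) b
             * T (real z + 1) (int y + int b - 1) b
             / (T (real b + 1) (int y + int z + 2 * int a - 2) y
                * T (real x + 2 * real a + real b) (int y + int b - 1) b
                * T (real x + real z + 1) (int y + int b - 1) b)))
     \<and>
     (\<forall>(k :: nat) (a :: nat list).
        k \<ge> 2 \<and> length a = 2 * k \<and> term_at a 1 \<ge> 1 \<and> z + even_sum a \<ge> 1 \<longrightarrow>
        M_H8 x y z a =
          M_H8 x y z [odd_sum a, even_sum a]
          * (Q ([0, term_at a 1 - 1] @ tl a @ [y])
             * K' (butlast a @ [term_at a (2 * k) + z])
             / (P y (y + 2 * odd_sum a - 2) (even_sum a)
                * P' (z + even_sum a - 1) (z + even_sum a - 1) (odd_sum a)))
          * (\<Prod>i = 2..k.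
               T_factor a i (real x + real z + real (even_tail i a) + 1)
               * T_factor a i (real y + real (even_tail i a) + 1)
               / (T_factor a i (real x + real y + real (even_tail i a) + 1)
                  * T_factor a i (real z + real (even_tail i a) + 1))
               * (T_factor a i (real x + real y + sigma a i)
                  * T_factor a i (real z + sigma a i)
                  / (T_factor a i (real x + real z + sigma a i)
                     * T_factor a i (real y + sigma a i)))))"
  by (intro conjI allI impI; elim conjE) (rule M_H8_two_product M_H8_fern; assumption)+

end
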